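(* Let $a\ne b$ be complex numbers and let $P$ vary in $U_d$. Then for any fixed complex polynomial $Q$ with $Q(a)=Q(b)=0$, the Center Set of the Abel equation $y'=p(x)y^3+q(x)y^2$, $p=P'$, $q=Q'$, in $U_d$ consists of the Composition Set and possibly a finite set of additional points.
   Context: $\mathcal P_d$ is the space of all complex polynomials of degree at most $d$ vanishing at $a$ and $b$. $U_d$ is the linear subspace of all $P\in\mathcal P_d$ such that all the degrees of $x$ appearing in $P$ with non-zero coefficients are powers of prime numbers. The Abel equation has a center on $[a,b]$ if every solution with sufficiently small initial value $y(a)$, analytically continued along the segment from $a$ to $b$, satisfies $y(a)=y(b)$. The Center Set in $U_d$ is the set of $P\in U_d$ for which the equation has a center on $[a,b]$. The Composition Set in $U_d$ is the set of $P\in U_d$ for which there exist polynomials $\tilde P,\tilde Q,W$ with $W(a)=W(b)$, $P=\tilde P(W)$, $Q=\tilde Q(W)$. *)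

theory Defs
  imports "HOL-Complex_Analysis.Complex_Analysis" "HOL-Number_Theory.Prime_Powers"
begin

definition poly_space :: "complex \<Rightarrow> complex \<Rightarrow> nat \<Rightarrow> complex poly set" where
  "poly_space a b d = {P. degree P \<le> d \<and> poly P a = 0 \<and> poly P b = 0}"

text \<open>
  The exponent in a prime power is positive, so neither the constant nor the linear monomial
  may occur in an element of this subspace.
\<close>
definition prime_power_space :: "complex \<Rightarrow> complex \<Rightarrow> nat \<Rightarrow> complex poly set" where
  "prime_power_space a b d =
     {P \<in> poly_space a b d. \<forall>n. coeff P n \<noteq> 0 \<longrightarrow> primepow n}"

definition abel_solution_on ::
  "complex poly \<Rightarrow> complex poly \<Rightarrow> complex set \<Rightarrow> (complex \<Rightarrow> complex) \<Rightarrow> bool" where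
  "abel_solution_on p q S y \<longleftrightarrow>
     (\<forall>x\<in>S. (y has_field_derivative (poly p x * y x ^ 3 + poly q x * y x ^ 2)) (at x))"

text \<open>
  A solution germ at \<open>a\<close> that continues analytically along the segment is the germ of a
  single-valued holomorphic solution on some open neighbourhood \<open>S\<close> of the segment, because the
  segment is an embedded arc.  For all sufficiently small initial values such a continuation
  exists, so the quantification over solutions below ranges over all of them.
\<close>
definition abel_center ::
  "complex \<Rightarrow> complex \<Rightarrow> complex poly \<Rightarrow> complex poly \<Rightarrow> bool" where
  "abel_center a b p q \<longleftrightarrow>
     (\<exists>\<epsilon>>0. \<forall>S y. open S \<longrightarrow> closed_segment a b \<subseteq> S \<longrightarrow> abel_solution_on p q S y \<longrightarrow>
        norm (y a) < \<epsilon> \<longrightarrow> y a = y b)"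

definition center_set ::
  "complex \<Rightarrow> complex \<Rightarrow> complex poly \<Rightarrow> nat \<Rightarrow> complex poly set" where
  "center_set a b Q d =
     {P \<in> prime_power_space a b d. abel_center a b (pderiv P) (pderiv Q)}"

definition composition_set ::
  "complex \<Rightarrow> complex \<Rightarrow> complex poly \<Rightarrow> nat \<Rightarrow> complex poly set" where
  "composition_set a b Q d =
     {P \<in> prime_power_space a b d.
        \<exists>P' Q' W. poly W a = poly W b \<and> P = pcompose P' W \<and> Q = pcompose Q' W}"

end

theory Submission
  imports Defs "HOL-Computational_Algebra.Computational_Algebra"
begin

text \<open>
  The center equations \<open>\<psi> k (b) = 0\<close>, \<open>k \<ge> 2\<close>, are polynomial in the coefficients of \<open>P\<close>, and composition
  is a constructible condition. So if infinitely many centers were not compositions, then for each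
  \<open>N\<close> there would be arbitrarily large non-compositions satisfying the first \<open>N\<close> equations. Normalise
  them and pass to a limit \<open>P\<close> of norm 1: the leading term of the rescaled equations says that all
  moments \<open>\<integral> P ^ k dQ\<close> over \<open>[a, b]\<close> vanish. The degree of \<open>P\<close> is a prime power \<open>n = p ^ r\<close>, and in that
  case there is a single \<open>V\<close> with \<open>V(a) = V(b)\<close> such that \<open>P\<close> and all \<open>R\<close> with vanishing moments
  \<open>\<integral> P ^ k dR\<close> lie in \<open>\<complex>[V]\<close>. Split the normalised sequence along a linear projection onto the
  polynomials in \<open>V\<close> vanishing at \<open>a\<close>. The complementary parts, renormalised, have a limit \<open>C\<close> with
  \<open>\<integral> P ^ k C dQ = 0\<close>; hence \<open>C \<in> \<complex>[V]\<close>, although \<open>C\<close> is a nonzero element of the complement.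

  For the moment problem, the vanishing of the Cauchy transform of \<open>dQ\<close> along \<open>P\<close> is, near infinity,
  a linear relation between the values of \<open>Q' / P'\<close> on the fibres of \<open>P\<close>, with branches of
  \<open>log ((b - x) / (a - x))\<close> as coefficients. Two choices of the branches differ by an integral relation.
  The primitive part of \<open>x ^ n - 1\<close> is irreducible, so either every such relation is invariant under the
  monodromy of order \<open>p\<close> at infinity or every \<open>R\<close> with vanishing moments is. In the second case the
  fibres of \<open>P\<close> and of all these \<open>R\<close> have common nontrivial classes, which are the fibres of a
  polynomial. The first case is impossible: the elementary symmetric functions of the classes of
  points with equal monodromy are polynomials, and the logarithms force the classes to be trivial.
\<close>

section \<open>Moments of polynomials\<close>

text \<open>The degree may drop in the limit \<open>x\<close>; because every exponent in the
  sequence is a prime power, \<open>degree x\<close> is one whatever it turns out to be. The moment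
  theorem has to produce one \<open>V\<close> for all \<open>R\<close>, since it is used twice with
  the same \<open>x\<close>: once for \<open>Q\<close>, once for the primitive of
  \<open>c dQ\<close>. Only when \<open>dQ\<close> and \<open>c dQ\<close> both come from the same
  \<open>V\<close> can \<open>c\<close> be recovered as their quotient. The power -1/2 of the norm
  comes from weights: the recursion for the first integral is homogeneous when \<open>p\<close> has
  weight 2 and \<open>q\<close> weight 1, so dividing \<open>P\<close> by \<open>t\<close> has the
  effect of multiplying \<open>Q\<close> by \<open>t\<close> to the power -1/2. Without
  \<open>Q\<close> the equation is separable and always has a center, hence the first information
  sits in the term linear in that small factor. A constructible set carries finitely many
  conditions, so a member of the sequence solves only its first \<open>N\<close> equations; every
  fixed equation still holds from some index on, and this is all the limits use. The approximating
  compositions solve all equations, which makes difference quotients possible.\<close>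

definition pint :: "complex \<Rightarrow> complex poly \<Rightarrow> complex poly" where
  "pint a f = (let F = (\<Sum>i\<le>degree f. monom (coeff f i / of_nat (Suc i)) (Suc i)) in F - [:poly F a:])"

lemma pderiv_sum: "pderiv (\<Sum>i\<in>I. f i) = (\<Sum>i\<in>I. pderiv (f i :: complex poly))"
  by (induction I rule: infinite_finite_induct) (simp_all add: pderiv_add)

lemma pderiv_pint [simp]: "pderiv (pint a f) = f"
proof -
  have "pderiv (pint a f) = (\<Sum>i\<le>degree f. monom (coeff f i) i)"
    by (simp add: pint_def Let_def pderiv_diff pderiv_pCons pderiv_sum pderiv_monom del: of_nat_Suc)
  then show ?thesis by (simp add: poly_as_sum_of_monoms)
qed

lemma poly_pint_start [simp]: "poly (pint a f) a = 0"
  by (simp add: pint_def Let_def)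

lemma pint_unique:
  assumes "pderiv R = f" "poly R a = 0" shows "pint a f = R"
proof -
  have "pderiv (pint a f - R) = 0" using assms(1) by (simp add: pderiv_diff)
  then have "degree (pint a f - R) = 0" by (simp add: pderiv_eq_0_iff)
  then obtain c where c: "pint a f - R = [:c:]" using degree_eq_zeroE by blast
  have "poly (pint a f - R) a = 0" using assms(2) by simp
  then have "c = 0" unfolding c by simp
  then show ?thesis using c by simp
qed

lemma pint_add: "pint a (f + g) = pint a f + pint a g"
  by (rule pint_unique) (simp_all add: pderiv_add)

lemma pint_smult: "pint a (smult c f) = smult c (pint a f)"
  by (rule pint_unique) (simp_all add: pderiv_smult)

lemma pint_0 [simp]: "pint a 0 = 0"
  by (rule pint_unique) simp_all

lemma pint_pcompose: "pint a (pcompose f W * pderiv W) = pcompose (pint (poly W a) f) W"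
  by (rule pint_unique) (simp_all add: pderiv_pcompose poly_pcompose)

lemma contour_integral_pint:
  "(poly f has_contour_integral poly (pint a f) b) (linepath a b)"
  using contour_integral_primitive[of UNIV "poly (pint a f)" "poly f" "linepath a b"] poly_DERIV[of "pint a f"]
  by simp

text \<open>Taking the value at \<open>b\<close> of a primitive instead of a path integral keeps the
  moments algebraic, so that substitution and limits act on coefficients.\<close>

definition moments_vanish :: "complex \<Rightarrow> complex \<Rightarrow> complex poly \<Rightarrow> complex poly \<Rightarrow> bool" where
  "moments_vanish a b P Q \<longleftrightarrow> (\<forall>k. poly (pint a (P ^ k * pderiv Q)) b = 0)"

lemma pcompose_power: "pcompose (p ^ k) (q :: complex poly) = pcompose p q ^ k"
  by (induction k) (simp_all add: pcompose_mult pcompose_1)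

text \<open>Substitution of \<open>W\<close>. The new end points \<open>poly W a\<close> and
  \<open>poly W b\<close> may coincide, which is where the recursion in
  \<open>moment_composition\<close> stops.\<close>

lemma moments_vanish_pcompose:
  "moments_vanish a b (pcompose A W) (pcompose B W) \<longleftrightarrow> moments_vanish (poly W a) (poly W b) A B"
proof -
  have "pcompose A W ^ k * pderiv (pcompose B W) = pcompose (A ^ k * pderiv B) W * pderiv W" for k
    by (simp add: pderiv_pcompose pcompose_mult pcompose_power mult_ac)
  then show ?thesis unfolding moments_vanish_def by (simp add: pint_pcompose poly_pcompose)
qed

section \<open>Relations on a cyclic orbit of prime power length\<close>

text \<open>The absorption identity shows that \<open>p ^ k\<close> divides \<open>j\<close> times
  the binomial coefficient; if \<open>p\<close> did not divide the latter, \<open>p ^ k\<close>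
  would divide the smaller number \<open>j\<close>.\<close>

lemma prime_dvd_prime_power_choose:
  assumes "prime p" "0 < j" "j < p ^ k"
  shows "p dvd (p ^ k choose j)"
proof (rule ccontr)
  assume nd: "\<not> p dvd (p ^ k choose j)"
  have "j * (p ^ k choose j) = p ^ k * ((p ^ k - 1) choose (j - 1))"
    using assms by (metis binomial_absorption One_nat_def Suc_pred' mult.commute prime_gt_0_nat times_binomial_minus1_eq)
  then have "p ^ k dvd j * (p ^ k choose j)" by simp
  moreover have "coprime (p ^ k) (p ^ k choose j)"
    using nd assms(1) by (simp add: prime_imp_coprime)
  ultimately have "p ^ k dvd j" by (simp add: coprime_dvd_mult_left_iff)
  then show False using assms by (simp add: nat_dvd_not_less)
qed

text \<open>For \<open>m = p ^ k\<close> this is the cyclotomic polynomial of order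
  \<open>p ^ Suc k\<close>.\<close>

definition cycl :: "nat \<Rightarrow> nat \<Rightarrow> int poly" where
  "cycl p m = (\<Sum>t<p. monom 1 (m * t))"

lemma cycl_times: "cycl p m * (monom 1 m - 1) = monom 1 (m * p) - 1"
proof -
  have "cycl p m = (\<Sum>t<p. (monom 1 m) ^ t)" unfolding cycl_def by (simp add: monom_power)
  then have "(monom 1 m - 1) * cycl p m = monom 1 m ^ p - 1"
    by (simp add: power_diff_1_eq)
  then show ?thesis by (simp add: monom_power mult.commute)
qed

lemma poly_shift_power_coeff:
  "coeff ([:1, 1::int:] ^ n) i = int (n choose i)"
proof (cases "i \<le> n")
  case True
  then show ?thesis using coeff_linear_power[of 1 1] by (simp add: coeff_linear_poly_power)
next
  case False
  then show ?thesis by (simp add: coeff_eq_0 degree_linear_power)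
qed

lemma dvd_shift_power_coeff:
  assumes "prime p"
  shows "int p dvd coeff ([:1, 1::int:] ^ (p ^ k) - (monom 1 (p ^ k) + 1)) i"
proof -
  consider "i = 0" | "i = p ^ k" | "i > p ^ k" | "0 < i" "i < p ^ k" by linarith
  then show ?thesis
  proof cases
    case 4
    then have "int p dvd int (p ^ k choose i)"
      using prime_dvd_prime_power_choose[OF assms] by (subst int_dvd_int_iff)
    then show ?thesis using 4 by (simp add: poly_shift_power_coeff)
  next
    case 3
    then show ?thesis by (simp add: poly_shift_power_coeff binomial_eq_0)
  qed (use prime_gt_0_nat[OF assms] in \<open>auto simp: poly_shift_power_coeff\<close>)
qed

lemma cycl_degree: "p > 0 \<Longrightarrow> m > 0 \<Longrightarrow> degree (cycl p m) = m * (p - 1)"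
  and cycl_lead: "p > 0 \<Longrightarrow> m > 0 \<Longrightarrow> lead_coeff (cycl p m) = 1"
proof -
  assume pm: "p > 0" "m > 0"
  have "degree (cycl p m) \<le> m * (p - 1)"
    unfolding cycl_def using pm by (intro degree_sum_le) (auto simp: degree_monom_eq)
  moreover have c: "coeff (cycl p m) (m * (p - 1)) = 1"
  proof -
    have "coeff (cycl p m) (m * (p - 1)) = (\<Sum>t<p. if t = p - 1 then 1 else 0)"
      unfolding cycl_def coeff_sum using pm by (intro sum.cong) (auto simp: coeff_monom)
    then show ?thesis using pm by simp
  qed
  ultimately show "degree (cycl p m) = m * (p - 1)"
    by (metis le_antisym le_degree zero_neq_one)
  with c show "lead_coeff (cycl p m) = 1" by simp
qed

text \<open>Modulo \<open>p\<close> the power \<open>?X ^ ?m\<close> is \<open>x ^ m + 1\<close>,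
  and likewise for \<open>m * p\<close>. The identity \<open>cycl_times\<close>, shifted by one,
  therefore reads: the shifted polynomial times \<open>x ^ m\<close> is \<open>x ^ (m * p)\<close>
  modulo \<open>p\<close>.\<close>

lemma cycl_shift_coeff:
  assumes p: "prime p" and i: "i < p ^ k * (p - 1)"
  shows "int p dvd coeff (pcompose (cycl p (p ^ k)) [:1,1:]) i"
proof -
  let ?m = "p ^ k" and ?X = "[:1, 1::int:]"
  let ?P = "pcompose (cycl p ?m) ?X"
  obtain T where T: "?X ^ ?m = monom 1 ?m + 1 + smult (int p) T"
  proof -
    have "[:int p:] dvd ?X ^ ?m - (monom 1 ?m + 1)"
      unfolding const_poly_dvd_iff using dvd_shift_power_coeff[OF p, of k] by blast
    then obtain T where "?X ^ ?m - (monom 1 ?m + 1) = [:int p:] * T" by (rule dvdE)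
    then show ?thesis using that[of T] by (simp add: diff_eq_eq add.commute)
  qed
  obtain T' where T': "?X ^ (?m * p) = monom 1 (?m * p) + 1 + smult (int p) T'"
  proof -
    have "[:int p:] dvd ?X ^ (p ^ Suc k) - (monom 1 (p ^ Suc k) + 1)"
      unfolding const_poly_dvd_iff using dvd_shift_power_coeff[OF p, of "Suc k"] by blast
    then obtain T where "?X ^ (p ^ Suc k) - (monom 1 (p ^ Suc k) + 1) = [:int p:] * T" by (rule dvdE)
    then show ?thesis using that[of T] by (simp add: diff_eq_eq add.commute mult.commute)
  qed
  have "pcompose (monom 1 j) ?X = ?X ^ j" for j
    by (induction j) (auto simp: monom_0 monom_Suc pcompose_pCons one_pCons)
  then have "?P * (?X ^ ?m - 1) = ?X ^ (?m * p) - 1"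
    using arg_cong[OF cycl_times[of p ?m], of "\<lambda>q. pcompose q ?X"] by (simp add: pcompose_mult pcompose_diff pcompose_1)
  then have "?P * monom 1 ?m = monom 1 (?m * p) + smult (int p) (T' - ?P * T)"
    unfolding T T' by (simp add: algebra_simps smult_diff_right)
  then have "coeff (?P * monom 1 ?m) (i + ?m) = coeff (monom 1 (?m * p) + smult (int p) (T' - ?P * T)) (i + ?m)"
    by simp
  moreover have "i + ?m < ?m * p" using i p prime_gt_0_nat[OF p] by (cases p) auto
  ultimately show ?thesis by (simp add: mult.commute[of ?P] coeff_monom_mult)
qed

text \<open>Eisenstein's criterion at \<open>x + 1\<close>. The value at 1 is exactly
  \<open>p\<close>, so one of two factors has a value at 1 prime to \<open>p\<close>, and that
  factor is shown to be a unit.\<close>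

lemma irreducible_cycl:
  assumes p: "prime p"
  shows "irreducible (cycl p (p ^ k))"
proof -
  let ?m = "p ^ k" let ?F = "cycl p ?m" and ?N = "p ^ k * (p - 1)"
  have p0: "p > 1" using p prime_gt_1_nat by blast
  have deg: "degree ?F = ?N" and lead: "lead_coeff ?F = 1" using cycl_degree[of p ?m] cycl_lead[of p ?m] p0 by auto
  have val1: "poly ?F 1 = int p" by (simp add: cycl_def poly_sum poly_monom)
  have *: False if ab: "?F = a * b" and a1: "\<not> int p dvd poly a 1" and bu: "\<not> is_unit a" for a b
  proof -
    have "degree a + degree b = ?N" "lead_coeff a * lead_coeff b = 1"
      using deg lead ab p0 by (auto simp: degree_mult_eq lead_coeff_mult dest: arg_cong[of _ _ degree])
       (metis degree_0 degree_mult_eq lead_coeff_mult leading_coeff_0_iff mult_eq_0_iff zero_neq_one)+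
    then have ua: "is_unit (lead_coeff a)" "is_unit (lead_coeff b)" by (metis dvd_triv_left, metis dvd_triv_right)
    have "degree a \<noteq> 0"
    proof
      assume "degree a = 0"
      then obtain c where "a = [:c:]" using degree_eq_zeroE by blast
      then show False using ua bu by (simp add: is_unit_const_poly_iff)
    qed
    define A where "A = pcompose a [:1,1:]"
    define B where "B = pcompose b [:1,1:]"
    have AB: "pcompose ?F [:1,1:] = A * B" unfolding A_def B_def ab by (simp add: pcompose_mult)
    have A0: "coeff A 0 = poly a 1" unfolding A_def by (simp flip: poly_0_coeff_0 add: poly_pcompose)
    have "lead_coeff B = lead_coeff b" unfolding B_def by (subst lead_coeff_comp) auto
    then have "\<not> int p dvd lead_coeff B" using ua p0
      by (metis dvd_trans int_dvd_int_iff nat_dvd_1_iff_1 of_nat_1 order_less_irrefl)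
    then have ex: "\<exists>i. \<not> int p dvd coeff B i" by blast
    \<comment> \<open>In coefficient \<open>i\<close> of \<open>A * B\<close> all terms but
      \<open>coeff A 0 * coeff B i\<close> are divisible by \<open>p\<close>. As \<open>a\<close> is
      not constant, \<open>i\<close> is below the top degree, so the whole coefficient is divisible
      as well.\<close>
    define i where "i = (LEAST i. \<not> int p dvd coeff B i)"
    have i: "\<not> int p dvd coeff B i" unfolding i_def using ex by (rule LeastI_ex)
    have below: "int p dvd coeff B j" if "j < i" for j using not_less_Least[of j] that unfolding i_def by blast
    have "i \<le> degree B" using i le_degree by (metis dvd_0_right)
    moreover have "degree B = degree b" unfolding B_def by (simp add: degree_pcompose)
    ultimately have iN: "i < ?N" using \<open>degree a + degree b = ?N\<close> \<open>degree a \<noteq> 0\<close> by linarith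
    have "coeff (A * B) i = coeff A 0 * coeff B i + (\<Sum>j\<in>{1..i}. coeff A j * coeff B (i - j))"
      unfolding coeff_mult by (subst sum.atMost_shift) (simp add: sum.atLeast1_atMost_eq lessThan_Suc_atMost atLeast0LessThan)
    moreover have "int p dvd (\<Sum>j\<in>{1..i}. coeff A j * coeff B (i - j))"
      by (intro dvd_sum dvd_mult below) auto
    moreover have "int p dvd coeff (A * B) i" using cycl_shift_coeff[OF p iN] AB by simp
    ultimately have "int p dvd coeff A 0 * coeff B i" by (simp add: dvd_add_left_iff)
    then show False using i a1 A0 p by (simp add: prime_dvd_mult_iff)
  qed
  show ?thesis
  proof (rule irreducibleI)
    show "?F \<noteq> 0" using lead by auto
    show "\<not> is_unit ?F"
    proof
      assume "is_unit ?F"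
      then have "degree ?F \<le> degree (1 :: int poly)" by (rule dvd_imp_degree_le) simp
      then have "degree ?F = 0" by simp
      then show False using deg p0 by simp
    qed
    fix a b assume ab: "?F = a * b"
    have pv: "poly a 1 * poly b 1 = int p" using ab val1 by (metis poly_mult)
    have "\<not> (int p dvd poly a 1 \<and> int p dvd poly b 1)"
    proof
      assume "int p dvd poly a 1 \<and> int p dvd poly b 1"
      then have "int p * int p dvd int p" using pv by (metis mult_dvd_mono)
      then show False using p0 by (metis int_dvd_int_iff of_nat_mult dvd_mult_cancel1 nat_dvd_1_iff_1 not_one_less_zero order_less_irrefl gr0I)
    qed
    then show "is_unit a \<or> is_unit b" using *[OF ab] *[of b a] ab by (auto simp: mult.commute)
  qed
qed


section \<open>Integer polynomials acting on sequences by the shift\<close>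

definition shift_act :: "int poly \<Rightarrow> (nat \<Rightarrow> complex) \<Rightarrow> nat \<Rightarrow> complex" where
  "shift_act g s j = (\<Sum>i\<le>degree g. of_int (coeff g i) * s (i + j))"

lemma shift_act_bound: "degree g \<le> N \<Longrightarrow> shift_act g s j = (\<Sum>i\<le>N. of_int (coeff g i) * s (i + j))"
  unfolding shift_act_def by (intro sum.mono_neutral_left) (auto simp: coeff_eq_0)

lemma shift_act_add: "shift_act (g + h) s j = shift_act g s j + shift_act h s j"
proof -
  let ?N = "max (degree g) (degree h)"
  show ?thesis
    by (subst (1 2 3) shift_act_bound[of _ ?N]) (auto simp: degree_add_le sum.distrib algebra_simps)
qed

lemma shift_act_smult: "shift_act (smult a g) s j = of_int a * shift_act g s j"
  by (subst shift_act_bound[of _ "degree g"]) (auto simp: degree_smult_le shift_act_def sum_distrib_left mult_ac)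

lemma shift_act_pCons: "shift_act (pCons a g) s j = of_int a * s j + shift_act g s (Suc j)"
proof -
  have "shift_act (pCons a g) s j = (\<Sum>i\<le>Suc (degree g). of_int (coeff (pCons a g) i) * s (i + j))"
    by (rule shift_act_bound) (rule degree_pCons_le)
  then show ?thesis by (simp only: sum.atMost_Suc_shift) (simp add: shift_act_def)
qed

text \<open>The variable acts as the shift, which makes sequences a module over the integer
  polynomials. Annihilators are therefore ideals.\<close>

lemma shift_act_mult: "shift_act (g * h) s j = shift_act g (shift_act h s) j"
proof (induction g arbitrary: j rule: pCons_induct)
  case 0
  then show ?case by (simp add: shift_act_def)
next
  case (pCons a g)
  then show ?case by (simp add: shift_act_add shift_act_smult shift_act_pCons)
qed

text \<open>The minimal annihilating polynomial of the orbit of \<open>s\<close> contains the irreducible cyclotomic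
  factor, so \<open>f\<close> is a multiple of it.\<close>
lemma cycl_annihilator:
  assumes p: "prime p" and s: "s j0 \<noteq> 0"
    and f: "\<And>j. shift_act f s j = 0" and c: "\<And>j. shift_act (cycl p (p ^ k)) s j = 0"
  shows "cycl p (p ^ k) dvd f"
proof -
  let ?F = "cycl p (p ^ k)"
  have F0: "?F \<noteq> 0" using irreducible_cycl[OF p, of k] by auto
  have pr: "prime_elem ?F" using irreducible_cycl[OF p] by (rule irreducible_imp_prime_elem)
  \<comment> \<open>The ideal generated by \<open>f\<close> and the cyclotomic factor. It need not
    be principal over the integers, so an element \<open>g\<close> of least degree divides the
    others only up to an integer factor, by pseudo-division.\<close>
  define J where "J = {g. \<exists>U V. g = U * f + V * ?F}"
  have J0: "shift_act g s j = 0" if gJ: "g \<in> J" for g j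
  proof -
    obtain U V where g: "g = U * f + V * ?F" using gJ unfolding J_def by blast
    have "shift_act f s = (\<lambda>_. 0)" "shift_act ?F s = (\<lambda>_. 0)" using f c by auto
    then show ?thesis unfolding g shift_act_add shift_act_mult by (simp add: shift_act_def)
  qed
  have FJ: "?F \<in> J" "f \<in> J" unfolding J_def
    by (rule CollectI, rule exI[of _ 0], rule exI[of _ 1], simp)
      (rule CollectI, rule exI[of _ 1], rule exI[of _ 0], simp)
  then have "?F \<in> J - {0}" using F0 by simp
  from ex_has_least_nat[of "\<lambda>g. g \<in> J - {0}", OF this, of degree]
  obtain g where g: "g \<in> J" "g \<noteq> 0" and min: "\<And>h. h \<in> J \<Longrightarrow> h \<noteq> 0 \<Longrightarrow> degree g \<le> degree h"
    by auto
  have div: "\<exists>a q. a \<noteq> 0 \<and> smult a h = g * q" if h: "h \<in> J" for h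
  proof -
    obtain a q where aq: "a \<noteq> 0" "smult a h = g * q + pseudo_mod h g"
      using pseudo_mod(1)[OF g(2), of h] by blast
    obtain U V where hU: "h = U * f + V * ?F" using h unfolding J_def by blast
    obtain U' V' where gU: "g = U' * f + V' * ?F" using g(1) unfolding J_def by blast
    have "pseudo_mod h g = (smult a U - U' * q) * f + (smult a V - V' * q) * ?F"
      using aq(2) unfolding hU gU by (simp add: algebra_simps smult_add_right)
    then have pJ: "pseudo_mod h g \<in> J" unfolding J_def by (intro CollectI exI)
    have "pseudo_mod h g = 0"
    proof (rule ccontr)
      assume "pseudo_mod h g \<noteq> 0"
      with min[OF pJ] pseudo_mod(2)[OF g(2), of h] show False by simp
    qed
    then show ?thesis using aq by (intro exI[of _ a] exI[of _ q]) simp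
  qed
  have nd: "\<not> ?F dvd smult a 1" if "a \<noteq> 0" for a
  proof
    assume "?F dvd smult a 1"
    then have "degree ?F \<le> degree (smult a (1 :: int poly))" by (rule dvd_imp_degree_le) (use that in simp)
    moreover have "degree ?F = p ^ k * (p - 1)" using cycl_degree[of p "p ^ k"] prime_gt_0_nat[OF p] by simp
    ultimately show False using prime_gt_1_nat[OF p] by simp
  qed
  have smult1: "smult a h = smult a 1 * h" for a and h :: "int poly" by simp
  obtain a q where aq: "a \<noteq> 0" "smult a ?F = g * q" using div[OF FJ(1)] by blast
  have "?F dvd g * q" unfolding aq(2)[symmetric] by (rule dvd_smult) simp
  then consider "?F dvd g" | "?F dvd q" using pr by (auto simp: prime_elem_dvd_mult_iff)
  then show ?thesis
  proof cases
    case 1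
    obtain b r where br: "b \<noteq> 0" "smult b f = g * r" using div[OF FJ(2)] by blast
    have "?F dvd smult b 1 * f" unfolding smult1[symmetric] br(2) using 1 by (rule dvd_mult2)
    then show ?thesis using prime_elem_dvd_multD[OF pr] nd[OF br(1)] by blast
  next
    \<comment> \<open>Here \<open>g\<close> divides a nonzero constant, so it is itself a constant,
      and a nonzero constant cannot annihilate \<open>s\<close>.\<close>
    case 2
    then obtain r where "q = ?F * r" by (rule dvdE)
    then have "?F * smult a 1 = ?F * (g * r)" using aq(2) by (simp add: mult_ac)
    then have gr: "g * r = smult a 1" using F0 mult_left_cancel[OF F0, of "smult a 1" "g * r"] by (simp only:)
    have "degree g = 0"
    proof -
      have "r \<noteq> 0" using gr aq(1) by auto
      then have "degree g + degree r = degree (smult a (1 :: int poly))"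
        unfolding gr[symmetric] using g(2) by (simp add: degree_mult_eq)
      then show ?thesis by simp
    qed
    then obtain b where b: "g = [:b:]" using degree_eq_zeroE by blast
    then have "shift_act g s j0 = of_int b * s j0" by (simp add: shift_act_def)
    then show ?thesis using J0[OF g(1)] s g(2) b by auto
  qed
qed

text \<open>The cofactor has degree below \<open>m\<close>, so the coefficients of \<open>f\<close>
  are those of the cofactor written \<open>p\<close> times in succession.\<close>

lemma cycl_multiple_periodic:
  assumes p: "p > 1" and m: "m > 0" and f: "cycl p m dvd f" and deg: "degree f < m * p"
  shows "coeff f 0 = coeff f m"
proof -
  obtain h where h: "f = cycl p m * h" using f by blast
  show ?thesis
  proof (cases "h = 0")
    case False
    have "cycl p m \<noteq> 0" using cycl_lead[of p m] p m by auto
    then have "degree f = m * (p - 1) + degree h"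
      using h False cycl_degree[of p m] p m by (simp add: degree_mult_eq)
    then have dh: "degree h < m" using deg p by (cases p) auto
    have "f = (\<Sum>t<p. monom 1 (m * t) * h)" unfolding h cycl_def by (simp add: sum_distrib_right)
    then have cf: "coeff f i = (\<Sum>t<p. if m * t \<le> i then coeff h (i - m * t) else 0)" for i
      by (auto simp: coeff_sum coeff_monom_mult intro!: sum.cong)
    have "coeff f 0 = (\<Sum>t<p. if t = 0 then coeff h 0 else 0)"
      unfolding cf using m by (intro sum.cong) auto
    moreover have "coeff f m = (\<Sum>t<p. if t = 1 then coeff h 0 else 0)"
      unfolding cf using m dh by (intro sum.cong) (auto simp: coeff_eq_0 le_Suc_eq)
    ultimately show ?thesis using p by simp
  qed (use h in simp)
qed

section \<open>Fibres of a polynomial and its inverse branches\<close>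

text \<open>The sheets of \<open>P\<close> over an evenly covered region. Connectedness of
  \<open>D\<close> lets an identity between sheets spread from an open subset to all of
  \<open>D\<close>.\<close>

definition branches :: "complex poly \<Rightarrow> complex set \<Rightarrow> (complex \<Rightarrow> complex) set \<Rightarrow> bool" where
  "branches P D Bs \<longleftrightarrow> open D \<and> connected D \<and> finite Bs \<and>
     (\<forall>\<beta>\<in>Bs. \<beta> holomorphic_on D \<and> (\<forall>w\<in>D. poly P (\<beta> w) = w)) \<and>
     (\<forall>w\<in>D. inj_on (\<lambda>\<beta>. \<beta> w) Bs \<and> {x. poly P x = w} = (\<lambda>\<beta>. \<beta> w) ` Bs)"

lemma branchesD:
  assumes "branches P D Bs"
  shows "open D" "connected D" "finite Bs" "\<And>\<beta>. \<beta> \<in> Bs \<Longrightarrow> \<beta> holomorphic_on D"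
    "\<And>\<beta> w. \<beta> \<in> Bs \<Longrightarrow> w \<in> D \<Longrightarrow> poly P (\<beta> w) = w"
    "\<And>w. w \<in> D \<Longrightarrow> inj_on (\<lambda>\<beta>. \<beta> w) Bs"
    "\<And>w. w \<in> D \<Longrightarrow> {x. poly P x = w} = (\<lambda>\<beta>. \<beta> w) ` Bs"
  using assms unfolding branches_def by auto

lemma branches_obtain:
  assumes "branches P D Bs" "poly P x \<in> D"
  obtains \<beta> where "\<beta> \<in> Bs" "\<beta> (poly P x) = x"
proof -
  have "x \<in> {t. poly P t = poly P x}" by simp
  then show ?thesis using branchesD(7)[OF assms] that by auto
qed

lemma branch_image_open:
  assumes "branches P D Bs" "\<beta> \<in> Bs" "open U" "U \<subseteq> D"
  shows "open (\<beta> ` U)"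
proof -
  have "inj_on \<beta> U" using branchesD(5)[OF assms(1,2)] assms(4) by (metis inj_onI subsetD)
  moreover have "\<beta> holomorphic_on U" using branchesD(4)[OF assms(1,2)] assms(4) by (rule holomorphic_on_subset)
  ultimately show ?thesis using assms(3) open_mapping_thm3 by blast
qed

lemma branch_image_iff:
  assumes "branches P D Bs" "\<beta> \<in> Bs"
  shows "x \<in> \<beta> ` D \<longleftrightarrow> poly P x \<in> D \<and> \<beta> (poly P x) = x"
proof
  assume "x \<in> \<beta> ` D"
  then obtain w where "w \<in> D" "x = \<beta> w" by blast
  then show "poly P x \<in> D \<and> \<beta> (poly P x) = x" using branchesD(5)[OF assms, of w] by simp
next
  assume "poly P x \<in> D \<and> \<beta> (poly P x) = x"
  then show "x \<in> \<beta> ` D" by (intro image_eqI[of _ _ "poly P x"]) simp_all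
qed

lemma card_fibre_le:
  assumes "degree P > 0"
  shows "finite {x. poly P x = (z::complex)}" "card {x. poly P x = z} \<le> degree P"
proof -
  have ne: "P - [:z:] \<noteq> 0" using assms by (metis degree_pCons_0 diff_eq_eq add_0 less_irrefl)
  have eq: "{x. poly P x = z} = {x. poly (P - [:z:]) x = 0}" by auto
  show "finite {x. poly P x = z}" unfolding eq using poly_roots_finite[OF ne] by simp
  have "card {x. poly (P - [:z:]) x = 0} \<le> degree (P - [:z:])" by (rule card_poly_roots_bound[OF ne])
  also have "\<dots> \<le> degree P" by (rule degree_diff_le) auto
  finally show "card {x. poly P x = z} \<le> degree P" unfolding eq .
qed

lemma card_fibre_eq:
  assumes P: "degree P > 0" and nc: "\<And>x. poly P x = z \<Longrightarrow> poly (pderiv P) x \<noteq> 0"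
  shows "card {x. poly P x = (z::complex)} = degree P"
proof -
  let ?A = "P - [:z:]"
  have ne: "?A \<noteq> 0" using P by (metis degree_pCons_0 diff_eq_eq add_0 less_irrefl)
  have eq: "{x. poly P x = z} = {x. poly ?A x = 0}" by auto
  have "rsquarefree ?A" unfolding rsquarefree_roots using nc by (auto simp: pderiv_diff pderiv_pCons)
  then have ord: "order x ?A = 1" if "poly ?A x = 0" for x
    using rsquarefree_root_order[of ?A x] ne that by simp
  have "degree ?A = degree P" using degree_add_eq_left[of "[:-z:]" P] P by (simp add: diff_conv_add_uminus del: add_uminus_conv_diff)
  moreover have "size (proots ?A) = degree ?A" by (rule size_proots_complex)
  moreover have "size (proots ?A) = (\<Sum>x\<in>{x. poly ?A x = 0}. order x ?A)"
    using ne by (simp add: size_multiset_overloaded_eq)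
  moreover have "\<dots> = card {x. poly ?A x = 0}" using ord by simp
  ultimately show ?thesis unfolding eq by simp
qed

text \<open>Each of the \<open>degree P\<close> simple preimages of \<open>z\<close> has a local
  inverse. On a common ball of values these inverses take values in disjoint discs, hence are
  distinct, and their number shows that they exhaust the fibre.\<close>

lemma branches_exist:
  assumes P: "degree P > 0" and nc: "\<And>x. poly P x = z \<Longrightarrow> poly (pderiv P) x \<noteq> 0" and U: "open U" "z \<in> U"
  obtains r Bs where "r > 0" "ball z r \<subseteq> U" "branches P (ball z r) Bs"
proof -
  let ?Z = "{x. poly P x = z}"
  have fin: "finite ?Z" using card_fibre_le[OF P] by blast
  have hol: "poly P holomorphic_on S" for S by (intro holomorphic_intros)
  have dr: "deriv (poly P) x = poly (pderiv P) x" for x by (intro DERIV_imp_deriv poly_DERIV)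
  have "\<exists>\<rho>>0. inj_on (poly P) (ball x \<rho>)" if "x \<in> ?Z" for x
    using has_complex_derivative_locally_invertible[OF hol[of UNIV], of x] nc that dr
    by (metis (mono_tags, lifting) UNIV_I mem_Collect_eq open_UNIV)
  then obtain \<rho> where \<rho>: "\<And>x. x \<in> ?Z \<Longrightarrow> \<rho> x > 0 \<and> inj_on (poly P) (ball x (\<rho> x))" by metis
  \<comment> \<open>The half distances make the discs of radius \<open>\<sigma>\<close> disjoint;
    the element 1 makes nonemptiness immediate, so that \<open>Min\<close> is meaningful.\<close>
  define S where "S = \<rho> ` ?Z \<union> (\<lambda>(x,y). dist x y / 2) ` {(x,y). x \<in> ?Z \<and> y \<in> ?Z \<and> x \<noteq> y} \<union> {1}"
  define \<sigma> where "\<sigma> = Min S"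
  have "{(x,y). x \<in> ?Z \<and> y \<in> ?Z \<and> x \<noteq> y} \<subseteq> ?Z \<times> ?Z" by auto
  then have finS: "finite S" unfolding S_def using fin finite_subset[OF _ finite_cartesian_product[OF fin fin]] by auto
  have pos: "\<sigma> > 0" unfolding \<sigma>_def using finS by (subst Min_gr_iff) (auto simp: S_def \<rho>)
  have \<sigma>\<rho>: "\<sigma> \<le> \<rho> x" if "x \<in> ?Z" for x unfolding \<sigma>_def using finS that by (intro Min_le) (auto simp: S_def)
  have \<sigma>d: "\<sigma> \<le> dist x y / 2" if "x \<in> ?Z" "y \<in> ?Z" "x \<noteq> y" for x y
    unfolding \<sigma>_def using finS that by (intro Min_le) (force simp: S_def)+
  have inj: "inj_on (poly P) (ball x \<sigma>)" if "x \<in> ?Z" for x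
    using \<rho>[OF that] \<sigma>\<rho>[OF that] by (meson inj_on_subset subset_ball)
  have disj: "ball x \<sigma> \<inter> ball y \<sigma> = {}" if "x \<in> ?Z" "y \<in> ?Z" "x \<noteq> y" for x y
  proof -
    have "dist x y \<ge> 2 * \<sigma>" using \<sigma>d[OF that] by simp
    moreover have "dist x y < 2 * \<sigma>" if "t \<in> ball x \<sigma>" "t \<in> ball y \<sigma>" for t
      using dist_triangle2[of x y t] that by (simp add: dist_commute)
    ultimately show ?thesis by fastforce
  qed
  have "\<exists>g. g holomorphic_on (poly P ` ball x \<sigma>) \<and> (\<forall>t\<in>ball x \<sigma>. g (poly P t) = t)" if "x \<in> ?Z" for x
    using holomorphic_has_inverse[OF hol open_ball inj[OF that]] by metis
  then obtain g where g: "\<And>x. x \<in> ?Z \<Longrightarrow> g x holomorphic_on (poly P ` ball x \<sigma>)"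
    "\<And>x t. x \<in> ?Z \<Longrightarrow> t \<in> ball x \<sigma> \<Longrightarrow> g x (poly P t) = t" by metis
  have op: "open (poly P ` ball x \<sigma>)" if "x \<in> ?Z" for x
    using open_mapping_thm3[OF hol open_ball inj[OF that]] .
  have "open (U \<inter> (\<Inter>x\<in>?Z. poly P ` ball x \<sigma>))"
    using fin op U by (intro open_Int open_INT) auto
  moreover have "z \<in> U \<inter> (\<Inter>x\<in>?Z. poly P ` ball x \<sigma>)"
  proof -
    have "z \<in> poly P ` ball x \<sigma>" if "x \<in> ?Z" for x
      using that pos by (intro image_eqI[of _ _ x]) auto
    then show ?thesis using U by auto
  qed
  ultimately obtain r where r: "r > 0" "ball z r \<subseteq> U \<inter> (\<Inter>x\<in>?Z. poly P ` ball x \<sigma>)"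
    using open_contains_ball by metis
  have gw: "g x w \<in> ball x \<sigma> \<and> poly P (g x w) = w" if xw: "x \<in> ?Z" "w \<in> ball z r" for x w
  proof -
    have "w \<in> poly P ` ball x \<sigma>" using r(2) xw by blast
    then show ?thesis using g(2)[OF xw(1)] by auto
  qed
  have injg: "inj_on (\<lambda>x. g x w) ?Z" if "w \<in> ball z r" for w
  proof (rule inj_onI, rule ccontr)
    fix x y assume "x \<in> ?Z" "y \<in> ?Z" "g x w = g y w" "x \<noteq> y"
    then show False using gw[of x w] gw[of y w] disj[of x y] that by auto
  qed
  have img: "(\<lambda>x. g x w) ` ?Z = {x. poly P x = w}" if w: "w \<in> ball z r" for w
  proof (rule card_subset_eq)
    show "finite {x. poly P x = w}" using card_fibre_le[OF P] by blast
    show "(\<lambda>x. g x w) ` ?Z \<subseteq> {x. poly P x = w}" using gw w by auto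
    show "card ((\<lambda>x. g x w) ` ?Z) = card {x. poly P x = w}"
    proof (rule antisym)
      show "card ((\<lambda>x. g x w) ` ?Z) \<le> card {x. poly P x = w}"
        using card_fibre_le[OF P] gw w by (intro card_mono) auto
      have "card ((\<lambda>x. g x w) ` ?Z) = degree P" using card_image[OF injg[OF w]] card_fibre_eq[OF P nc] by simp
      then show "card {x. poly P x = w} \<le> card ((\<lambda>x. g x w) ` ?Z)" using card_fibre_le[OF P] by simp
    qed
  qed
  have "branches P (ball z r) (g ` ?Z)"
    unfolding branches_def
  proof (intro conjI ballI)
    show "finite (g ` ?Z)" using fin by simp
    fix \<beta> assume "\<beta> \<in> g ` ?Z"
    then obtain x where x: "x \<in> ?Z" "\<beta> = g x" by blast
    have "ball z r \<subseteq> poly P ` ball x \<sigma>" using r x by blast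
    then show "\<beta> holomorphic_on ball z r" using g(1)[OF x(1)] x holomorphic_on_subset by blast
    fix w assume "w \<in> ball z r"
    then show "poly P (\<beta> w) = w" using gw x by blast
  next
    fix w assume w: "w \<in> ball z r"
    show "inj_on (\<lambda>\<beta>. \<beta> w) (g ` ?Z)" using injg[OF w] by (auto simp: inj_on_def)
    show "{x. poly P x = w} = (\<lambda>\<beta>. \<beta> w) ` (g ` ?Z)" using img[OF w] by (auto simp: image_image)
  qed (auto simp: connected_ball)
  then show ?thesis using that r by blast
qed

lemma branches_agree:
  assumes "branches P D Bs" "branches P D' Bs'" "w0 \<in> D" "w0 \<in> D'" "\<beta> \<in> Bs" "\<beta>' \<in> Bs'" "\<beta> w0 = \<beta>' w0"
  obtains r where "r > 0" "ball w0 r \<subseteq> D \<inter> D'" "\<And>w. w \<in> ball w0 r \<Longrightarrow> \<beta> w = \<beta>' w"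
proof -
  have op: "open (\<beta> ` D)" using branch_image_open[OF assms(1,5)] branchesD(1)[OF assms(1)] by blast
  have cont: "continuous_on D' \<beta>'" using branchesD(4)[OF assms(2,6)] holomorphic_on_imp_continuous_on by blast
  have "open (D' \<inter> \<beta>' -` (\<beta> ` D))"
    using continuous_open_preimage[OF cont branchesD(1)[OF assms(2)] op] .
  moreover have "w0 \<in> D' \<inter> \<beta>' -` (\<beta> ` D)" using assms(3,4,7) by (metis IntI image_eqI vimageI)
  ultimately have "open (D \<inter> (D' \<inter> \<beta>' -` (\<beta> ` D)))" "w0 \<in> D \<inter> (D' \<inter> \<beta>' -` (\<beta> ` D))"
    using branchesD(1)[OF assms(1)] assms by auto
  then obtain r where r: "r > 0" "ball w0 r \<subseteq> D \<inter> (D' \<inter> \<beta>' -` (\<beta> ` D))" using open_contains_ball by metis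
  have "\<beta> w = \<beta>' w" if "w \<in> ball w0 r" for w
  proof -
    have "\<beta>' w \<in> \<beta> ` D" "w \<in> D'" using r that by auto
    then show ?thesis using branch_image_iff[OF assms(1,5)] branchesD(5)[OF assms(2,6)] by simp
  qed
  then show ?thesis using that r by blast
qed

lemma poly_ratio_bounds:
  assumes "degree P > 0"
  shows "\<exists>R>0. \<forall>x::complex. norm x \<ge> R \<longrightarrow>
     norm (lead_coeff P) / 2 * norm x ^ degree P \<le> norm (poly P x) \<and>
     norm (poly P x) \<le> 2 * norm (lead_coeff P) * norm x ^ degree P"
proof -
  let ?c = "lead_coeff P"
  have c: "norm ?c > 0" using assms by auto
  have "((\<lambda>x. poly P x / x ^ degree P) \<longlongrightarrow> ?c) at_infinity" by (rule poly_divide_tendsto_aux)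
  then have "eventually (\<lambda>x. dist (poly P x / x ^ degree P) ?c < norm ?c / 2) at_infinity"
    using c by (intro tendstoD) auto
  then obtain R where R: "\<And>x. norm x \<ge> R \<Longrightarrow> norm (poly P x / x ^ degree P - ?c) < norm ?c / 2"
    unfolding eventually_at_infinity dist_norm by blast
  show ?thesis
  proof (intro exI[of _ "max R 1"] conjI allI impI)
    fix x :: complex assume x: "norm x \<ge> max R 1"
    let ?q = "poly P x / x ^ degree P"
    have x0: "x \<noteq> 0" using x by auto
    have "norm (?q - ?c) < norm ?c / 2" using R x by simp
    then have "norm ?q \<ge> norm ?c / 2" "norm ?q \<le> 2 * norm ?c"
      using norm_triangle_ineq2[of ?c ?q] norm_triangle_ineq2[of ?q ?c] by (auto simp: norm_minus_commute)
    moreover have "norm (poly P x) = norm ?q * norm x ^ degree P"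
      using x0 by (simp add: norm_divide norm_power)
    ultimately show "norm ?c / 2 * norm x ^ degree P \<le> norm (poly P x)"
      "norm (poly P x) \<le> 2 * norm ?c * norm x ^ degree P"
      using mult_right_mono[of "norm ?c / 2" "norm ?q" "norm x ^ degree P"]
        mult_right_mono[of "norm ?q" "2 * norm ?c" "norm x ^ degree P"] by simp_all
  qed auto
qed

text \<open>The two-sided estimates with factors 1/2 and 2 give 4 as a bound for the quotient of the
  \<open>degree P\<close>-th powers of the norms; the root of 4 is bounded crudely by 4.\<close>

lemma fibre_growth:
  assumes "degree P > 0"
  shows "\<exists>R>0. \<forall>x y::complex. norm x \<ge> R \<longrightarrow> poly P y = poly P x \<longrightarrow> norm y \<le> 4 * norm x"
proof -
  obtain R where R: "R > 0" "\<And>x::complex. norm x \<ge> R \<Longrightarrow>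
     norm (lead_coeff P) / 2 * norm x ^ degree P \<le> norm (poly P x) \<and>
     norm (poly P x) \<le> 2 * norm (lead_coeff P) * norm x ^ degree P"
    using poly_ratio_bounds[OF assms] by blast
  have c: "norm (lead_coeff P) > 0" using assms by auto
  have "norm y \<le> 4 * norm x" if x: "norm x \<ge> R" "poly P y = poly P x" for x y
  proof (rule ccontr)
    assume y: "\<not> norm y \<le> 4 * norm x"
    then have yR: "norm y \<ge> R" using x R(1) by auto
    have "4 ^ degree P * norm x ^ degree P < norm y ^ degree P"
      unfolding power_mult_distrib[symmetric] using y assms by (intro power_strict_mono) auto
    then have "norm (lead_coeff P) / 2 * (4 ^ degree P * norm x ^ degree P) < norm (lead_coeff P) / 2 * norm y ^ degree P"
      using c by simp
    also have "\<dots> \<le> 2 * norm (lead_coeff P) * norm x ^ degree P" using R(2)[OF yR] R(2)[OF x(1)] x(2) by simp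
    finally have "4 ^ degree P * norm x ^ degree P < 4 * norm x ^ degree P" using c by simp
    moreover have "norm x ^ degree P > 0" using x R(1) by (intro zero_less_power) linarith
    ultimately have "(4::real) ^ degree P < 4 ^ 1" by (simp only: mult_less_cancel_right_pos power_one_right)
    moreover have "(4::real) ^ 1 \<le> 4 ^ degree P" using assms by (intro power_increasing) auto
    ultimately show False by linarith
  qed
  then show ?thesis using R(1) by blast
qed

lemma bounded_fibres:
  assumes "degree P > 0"
  shows "\<exists>K. \<forall>y::complex. norm (poly P y) \<le> M \<longrightarrow> norm y \<le> K"
proof -
  obtain R where R: "R > 0" "\<And>x::complex. norm x \<ge> R \<Longrightarrow>
     norm (lead_coeff P) / 2 * norm x ^ degree P \<le> norm (poly P x)"
    using poly_ratio_bounds[OF assms] by blast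
  have c: "norm (lead_coeff P) > 0" using assms by auto
  have "norm y \<le> max (max R 1) (2 * M / norm (lead_coeff P))" if "norm (poly P y) \<le> M" for y
  proof (rule ccontr)
    assume y: "\<not> norm y \<le> max (max R 1) (2 * M / norm (lead_coeff P))"
    then have yR: "norm y > R" "norm y > 1" by auto
    then have "norm (lead_coeff P) / 2 * norm y ^ degree P \<le> M" using R(2)[of y] that by linarith
    moreover have "norm y \<le> norm y ^ degree P" using yR assms by (intro self_le_power) auto
    ultimately have "norm (lead_coeff P) / 2 * norm y \<le> M" using c
      by (meson dual_order.trans half_gt_zero less_imp_le mult_left_mono)
    moreover have "2 * M / norm (lead_coeff P) < norm y" using y by linarith
    then have "2 * M < norm y * norm (lead_coeff P)" using c by (simp only: pos_divide_less_eq)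
    ultimately show False by (simp add: mult.commute)
  qed
  then show ?thesis by blast
qed

section \<open>Locally constant equivalence relations on the fibres of a polynomial\<close>

lemma holomorphic_on_locally:
  assumes "\<And>x. x \<in> S \<Longrightarrow> \<exists>T. open T \<and> x \<in> T \<and> f holomorphic_on T"
  shows "f holomorphic_on S"
  unfolding holomorphic_on_def
proof
  fix x assume "x \<in> S"
  then obtain T where "open T" "x \<in> T" "f holomorphic_on T" using assms by blast
  then have "f field_differentiable at x" by (intro holomorphic_on_imp_differentiable_at)
  then show "f field_differentiable at x within S" by (rule field_differentiable_at_within)
qed

lemma holomorphic_on_poly_compose:
  assumes "f holomorphic_on S" shows "(\<lambda>w. poly Q (f w)) holomorphic_on S"
proof -
  have "poly Q \<circ> f holomorphic_on S" by (rule holomorphic_on_compose[OF assms]) (intro holomorphic_intros)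
  then show ?thesis by (simp add: o_def)
qed

text \<open>Used for two relations: equality of germs of given polynomials, and equality of
  monodromy of logarithms. \<open>E_lc\<close> says that the relation is carried along the sheets;
  this makes functions that are symmetric in a class single-valued away from a finite set.\<close>

locale fibre_relation =
  fixes P :: "complex poly" and B :: "complex set" and E :: "complex \<Rightarrow> complex \<Rightarrow> bool"
  assumes deg: "degree P > 0" and finB: "finite B"
    and E_refl: "poly P x \<notin> B \<Longrightarrow> E x x"
    and E_sym: "E x y \<Longrightarrow> E y x"
    and E_trans: "E x y \<Longrightarrow> E y z \<Longrightarrow> E x z"
    and E_fibre: "E x y \<Longrightarrow> poly P x \<notin> B \<and> poly P y = poly P x"
    and E_lc: "z \<notin> B \<Longrightarrow> \<exists>D Bs. z \<in> D \<and> D \<inter> B = {} \<and> branches P D Bs \<and>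
      (\<forall>\<beta>1\<in>Bs. \<forall>\<beta>2\<in>Bs. \<forall>w\<in>D. \<forall>w'\<in>D. E (\<beta>1 w) (\<beta>2 w) \<longrightarrow> E (\<beta>1 w') (\<beta>2 w'))"
begin

definition X :: "complex set" where "X = {x. poly P x \<notin> B}"
definition cls :: "complex \<Rightarrow> complex set" where "cls x = {y. E x y}"

lemma finite_compl_X: "finite (- X)"
proof -
  have "- X = (\<Union>w\<in>B. {x. poly P x = w})" unfolding X_def by auto
  then show ?thesis using finB card_fibre_le(1)[OF deg] by auto
qed

lemma connected_X: "connected X"
  using connected_open_delete_finite[of "UNIV :: complex set" "- X"] finite_compl_X connected_UNIV
  by (simp add: Diff_Compl)

lemma finite_cls: "finite (cls x)"
proof (rule finite_subset[OF _ card_fibre_le(1)[OF deg]])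
  show "cls x \<subseteq> {y. poly P y = poly P x}" unfolding cls_def using E_fibre by auto
qed

lemma cls_eq: "E x y \<Longrightarrow> cls x = cls y"
  unfolding cls_def by (auto intro: E_trans[of y x] E_trans[of x y] dest: E_sym)

lemma local_cls:
  assumes "x0 \<in> X"
  obtains D Bs \<beta>0 J where "branches P D Bs" "D \<inter> B = {}" "\<beta>0 \<in> Bs" "x0 \<in> \<beta>0 ` D" "J \<subseteq> Bs"
    "\<And>x. x \<in> \<beta>0 ` D \<Longrightarrow> cls x = (\<lambda>\<beta>. \<beta> (poly P x)) ` J"
    "\<And>x. x \<in> \<beta>0 ` D \<Longrightarrow> inj_on (\<lambda>\<beta>. \<beta> (poly P x)) J"
proof -
  let ?z = "poly P x0"
  have "?z \<notin> B" using assms unfolding X_def by simp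
  from E_lc[OF this] obtain D Bs where D: "?z \<in> D" "D \<inter> B = {}" "branches P D Bs"
    and lc': "\<forall>\<beta>1\<in>Bs. \<forall>\<beta>2\<in>Bs. \<forall>w\<in>D. \<forall>w'\<in>D. E (\<beta>1 w) (\<beta>2 w) \<longrightarrow> E (\<beta>1 w') (\<beta>2 w')"
    by (elim exE conjE)
  note lc = lc'[rule_format]
  obtain \<beta>0 where b0: "\<beta>0 \<in> Bs" "\<beta>0 ?z = x0" using branches_obtain[OF D(3,1)] by blast
  \<comment> \<open>The sheets related to \<open>\<beta>0\<close> at one point; \<open>E_lc\<close>
    keeps this set the same over all of \<open>D\<close>.\<close>
  define J where "J = {\<beta>\<in>Bs. E x0 (\<beta> ?z)}"
  have J: "J \<subseteq> Bs" unfolding J_def by blast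
  have img: "poly P x \<in> D" "\<beta>0 (poly P x) = x" if "x \<in> \<beta>0 ` D" for x
    using branch_image_iff[OF D(3) b0(1)] that by blast+
  show ?thesis
  proof (rule that[OF D(3,2) b0(1) _ J])
    show "x0 \<in> \<beta>0 ` D" using b0 D(1) by (intro image_eqI[of _ _ ?z]) auto
    fix x assume x: "x \<in> \<beta>0 ` D"
    show "inj_on (\<lambda>\<beta>. \<beta> (poly P x)) J"
      using branchesD(6)[OF D(3) img(1)[OF x]] J by (rule inj_on_subset)
    show "cls x = (\<lambda>\<beta>. \<beta> (poly P x)) ` J"
    proof (intro set_eqI iffI)
      fix y assume "y \<in> cls x"
      then have E: "E x y" unfolding cls_def by simp
      then have y: "poly P y = poly P x" using E_fibre by blast
      then obtain \<beta> where \<beta>: "\<beta> \<in> Bs" "\<beta> (poly P x) = y"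
        using branches_obtain[OF D(3), of y] img(1)[OF x] by metis
      have "E (\<beta>0 ?z) (\<beta> ?z)"
        by (rule lc[OF b0(1) \<beta>(1) img(1)[OF x] D(1)]) (use E \<beta> img(2)[OF x] in simp)
      then show "y \<in> (\<lambda>\<beta>. \<beta> (poly P x)) ` J" using \<beta> b0 unfolding J_def by auto
    next
      fix y assume "y \<in> (\<lambda>\<beta>. \<beta> (poly P x)) ` J"
      then obtain \<beta> where \<beta>: "\<beta> \<in> Bs" "E x0 (\<beta> ?z)" "y = \<beta> (poly P x)" unfolding J_def by blast
      have "E (\<beta>0 (poly P x)) (\<beta> (poly P x))"
        by (rule lc[OF b0(1) \<beta>(1) D(1) img(1)[OF x]]) (use \<beta> b0 in simp)
      then show "y \<in> cls x" unfolding cls_def using \<beta> img(2)[OF x] by simp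
    qed
  qed
qed

lemma card_cls_const: "x \<in> X \<Longrightarrow> y \<in> X \<Longrightarrow> card (cls x) = card (cls y)"
proof -
  have "(\<lambda>x. card (cls x)) constant_on X"
  proof (rule locally_constant_imp_constant[OF connected_X])
    fix x0 assume "x0 \<in> X"
    from local_cls[OF this] obtain D Bs \<beta>0 J where D: "branches P D Bs" "D \<inter> B = {}" "\<beta>0 \<in> Bs" "x0 \<in> \<beta>0 ` D" "J \<subseteq> Bs"
      "\<And>x. x \<in> \<beta>0 ` D \<Longrightarrow> cls x = (\<lambda>\<beta>. \<beta> (poly P x)) ` J"
      "\<And>x. x \<in> \<beta>0 ` D \<Longrightarrow> inj_on (\<lambda>\<beta>. \<beta> (poly P x)) J" by blast
    have "open (\<beta>0 ` D)" using branch_image_open[OF D(1,3)] branchesD(1)[OF D(1)] by blast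
    moreover have "card (cls x) = card J" if "x \<in> \<beta>0 ` D" for x using D(6,7)[OF that] by (simp add: card_image)
    ultimately show "\<exists>T. openin (top_of_set X) T \<and> x0 \<in> T \<and> (\<forall>x\<in>T. card (cls x) = card (cls x0))"
      using D(4) \<open>x0 \<in> X\<close> by (intro exI[of _ "X \<inter> \<beta>0 ` D"]) auto
  qed
  then show "x \<in> X \<Longrightarrow> y \<in> X \<Longrightarrow> card (cls x) = card (cls y)" by (auto simp: constant_on_def)
qed

definition e :: nat where "e = card (cls (SOME x. x \<in> X))"

lemma X_large: "\<exists>x\<in>X. norm x > r"
proof (rule ccontr)
  assume "\<not> ?thesis"
  then have "X \<subseteq> cball 0 r" by (auto simp: not_less)
  then have "bounded X" by (rule bounded_subset[OF bounded_cball])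
  then have "bounded (X \<union> - X)" using finite_imp_bounded[OF finite_compl_X] by (simp only: bounded_Un)
  then show False using not_bounded_UNIV[where 'a = complex] by simp
qed

lemma card_cls: "x \<in> X \<Longrightarrow> card (cls x) = e"
  unfolding e_def by (rule card_cls_const) (assumption, rule someI)

lemma class_product_holomorphic: "(\<lambda>x. \<Prod>y\<in>cls x. (c - y)) holomorphic_on X"
proof (rule holomorphic_on_locally)
  fix x0 assume "x0 \<in> X"
  from local_cls[OF this] obtain D Bs \<beta>0 J where D: "branches P D Bs" "D \<inter> B = {}" "\<beta>0 \<in> Bs" "x0 \<in> \<beta>0 ` D" "J \<subseteq> Bs"
    "\<And>x. x \<in> \<beta>0 ` D \<Longrightarrow> cls x = (\<lambda>\<beta>. \<beta> (poly P x)) ` J"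
    "\<And>x. x \<in> \<beta>0 ` D \<Longrightarrow> inj_on (\<lambda>\<beta>. \<beta> (poly P x)) J" by blast
  have PD: "poly P ` (\<beta>0 ` D) \<subseteq> D" using branchesD(5)[OF D(1,3)] by auto
  have "\<beta> \<circ> poly P holomorphic_on \<beta>0 ` D" if "\<beta> \<in> J" for \<beta>
    by (rule holomorphic_on_compose) (use branchesD(4)[OF D(1)] D(5) that PD in \<open>auto intro!: holomorphic_intros intro: holomorphic_on_subset\<close>)
  then have "(\<lambda>x. \<Prod>\<beta>\<in>J. (c - \<beta> (poly P x))) holomorphic_on \<beta>0 ` D"
    by (intro holomorphic_intros) (auto simp: o_def)
  then have "(\<lambda>x. \<Prod>y\<in>cls x. (c - y)) holomorphic_on \<beta>0 ` D"
    by (rule holomorphic_transform) (simp add: D(6,7) prod.reindex)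
  moreover have "open (\<beta>0 ` D)" using branch_image_open[OF D(1,3)] branchesD(1)[OF D(1)] by blast
  ultimately show "\<exists>T. open T \<and> x0 \<in> T \<and> (\<lambda>x. \<Prod>y\<in>cls x. (c - y)) holomorphic_on T"
    using D(4) by blast
qed

text \<open>The product is holomorphic off a finite set. Its singularities are removable because
  fibres over bounded sets are bounded, and its growth at infinity is at most that of
  \<open>x ^ e\<close>, so Liouville's theorem applies.\<close>

lemma class_product_polynomial:
  "\<exists>N. degree N \<le> e \<and> (\<forall>x\<in>X. poly N x = (\<Prod>y\<in>cls x. (c - y)))"
proof -
  define h where "h x = (\<Prod>y\<in>cls x. (c - y))" for x
  have "\<exists>g. g holomorphic_on UNIV \<and> (\<forall>z\<in>UNIV - (- X). g z = h z)"
  proof (rule removable_singularities)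
    show "h holomorphic_on UNIV - - X" using class_product_holomorphic unfolding h_def by (simp add: Diff_Compl)
    fix z assume "z \<in> - X"
    have "bounded (poly P ` cball z 1)"
      by (intro compact_imp_bounded compact_continuous_image) (auto intro!: continuous_intros)
    then obtain M where "\<forall>v\<in>poly P ` cball z 1. norm v \<le> M" unfolding bounded_iff by blast
    then have M: "norm (poly P x) \<le> M" if "x \<in> cball z 1" for x using that by blast
    obtain K where K: "\<And>y. norm (poly P y) \<le> M \<Longrightarrow> norm y \<le> K" using bounded_fibres[OF deg] by blast
    have "norm (h x) \<le> max 1 (norm c + K) ^ e" if x: "x \<in> cball z 1" "x \<in> X" for x
    proof -
      have "norm (h x) \<le> (\<Prod>y\<in>cls x. max 1 (norm c + K))"
        unfolding h_def prod_norm[symmetric]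
      proof (rule prod_mono)
        fix y assume "y \<in> cls x"
        then have "poly P y = poly P x" unfolding cls_def using E_fibre by blast
        then have "norm y \<le> K" using K[of y] M[OF x(1)] by simp
        then show "0 \<le> norm (c - y) \<and> norm (c - y) \<le> max 1 (norm c + K)"
          using norm_triangle_ineq4[of c y] by simp
      qed
      then show ?thesis by (simp add: card_cls[OF x(2)])
    qed
    moreover have "eventually (\<lambda>x. x \<in> cball z 1 \<and> x \<in> X) (at z)"
    proof -
      have "eventually (\<lambda>x. x \<in> ball z 1 - (- X - {z})) (nhds z)"
        using finite_compl_X by (intro eventually_nhds_in_open open_Diff finite_imp_closed) auto
      then show ?thesis unfolding eventually_at_filter by (elim eventually_mono) auto
    qed
    ultimately show "h \<in> O[at z](\<lambda>_. 1)"
      by (intro bigoI[of _ "max 1 (norm c + K) ^ e"]) (auto elim!: eventually_mono)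
  qed (use finite_compl_X in auto)
  then obtain g where g: "g holomorphic_on UNIV" "\<And>z. z \<in> X \<Longrightarrow> g z = h z" by auto
  obtain R where R: "R > 0" "\<And>x y. norm x \<ge> R \<Longrightarrow> poly P y = poly P x \<Longrightarrow> norm y \<le> 4 * norm x"
    using fibre_growth[OF deg] by blast
  obtain R' where R': "\<And>x. x \<in> - X \<Longrightarrow> norm x \<le> R'"
    using finite_imp_bounded[OF finite_compl_X] unfolding bounded_iff by blast
  let ?A = "max (max R (norm c)) (R' + 1)"
  have "norm (g x) \<le> 5 ^ e * norm x ^ e" if x: "?A \<le> norm x" for x
  proof -
    have xX: "x \<in> X" using R'[of x] x by force
    \<comment> \<open>Here 5 = 1 + 4: \<open>norm c\<close> is at most \<open>norm x\<close>, and
      \<open>fibre_growth\<close> bounds \<open>norm y\<close> by four times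
      \<open>norm x\<close>.\<close>
    have "norm (h x) \<le> (\<Prod>y\<in>cls x. 5 * norm x)"
      unfolding h_def prod_norm[symmetric]
    proof (rule prod_mono)
      fix y assume "y \<in> cls x"
      then have "poly P y = poly P x" unfolding cls_def using E_fibre by blast
      then have "norm y \<le> 4 * norm x" using R(2)[of x y] x by simp
      then show "0 \<le> norm (c - y) \<and> norm (c - y) \<le> 5 * norm x"
        using norm_triangle_ineq4[of c y] x by simp
    qed
    then show ?thesis using g(2)[OF xX] by (simp add: card_cls[OF xX] power_mult_distrib)
  qed
  from Liouville_polynomial[OF g(1) this]
  have gs: "g x = (\<Sum>k\<le>e. (deriv ^^ k) g 0 / fact k * x ^ k)" for x by blast
  let ?N = "\<Sum>k\<le>e. monom ((deriv ^^ k) g 0 / fact k) k"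
  have "degree ?N \<le> e" by (intro degree_sum_le) (auto intro: order_trans[OF degree_monom_le])
  moreover have "poly ?N x = h x" if "x \<in> X" for x
    using gs[of x] g(2)[OF that] by (simp add: poly_sum poly_monom)
  ultimately show ?thesis unfolding h_def by blast
qed

end

section \<open>Polynomials in \<open>W\<close>, recognised by their values on the fibres of
  \<open>W\<close>\<close>

lemma base_expansion:
  fixes W R :: "complex poly"
  assumes W: "degree W > 0"
  shows "\<exists>c. R = (\<Sum>i<degree W. monom 1 i * pcompose (c i) W)"
proof (induction "degree R" arbitrary: R rule: less_induct)
  case less
  have W0: "W \<noteq> 0" using W by auto
  \<comment> \<open>The remainder is the lowest digit in base \<open>W\<close>. The digits are
    regrouped by powers of the variable, so that \<open>R\<close> becomes a combination of these
    powers over the polynomials in \<open>W\<close>.\<close>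
  have mod: "R mod W = (\<Sum>i<degree W. monom 1 i * pcompose [:coeff (R mod W) i:] W)"
  proof -
    have "degree (R mod W) < degree W" using W degree_mod_less[OF W0, of R] by auto
    then have "R mod W = (\<Sum>i<degree W. monom (coeff (R mod W) i) i)"
      by (subst poly_as_sum_of_monoms'[of _ "degree W - 1", symmetric]) (use W in \<open>auto simp: lessThan_Suc_atMost[symmetric]\<close>)
    then show ?thesis by (simp add: pcompose_const smult_monom)
  qed
  show ?case
  proof (cases "R div W = 0")
    case True
    then have "R = R mod W" by (metis add_0 div_mult_mod_eq mult_zero_left)
    then show ?thesis using mod by metis
  next
    case False
    have "degree R = degree (R div W) + degree W"
    proof -
      have "degree (R div W * W) = degree (R div W) + degree W" using False W0 by (simp add: degree_mult_eq)
      moreover have "degree (R mod W) < degree W" using W degree_mod_less[OF W0, of R] by auto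
      ultimately have "degree (R div W * W + R mod W) = degree (R div W) + degree W"
        by (subst degree_add_eq_left) auto
      then show ?thesis by simp
    qed
    then have "degree (R div W) < degree R" using W by simp
    from less[OF this] obtain c where c: "R div W = (\<Sum>i<degree W. monom 1 i * pcompose (c i) W)" by blast
    have "R = W * (R div W) + R mod W" by simp
    also have "\<dots> = (\<Sum>i<degree W. monom 1 i * pcompose (pCons (coeff (R mod W) i) (c i)) W)"
      by (subst mod, subst c) (simp add: sum_distrib_left sum.distrib[symmetric] pcompose_pCons algebra_simps)
    finally show ?thesis by (intro exI[of _ "\<lambda>i. pCons (coeff (R mod W) i) (c i)"])
  qed
qed

text \<open>Over a fixed \<open>v\<close> the expansion of \<open>R\<close> in base \<open>W\<close>
  becomes a polynomial of degree below \<open>degree W\<close>. It takes one value at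
  \<open>degree W\<close> points and so is constant. Thus all \<open>c i\<close> with positive
  \<open>i\<close> vanish at infinitely many \<open>v\<close>.\<close>

lemma pcompose_if_const_on_fibres:
  fixes W R :: "complex poly"
  assumes W: "degree W > 0"
    and inf: "infinite {v. \<exists>A. A \<subseteq> {x. poly W x = v} \<and> card A = degree W \<and> (\<forall>x\<in>A. \<forall>y\<in>A. poly R x = poly R y)}"
  shows "\<exists>R'. R = pcompose R' W"
proof -
  obtain c where c: "R = (\<Sum>i<degree W. monom 1 i * pcompose (c i) W)" using base_expansion[OF W] by blast
  have "c i = 0" if i: "i \<in> {1..<degree W}" for i
  proof (rule ccontr)
    assume "c i \<noteq> 0"
    moreover have "{v. \<exists>A. A \<subseteq> {x. poly W x = v} \<and> card A = degree W \<and> (\<forall>x\<in>A. \<forall>y\<in>A. poly R x = poly R y)}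
      \<subseteq> {v. poly (c i) v = 0}"
    proof
      fix v assume "v \<in> {v. \<exists>A. A \<subseteq> {x. poly W x = v} \<and> card A = degree W \<and> (\<forall>x\<in>A. \<forall>y\<in>A. poly R x = poly R y)}"
      then obtain A where A: "A \<subseteq> {x. poly W x = v}" "card A = degree W" "\<And>x y. x \<in> A \<Longrightarrow> y \<in> A \<Longrightarrow> poly R x = poly R y" by blast
      then obtain x0 where x0: "x0 \<in> A" using W by fastforce
      define S where "S = (\<Sum>i<degree W. monom (poly (c i) v) i)"
      have RS: "poly R x = poly S x" if "x \<in> A" for x
      proof -
        have "poly W x = v" using A(1) that by blast
        then have "poly (\<Sum>i<degree W. monom 1 i * pcompose (c i) W) x = poly S x"
          by (simp add: S_def poly_sum poly_monom poly_pcompose mult.commute)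
        then show ?thesis using c by simp
      qed
      have "degree S \<le> degree W - 1" unfolding S_def
        by (intro degree_sum_le) (auto intro: order_trans[OF degree_monom_le])
      then have dS: "degree (S - [:poly R x0:]) \<le> degree W - 1" by (intro degree_diff_le) auto
      have "S - [:poly R x0:] = 0"
      proof (rule ccontr)
        assume ne: "S - [:poly R x0:] \<noteq> 0"
        have sub: "A \<subseteq> {x. poly (S - [:poly R x0:]) x = 0}"
        proof (rule subsetI, rule CollectI)
          fix t assume t: "t \<in> A"
          show "poly (S - [:poly R x0:]) t = 0" using A(3)[OF t x0] RS[OF t] by simp
        qed
        have "card A \<le> card {x. poly (S - [:poly R x0:]) x = 0}"
          by (rule card_mono[OF poly_roots_finite[OF ne] sub])
        also have "\<dots> \<le> degree (S - [:poly R x0:])" by (rule card_poly_roots_bound[OF ne])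
        finally show False using A(2) dS W by linarith
      qed
      then have "coeff S i = coeff [:poly R x0:] i" by simp
      moreover have "coeff S i = poly (c i) v" unfolding S_def coeff_sum using i
        by (simp add: coeff_monom if_distrib sum.delta cong: if_cong)
      ultimately show "v \<in> {v. poly (c i) v = 0}" using i by (cases i) auto
    qed
    ultimately show False using inf poly_roots_finite finite_subset by blast
  qed
  then have "(\<Sum>i<degree W. monom 1 i * pcompose (c i) W) = (\<Sum>i<degree W. if i = 0 then pcompose (c 0) W else 0)"
    by (intro sum.cong) (auto simp: monom_0)
  also have "\<dots> = pcompose (c 0) W" using W by simp
  finally show ?thesis using c by metis
qed

context fibre_relation
begin

text \<open>\<open>W\<close> is the product of the negatives of the members of a class. Each class
  lies in one fibre of \<open>W\<close>, and it has \<open>e\<close> elements while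
  \<open>degree W\<close> is at most \<open>e\<close>; hence the classes are complete fibres of
  \<open>W\<close>, provided that \<open>W\<close> is not constant.\<close>

lemma nontrivial_class_composition:
  assumes nt: "E x1 y1" "x1 \<noteq> y1"
  shows "\<exists>W. degree W \<ge> 2 \<and>
    (\<forall>R. (\<forall>x y. E x y \<longrightarrow> poly R x = poly R y) \<longrightarrow> (\<exists>R'. R = pcompose R' W))"
proof -
  obtain W where W: "degree W \<le> e" "\<And>x. x \<in> X \<Longrightarrow> poly W x = (\<Prod>y\<in>cls x. (0 - y))"
    using class_product_polynomial by blast
  have Wcls: "poly W x = poly W y" if "E x y" for x y
    using W(2)[of x] W(2)[of y] cls_eq[OF that] E_fibre[OF that] unfolding X_def by simp
  have x1: "x1 \<in> X" using E_fibre[OF nt(1)] unfolding X_def by blast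
  have e2: "e \<ge> 2"
  proof -
    have "{x1, y1} \<subseteq> cls x1" using nt E_refl x1 unfolding cls_def X_def by auto
    then have "card {x1, y1} \<le> card (cls x1)" by (intro card_mono finite_cls)
    then show ?thesis using nt(2) card_cls[OF x1] by simp
  qed
  have nonconst: "degree W > 0"
  proof (rule ccontr)
    assume "\<not> degree W > 0"
    then obtain w where w: "W = [:w:]" using degree_eq_zeroE by blast
    \<comment> \<open>If \<open>W\<close> were the constant \<open>w\<close>: for large
      \<open>x\<close> all members of its class have norm above \<open>norm w + 2\<close>, and so
      their product has norm above \<open>norm w\<close>.\<close>
    have "bounded (poly P ` cball 0 (norm w + 2))"
      by (intro compact_imp_bounded compact_continuous_image) (auto intro!: continuous_intros)
    then obtain M where "\<forall>v\<in>poly P ` cball 0 (norm w + 2). norm v \<le> M" unfolding bounded_iff by blast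
    then have M: "norm y > norm w + 2" if "norm (poly P y) > M" for y using that by (force simp: not_le)
    obtain K where K: "\<And>y. norm (poly P y) \<le> M \<Longrightarrow> norm y \<le> K" using bounded_fibres[OF deg] by blast
    obtain x where x: "x \<in> X" "norm x > K" using X_large by blast
    then have xM: "norm (poly P x) > M" using K[of x] by linarith
    have "(\<Prod>y\<in>cls x. norm w + 2) \<le> (\<Prod>y\<in>cls x. norm (0 - y))"
    proof (rule prod_mono)
      fix y assume "y \<in> cls x"
      then have "poly P y = poly P x" unfolding cls_def using E_fibre by blast
      then show "0 \<le> norm w + 2 \<and> norm w + 2 \<le> norm (0 - y)" using M[of y] xM by simp
    qed
    also have "\<dots> = norm (poly W x)" by (simp only: W(2)[OF x(1)] prod_norm)
    finally have "(norm w + 2) ^ e \<le> norm w" using w by (simp add: card_cls[OF x(1)])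
    moreover have "norm w + 2 \<le> (norm w + 2) ^ e" using e2 by (intro self_le_power) auto
    ultimately show False by simp
  qed
  have fibW: "cls x \<subseteq> {t. poly W t = poly W x}" for x
    unfolding cls_def by (rule subsetI) (use Wcls[of x] in simp)
  have "card (cls x1) \<le> card {t. poly W t = poly W x1}"
    by (intro card_mono fibW card_fibre_le(1)[OF nonconst])
  also have "\<dots> \<le> degree W" by (rule card_fibre_le(2)[OF nonconst])
  finally have dW: "degree W = e" using W(1) card_cls[OF x1] by simp
  have infW: "infinite (poly W ` X)"
  proof
    assume f: "finite (poly W ` X)"
    have "X \<subseteq> (\<Union>v\<in>poly W ` X. {t. poly W t = v})" by blast
    moreover have "finite (\<Union>v\<in>poly W ` X. {t. poly W t = v})" using f card_fibre_le(1)[OF nonconst] by blast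
    ultimately have "finite X" by (rule finite_subset)
    then have "finite (X \<union> - X)" using finite_compl_X by blast
    then show False using infinite_UNIV_char_0[where 'a = complex] by simp
  qed
  have "\<exists>R'. R = pcompose R' W" if R: "\<forall>x y. E x y \<longrightarrow> poly R x = poly R y" for R
  proof (rule pcompose_if_const_on_fibres[OF nonconst])
    have "poly W ` X \<subseteq> {v. \<exists>A. A \<subseteq> {x. poly W x = v} \<and> card A = degree W \<and> (\<forall>x\<in>A. \<forall>y\<in>A. poly R x = poly R y)}"
    proof (rule image_subsetI, rule CollectI, rule exI, intro conjI ballI)
      fix x assume x: "x \<in> X"
      show "cls x \<subseteq> {t. poly W t = poly W x}" by (rule fibW)
      show "card (cls x) = degree W" using card_cls[OF x] dW by simp
      fix s t assume "s \<in> cls x" "t \<in> cls x"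
      then show "poly R s = poly R t" unfolding cls_def using R by (metis mem_Collect_eq)
    qed
    then show "infinite {v. \<exists>A. A \<subseteq> {x. poly W x = v} \<and> card A = degree W \<and> (\<forall>x\<in>A. \<forall>y\<in>A. poly R x = poly R y)}"
      using infW finite_subset by blast
  qed
  then show ?thesis using dW e2 by (intro exI[of _ W]) auto
qed

end

section \<open>The Puiseux chart at infinity\<close>

text \<open>The points over \<open>lead_coeff P / t ^ n\<close> are
  \<open>1 / \<omega> (\<epsilon> ^ i * t)\<close> for \<open>i < n\<close>; multiplication of
  \<open>t\<close> by \<open>\<epsilon>\<close> is the monodromy around infinity, a single cycle of
  length \<open>n\<close>.\<close>

locale infinity_chart =
  fixes P :: "complex poly" and \<omega> :: "complex \<Rightarrow> complex" and \<delta> :: real and n :: nat and \<epsilon> :: complex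
  assumes degP: "degree P = n" and n0: "n > 0" and \<delta>: "\<delta> > 0"
    and hol: "\<omega> holomorphic_on ball 0 \<delta>" and inj: "inj_on \<omega> (ball 0 \<delta>)" and w0: "\<omega> 0 = 0"
    and Pw: "t \<in> ball 0 \<delta> \<Longrightarrow> t \<noteq> 0 \<Longrightarrow> poly P (1 / \<omega> t) = lead_coeff P / t ^ n"
    and eps: "\<epsilon> ^ n = 1" and eps_inj: "inj_on (\<lambda>i. \<epsilon> ^ i) {..<n}"
begin

definition A :: "complex set" where "A = ball 0 \<delta> - {0}"

lemma norm_eps: "norm \<epsilon> = 1"
  using eps n0 by (metis norm_ge_zero norm_one norm_power power_eq_1_iff less_irrefl)

lemma eps0: "\<epsilon> \<noteq> 0" using norm_eps by auto

lemma lc0: "lead_coeff P \<noteq> 0" using degP n0 by auto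

lemma rot: "t \<in> A \<Longrightarrow> \<epsilon> ^ i * t \<in> A"
  unfolding A_def using eps0 by (auto simp: norm_mult norm_power norm_eps)

lemma wnz: "t \<in> A \<Longrightarrow> \<omega> t \<noteq> 0"
  using inj w0 \<delta> unfolding A_def inj_on_def by (metis DiffE centre_in_ball insertCI)

lemma P_rot: "t \<in> A \<Longrightarrow> poly P (1 / \<omega> (\<epsilon> ^ i * t)) = lead_coeff P / t ^ n"
proof -
  assume t: "t \<in> A"
  have "(\<epsilon> ^ i) ^ n = 1" by (metis eps power_mult mult.commute power_one)
  then have "(\<epsilon> ^ i * t) ^ n = t ^ n" by (simp add: power_mult_distrib)
  then show ?thesis using Pw[of "\<epsilon> ^ i * t"] rot[OF t] unfolding A_def by simp
qed

lemma roots_inj: "t \<in> A \<Longrightarrow> inj_on (\<lambda>i. 1 / \<omega> (\<epsilon> ^ i * t)) {..<n}"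
proof (rule inj_onI)
  fix i j assume t: "t \<in> A" and ij: "i \<in> {..<n}" "j \<in> {..<n}" "1 / \<omega> (\<epsilon> ^ i * t) = 1 / \<omega> (\<epsilon> ^ j * t)"
  have "\<omega> (\<epsilon> ^ i * t) = \<omega> (\<epsilon> ^ j * t)" using ij(3) by (simp add: divide_eq_eq eq_divide_eq wnz rot t)
  then have "\<epsilon> ^ i * t = \<epsilon> ^ j * t"
    using inj_onD[OF inj] rot[OF t] unfolding A_def by blast
  then have "\<epsilon> ^ i = \<epsilon> ^ j" using t unfolding A_def by simp
  then show "i = j" using inj_onD[OF eps_inj] ij by blast
qed

lemma roots_eq: "t \<in> A \<Longrightarrow> {x. poly P x = lead_coeff P / t ^ n} = (\<lambda>i. 1 / \<omega> (\<epsilon> ^ i * t)) ` {..<n}"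
proof (rule card_seteq[symmetric])
  assume t: "t \<in> A"
  show "finite {x. poly P x = lead_coeff P / t ^ n}" using card_fibre_le(1) degP n0 by blast
  show "(\<lambda>i. 1 / \<omega> (\<epsilon> ^ i * t)) ` {..<n} \<subseteq> {x. poly P x = lead_coeff P / t ^ n}" using P_rot[OF t] by auto
  show "card {x. poly P x = lead_coeff P / t ^ n} \<le> card ((\<lambda>i. 1 / \<omega> (\<epsilon> ^ i * t)) ` {..<n})"
    using card_fibre_le(2)[of P] degP n0 card_image[OF roots_inj[OF t]] by simp
qed

lemma sum_roots: "t \<in> A \<Longrightarrow> (\<Sum>x\<in>{x. poly P x = lead_coeff P / t ^ n}. g x) = (\<Sum>i<n. g (1 / \<omega> (\<epsilon> ^ i * t)))"
  by (simp add: roots_eq sum.reindex roots_inj)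

lemma open_A: "open A" and connected_A: "connected A"
  unfolding A_def by (auto intro: connected_punctured_ball)

lemma inv_hol: "(\<lambda>t. 1 / \<omega> (\<epsilon> ^ i * t)) holomorphic_on A"
proof -
  have "(\<lambda>t. \<omega> (\<epsilon> ^ i * t)) holomorphic_on A"
  proof -
    have "\<omega> \<circ> (\<lambda>t. \<epsilon> ^ i * t) holomorphic_on A"
    proof (intro holomorphic_on_compose holomorphic_on_subset[OF hol])
      show "(\<lambda>t. \<epsilon> ^ i * t) ` A \<subseteq> ball 0 \<delta>"
        using rot[of _ i] unfolding A_def by (rule_tac image_subsetI) blast
    qed (intro holomorphic_intros)
    then show ?thesis by (simp add: o_def)
  qed
  then show ?thesis using wnz rot by (intro holomorphic_intros) auto
qed

lemma large_value:
  assumes "t \<in> A"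
  shows "\<exists>r>0. \<forall>s\<in>A. norm s < r \<longrightarrow> M < norm (lead_coeff P / s ^ n)"
proof -
  define r where "r = min 1 (norm (lead_coeff P) / (\<bar>M\<bar> + 1))"
  have r: "r > 0" unfolding r_def using lc0 by auto
  have "M < norm (lead_coeff P / s ^ n)" if s: "s \<in> A" "norm s < r" for s
  proof -
    have s0: "norm s > 0" using s(1) unfolding A_def by auto
    have "norm s ^ n \<le> norm s ^ 1" using n0 s(2) s0 unfolding r_def by (intro power_decreasing) auto
    then have "norm s ^ n < norm (lead_coeff P) / (\<bar>M\<bar> + 1)" using s(2) unfolding r_def by simp
    then have "norm s ^ n * (\<bar>M\<bar> + 1) < norm (lead_coeff P)" by (simp add: pos_less_divide_eq)
    then have "\<bar>M\<bar> + 1 < norm (lead_coeff P) / norm s ^ n"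
      using s0 by (simp add: pos_less_divide_eq mult.commute)
    then show ?thesis by (simp add: norm_divide norm_power)
  qed
  then show ?thesis using r by blast
qed

text \<open>Differentiate \<open>P (x (t)) = lead_coeff P / t ^ n\<close> along sheet
  \<open>i\<close>. The factor in front of \<open>Q' / P'\<close> is the same on all sheets, so a
  relation between the values of \<open>Q' / P'\<close> is a relation between the derivatives of
  \<open>Q\<close> along the sheets.\<close>

lemma tower_value:
  assumes t: "t \<in> A"
  shows "poly (pderiv P) (1 / \<omega> (\<epsilon> ^ i * t)) \<noteq> 0"
    "((\<lambda>t. poly Q (1 / \<omega> (\<epsilon> ^ i * t))) has_field_derivative
      - (of_nat n * lead_coeff P / t ^ Suc n) *
        (poly (pderiv Q) (1 / \<omega> (\<epsilon> ^ i * t)) / poly (pderiv P) (1 / \<omega> (\<epsilon> ^ i * t)))) (at t)"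
proof -
  let ?x = "\<lambda>t. 1 / \<omega> (\<epsilon> ^ i * t)"
  let ?d = "deriv ?x t"
  have t0: "t \<noteq> 0" using t unfolding A_def by simp
  have x: "(?x has_field_derivative ?d) (at t)" using holomorphic_derivI[OF inv_hol open_A t] .
  have "((\<lambda>t. poly P (?x t)) has_field_derivative poly (pderiv P) (?x t) * ?d) (at t)"
    using DERIV_chain2[OF poly_DERIV x] .
  then have 1: "((\<lambda>t. lead_coeff P / t ^ n) has_field_derivative poly (pderiv P) (?x t) * ?d) (at t)"
    by (rule has_field_derivative_transform_within_open[OF _ open_A t]) (simp add: P_rot)
  have "((\<lambda>t. lead_coeff P * inverse (t ^ n)) has_field_derivative
      lead_coeff P * (- (inverse (t ^ n) * (of_nat n * t ^ (n - 1)) * inverse (t ^ n)))) (at t)"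
    using t0 by (auto intro!: derivative_eq_intros)
  moreover have "lead_coeff P * (- (inverse (t ^ n) * (of_nat n * t ^ (n - 1)) * inverse (t ^ n))) = - (of_nat n * lead_coeff P / t ^ Suc n)"
  proof -
    have "t ^ n = t * t ^ (n - 1)" using n0 by (metis Suc_pred' power_Suc)
    then show ?thesis using t0 by (simp add: field_simps)
  qed
  ultimately have 2: "((\<lambda>t. lead_coeff P / t ^ n) has_field_derivative - (of_nat n * lead_coeff P / t ^ Suc n)) (at t)"
    by (simp only: divide_inverse)
  have eq: "poly (pderiv P) (?x t) * ?d = - (of_nat n * lead_coeff P / t ^ Suc n)"
    using DERIV_unique[OF 1 2] .
  moreover have "- (of_nat n * lead_coeff P / t ^ Suc n) \<noteq> 0" using lc0 n0 t0 by simp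
  ultimately show nz: "poly (pderiv P) (?x t) \<noteq> 0" by auto
  have "((\<lambda>t. poly Q (?x t)) has_field_derivative poly (pderiv Q) (?x t) * ?d) (at t)"
    using DERIV_chain2[OF poly_DERIV x] .
  moreover have "poly (pderiv Q) (?x t) * ?d = - (of_nat n * lead_coeff P / t ^ Suc n) * (poly (pderiv Q) (?x t) / poly (pderiv P) (?x t))"
    unfolding eq[symmetric] using nz by simp
  ultimately show "((\<lambda>t. poly Q (?x t)) has_field_derivative - (of_nat n * lead_coeff P / t ^ Suc n) * (poly (pderiv Q) (?x t) / poly (pderiv P) (?x t))) (at t)"
    by simp
qed

text \<open>The relation integrates to a constant combination \<open>F\<close> of the values of
  \<open>Q\<close> on the sheets, and this persists on the whole punctured disc. Taking differences
  removes the constant and produces a nonzero sequence that is annihilated both by the relation and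
  by the cyclotomic factor.\<close>

lemma relation_periodic:
  assumes p: "prime p" and n: "n = p ^ k * p" and t0: "t0 \<in> A" and r: "r > 0" "ball t0 r \<subseteq> A"
    and rel: "\<And>t. t \<in> ball t0 r \<Longrightarrow>
       (\<Sum>i<n. of_int (f i) * (poly (pderiv Q) (1 / \<omega> (\<epsilon> ^ i * t)) / poly (pderiv P) (1 / \<omega> (\<epsilon> ^ i * t)))) = 0"
    and nt: "t1 \<in> A" "poly Q (1 / \<omega> (\<epsilon> ^ (p ^ k) * t1)) \<noteq> poly Q (1 / \<omega> t1)"
  shows "f 0 = f (p ^ k)"
proof -
  let ?m = "p ^ k"
  define \<phi> where "\<phi> t = poly Q (1 / \<omega> t)" for t
  define F where "F t = (\<Sum>i<n. of_int (f i) * \<phi> (\<epsilon> ^ i * t))" for t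
  have holF: "F holomorphic_on A" unfolding F_def \<phi>_def
  proof (intro holomorphic_on_sum holomorphic_on_mult holomorphic_on_const)
    fix i
    have "poly Q \<circ> (\<lambda>t. 1 / \<omega> (\<epsilon> ^ i * t)) holomorphic_on A"
      by (intro holomorphic_on_compose inv_hol) (intro holomorphic_intros)
    then show "(\<lambda>t. poly Q (1 / \<omega> (\<epsilon> ^ i * t))) holomorphic_on A" by (simp add: o_def)
  qed
  have der0: "(F has_field_derivative 0) (at t)" if t: "t \<in> ball t0 r" for t
  proof -
    have tA: "t \<in> A" using r t by blast
    have "(F has_field_derivative (\<Sum>i<n. of_int (f i) * (- (of_nat n * lead_coeff P / t ^ Suc n) *
        (poly (pderiv Q) (1 / \<omega> (\<epsilon> ^ i * t)) / poly (pderiv P) (1 / \<omega> (\<epsilon> ^ i * t)))))) (at t)"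
      unfolding F_def \<phi>_def by (intro DERIV_sum DERIV_cmult tower_value(2)[OF tA])
    moreover have "(\<Sum>i<n. of_int (f i) * (- (of_nat n * lead_coeff P / t ^ Suc n) *
        (poly (pderiv Q) (1 / \<omega> (\<epsilon> ^ i * t)) / poly (pderiv P) (1 / \<omega> (\<epsilon> ^ i * t))))) =
       - (of_nat n * lead_coeff P / t ^ Suc n) * (\<Sum>i<n. of_int (f i) * (poly (pderiv Q) (1 / \<omega> (\<epsilon> ^ i * t)) / poly (pderiv P) (1 / \<omega> (\<epsilon> ^ i * t))))"
      unfolding sum_distrib_left by (intro sum.cong refl) (simp only: mult.left_commute mult.assoc)
    ultimately show ?thesis using rel[OF t] by simp
  qed
  have "\<exists>\<kappa>. \<forall>t\<in>ball t0 r. F t = \<kappa>"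
    using has_field_derivative_zero_constant[of "ball t0 r" F] has_field_derivative_at_within[OF der0] by (metis convex_ball)
  then obtain \<kappa> where \<kappa>: "\<And>t. t \<in> ball t0 r \<Longrightarrow> F t = \<kappa>" by blast
  have F\<kappa>: "F t = \<kappa>" if "t \<in> A" for t
    using analytic_continuation_open[of "ball t0 r" A F "\<lambda>_. \<kappa>" t] open_A connected_A r holF \<kappa> that by auto
  \<comment> \<open>Besides cancelling the constant \<open>\<kappa>\<close>, the step width
    \<open>?m\<close> makes the action of the cyclotomic factor a telescoping sum around the
    cycle.\<close>
  define s where "s j = \<phi> (\<epsilon> ^ (?m + j) * t1) - \<phi> (\<epsilon> ^ j * t1)" for j
  define fp where "fp = (\<Sum>i<n. monom (f i) i)"
  have cf: "coeff fp i = (if i < n then f i else 0)" for i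
    unfolding fp_def by (simp add: coeff_sum coeff_monom)
  have dfp: "degree fp \<le> n - 1" unfolding fp_def
    by (intro degree_sum_le) (auto intro: order_trans[OF degree_monom_le])
  have "shift_act fp s j = 0" for j
  proof -
    have "shift_act fp s j = (\<Sum>i<n. of_int (f i) * s (i + j))"
      by (subst shift_act_bound[OF dfp]) (use n0 in \<open>simp add: cf lessThan_Suc_atMost[symmetric]\<close>)
    also have "\<dots> = F (\<epsilon> ^ (?m + j) * t1) - F (\<epsilon> ^ j * t1)"
      unfolding F_def s_def sum_subtractf[symmetric] by (intro sum.cong) (simp_all add: power_add algebra_simps)
    finally show ?thesis using F\<kappa>[OF rot[OF nt(1)]] by simp
  qed
  moreover have "shift_act (cycl p ?m) s j = 0" for j
  proof -
    have mono: "shift_act (monom a i) s j = of_int a * s (i + j)" for a i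
    proof (induction i arbitrary: j)
      case (Suc i)
      then show ?case by (simp add: monom_Suc shift_act_pCons)
    qed (simp add: monom_0 shift_act_def)
    have "shift_act (\<Sum>t<q. monom 1 (?m * t)) s j = (\<Sum>t<q. s (?m * t + j))" for q
      by (induction q) (simp_all add: shift_act_add mono, simp add: shift_act_def)
    then have "shift_act (cycl p ?m) s j = (\<Sum>t<p. s (?m * t + j))" unfolding cycl_def .
    also have "\<dots> = (\<Sum>t<p. \<phi> (\<epsilon> ^ (?m * Suc t + j) * t1) - \<phi> (\<epsilon> ^ (?m * t + j) * t1))"
      unfolding s_def by (simp add: add.assoc)
    also have "\<dots> = \<phi> (\<epsilon> ^ (?m * p + j) * t1) - \<phi> (\<epsilon> ^ j * t1)"
      using sum_lessThan_telescope[of "\<lambda>t. \<phi> (\<epsilon> ^ (?m * t + j) * t1)" p] by simp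
    also have "\<epsilon> ^ (?m * p + j) = \<epsilon> ^ j" using eps n by (simp add: power_add)
    finally show ?thesis by simp
  qed
  moreover have "s 0 \<noteq> 0" using nt(2) unfolding s_def \<phi>_def by simp
  ultimately have "cycl p ?m dvd fp" using cycl_annihilator[OF p] by blast
  moreover have "degree fp < ?m * p" unfolding n[symmetric] using dfp n0 by linarith
  ultimately have "coeff fp 0 = coeff fp ?m"
    using cycl_multiple_periodic[of p ?m fp] prime_gt_1_nat[OF p] prime_gt_0_nat[OF p] by simp
  moreover have "?m < n" using n n0 prime_gt_1_nat[OF p] by simp
  ultimately show ?thesis using n0 by (simp add: cf)
qed

end

text \<open>With \<open>h w = w ^ n * P (1 / w)\<close>, nonzero at 0, the function
  \<open>v w = w * (lead_coeff P / h w) ^ (1 / n)\<close> satisfies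
  \<open>v w ^ n = lead_coeff P / P (1 / w)\<close>. Its local inverse is
  \<open>\<omega>\<close>.\<close>

lemma infinity_chart_exists:
  assumes n: "degree P = n" "n > 0"
  obtains \<omega> \<delta> \<epsilon> where "infinity_chart P \<omega> \<delta> n \<epsilon>"
proof -
  let ?c = "lead_coeff P" and ?h = "reflect_poly P"
  have c: "?c \<noteq> 0" using n by auto
  have "open {w. poly ?h w \<noteq> 0}" by (intro open_Collect_neq continuous_intros)
  moreover have h0: "poly ?h 0 = ?c" by simp
  moreover have "0 \<in> {w. poly ?h w \<noteq> 0}" using c h0 by simp
  ultimately obtain \<rho> where \<rho>0: "\<rho> > 0" "ball 0 \<rho> \<subseteq> {w. poly ?h w \<noteq> 0}"
    using open_contains_ball[of "{w. poly ?h w \<noteq> 0}"] by meson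
  then have \<rho>: "\<rho> > 0" "\<And>w. w \<in> ball 0 \<rho> \<Longrightarrow> poly ?h w \<noteq> 0" by blast+
  obtain G where G: "G holomorphic_on ball 0 \<rho>" "\<And>w. w \<in> ball 0 \<rho> \<Longrightarrow> exp (G w) = ?c / poly ?h w"
    by (rule holomorphic_logarithm_exists[of "ball 0 \<rho>" "\<lambda>w. ?c / poly ?h w" 0])
      (use \<rho> c in \<open>auto intro!: holomorphic_intros\<close>)
  define v where "v w = w * exp (G w / of_nat n)" for w
  have vn: "v w ^ n = w ^ n * (?c / poly ?h w)" if "w \<in> ball 0 \<rho>" for w
  proof -
    have "exp (G w / of_nat n) ^ n = exp (G w)" using n by (simp add: exp_of_nat_mult[symmetric])
    then show ?thesis unfolding v_def using G(2)[OF that] by (simp add: power_mult_distrib)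
  qed
  have holv: "v holomorphic_on ball 0 \<rho>" unfolding v_def using n by (intro holomorphic_intros G) auto
  have Gd: "(G has_field_derivative deriv G 0) (at 0)" using holomorphic_derivI[OF G(1)] \<rho> by auto
  have "(v has_field_derivative exp (G 0 / of_nat n)) (at 0)"
    unfolding v_def by (rule derivative_eq_intros Gd refl | simp add: n)+
  then have dv: "deriv v 0 \<noteq> 0" by (simp add: DERIV_imp_deriv)
  have in\<rho>: "0 \<in> ball (0::complex) \<rho>" using \<rho>(1) by simp
  obtain r where r: "r > 0" "ball (0::complex) r \<subseteq> ball 0 \<rho>" "open (v ` ball 0 r)" "inj_on v (ball 0 r)"
    by (rule has_complex_derivative_locally_invertible[OF holv in\<rho> open_ball dv])
  obtain \<omega> where \<omega>: "\<omega> holomorphic_on v ` ball 0 r" "\<And>w. w \<in> ball 0 r \<Longrightarrow> \<omega> (v w) = w"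
    using holomorphic_has_inverse[OF holomorphic_on_subset[OF holv r(2)] open_ball r(4)] by metis
  have v0: "v 0 = 0" by (simp add: v_def)
  then have "0 \<in> v ` ball 0 r" using r(1) by (intro image_eqI[of _ _ 0]) auto
  then obtain \<delta> where \<delta>: "\<delta> > 0" "ball 0 \<delta> \<subseteq> v ` ball 0 r" using r(3) open_contains_ball by metis
  have vw: "\<omega> t \<in> ball 0 r \<and> v (\<omega> t) = t" if t: "t \<in> ball 0 \<delta>" for t
  proof -
    obtain w where w: "w \<in> ball 0 r" "t = v w" using \<delta>(2) t by blast
    then show ?thesis using \<omega>(2)[OF w(1)] by simp
  qed
  define \<epsilon> where "\<epsilon> = exp (2 * of_real pi * \<i> / of_nat n)"
  have epsi: "\<epsilon> ^ i = exp (2 * of_real pi * \<i> * of_nat i / of_nat n)" for i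
    unfolding \<epsilon>_def exp_of_nat_mult[symmetric] by (simp add: mult_ac)
  have "infinity_chart P \<omega> \<delta> n \<epsilon>"
  proof
    show "degree P = n" "n > 0" "\<delta> > 0" using n \<delta> by auto
    show "\<omega> holomorphic_on ball 0 \<delta>" using \<omega>(1) \<delta>(2) by (rule holomorphic_on_subset)
    show "inj_on \<omega> (ball 0 \<delta>)" using vw by (metis inj_on_inverseI)
    show "\<omega> 0 = 0" using \<omega>(2)[of 0] v0 r(1) by simp
    show "poly P (1 / \<omega> t) = ?c / t ^ n" if t: "t \<in> ball 0 \<delta>" "t \<noteq> 0" for t
    proof -
      have w: "\<omega> t \<in> ball 0 \<rho>" "v (\<omega> t) = t" using vw[OF t(1)] r(2) by auto
      have w0: "\<omega> t \<noteq> 0" using w(2) t(2) v0 by auto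
      have "poly ?h (\<omega> t) = \<omega> t ^ n * poly P (1 / \<omega> t)"
        using poly_reflect_poly_nz[OF w0, of P] n by (simp add: inverse_eq_divide)
      moreover have "t ^ n = \<omega> t ^ n * (?c / poly ?h (\<omega> t))" using vn[OF w(1)] w(2) by simp
      ultimately show ?thesis using c \<rho>(2)[OF w(1)] w0 t(2) by (simp add: field_simps)
    qed
    show "\<epsilon> ^ n = 1" unfolding epsi using n by (simp add: exp_two_pi_i)
    show "inj_on (\<lambda>i. \<epsilon> ^ i) {..<n}"
    proof (rule inj_onI)
      fix i j assume ij: "i \<in> {..<n}" "j \<in> {..<n}" "\<epsilon> ^ i = \<epsilon> ^ j"
      then have "i mod n = j mod n"
        using complex_root_unity_eq[of n i j] n unfolding epsi by (simp add: cong_def)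
      then show "i = j" using ij by simp
    qed
  qed
  then show ?thesis using that by blast
qed


context infinity_chart
begin

text \<open>Near \<open>t0\<close> a sheet over \<open>D\<close> and a sheet of the chart that meet
  over \<open>t0\<close> coincide, because the image of the former is open.\<close>

lemma chart_sheet:
  assumes br: "branches P D Bs" and \<beta>: "\<beta> \<in> Bs" and t0: "t0 \<in> A" and z: "lead_coeff P / t0 ^ n \<in> D"
    and eq: "\<beta> (lead_coeff P / t0 ^ n) = 1 / \<omega> (\<epsilon> ^ i * t0)"
  shows "eventually (\<lambda>t. t \<in> A \<and> lead_coeff P / t ^ n \<in> D \<and> \<beta> (lead_coeff P / t ^ n) = 1 / \<omega> (\<epsilon> ^ i * t)) (nhds t0)"
proof -
  let ?x = "\<lambda>t. 1 / \<omega> (\<epsilon> ^ i * t)"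
  have "open (\<beta> ` D)" using branch_image_open[OF br \<beta>] branchesD(1)[OF br] by blast
  moreover have "continuous_on A ?x" using inv_hol holomorphic_on_imp_continuous_on by blast
  ultimately have op: "open (A \<inter> ?x -` (\<beta> ` D))" using open_A by (intro continuous_open_preimage)
  have "?x t0 \<in> \<beta> ` D" using eq z by (intro image_eqI[of _ _ "lead_coeff P / t0 ^ n"]) simp_all
  then have "eventually (\<lambda>t. t \<in> A \<inter> ?x -` (\<beta> ` D)) (nhds t0)"
    using op t0 by (intro eventually_nhds_in_open) auto
  then show ?thesis
  proof (rule eventually_mono)
    fix t assume t: "t \<in> A \<inter> ?x -` (\<beta> ` D)"
    then have "poly P (?x t) \<in> D \<and> \<beta> (poly P (?x t)) = ?x t" using branch_image_iff[OF br \<beta>] by blast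
    then show "t \<in> A \<and> lead_coeff P / t ^ n \<in> D \<and> \<beta> (lead_coeff P / t ^ n) = ?x t"
      using t P_rot[of t i] by simp
  qed
qed

text \<open>The map \<open>t \<mapsto> lead_coeff P / t ^ n\<close> is locally biholomorphic, so a
  property valid near \<open>t0\<close> holds over an open set of values, from where analytic
  continuation in the value can start.\<close>

lemma value_open_image:
  assumes t0: "t0 \<in> A" and ev: "eventually (\<lambda>t. R t) (nhds t0)"
  shows "\<exists>V. open V \<and> V \<noteq> {} \<and> (\<forall>w\<in>V. \<exists>t. R t \<and> w = lead_coeff P / t ^ n)"
proof -
  let ?z = "\<lambda>t. lead_coeff P / t ^ n"
  obtain U where U: "open U" "t0 \<in> U" "\<And>t. t \<in> U \<Longrightarrow> R t" using ev unfolding eventually_nhds by blast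
  have op: "open (U \<inter> A)" using U open_A by blast
  have hol: "?z holomorphic_on (U \<inter> A)" unfolding A_def by (intro holomorphic_intros) auto
  \<comment> \<open>Taking \<open>Q = P\<close> in \<open>tower_value\<close> computes the
    derivative of the value itself.\<close>
  have "((\<lambda>t. poly P (1 / \<omega> (\<epsilon> ^ 0 * t))) has_field_derivative
      - (of_nat n * lead_coeff P / t0 ^ Suc n) *
        (poly (pderiv P) (1 / \<omega> (\<epsilon> ^ 0 * t0)) / poly (pderiv P) (1 / \<omega> (\<epsilon> ^ 0 * t0)))) (at t0)"
    by (rule tower_value(2)[OF t0])
  then have "(?z has_field_derivative
      - (of_nat n * lead_coeff P / t0 ^ Suc n) *
        (poly (pderiv P) (1 / \<omega> (\<epsilon> ^ 0 * t0)) / poly (pderiv P) (1 / \<omega> (\<epsilon> ^ 0 * t0)))) (at t0)"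
    by (rule has_field_derivative_transform_within_open[OF _ open_A t0]) (use P_rot[of _ 0] in simp)
  then have "deriv ?z t0 = - (of_nat n * lead_coeff P / t0 ^ Suc n)"
    using tower_value(1)[OF t0, of 0] by (simp add: DERIV_imp_deriv)
  then have dz: "deriv ?z t0 \<noteq> 0" using n0 lc0 t0 unfolding A_def by simp
  have t0U: "t0 \<in> U \<inter> A" using U t0 by blast
  obtain r where r: "r > 0" "ball t0 r \<subseteq> U \<inter> A" "open (?z ` ball t0 r)" "inj_on ?z (ball t0 r)"
    by (rule has_complex_derivative_locally_invertible[OF hol t0U op dz])
  have "\<forall>w\<in>?z ` ball t0 r. \<exists>t. R t \<and> w = ?z t"
  proof
    fix w assume "w \<in> ?z ` ball t0 r"
    then obtain t where "t \<in> ball t0 r" "w = ?z t" by blast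
    then show "\<exists>t. R t \<and> w = ?z t" using r(2) U(3) by (intro exI[of _ t]) blast
  qed
  then show ?thesis using r by (intro exI[of _ "?z ` ball t0 r"]) auto
qed

end

text \<open>Germ equality of the members of \<open>\<Q>\<close> along two branches of the inverse of \<open>P\<close>.\<close>
definition same_germ :: "complex poly \<Rightarrow> complex set \<Rightarrow> complex poly set \<Rightarrow> complex \<Rightarrow> complex \<Rightarrow> bool" where
  "same_germ P B \<Q> x y \<longleftrightarrow> poly P x \<notin> B \<and> poly P y = poly P x \<and>
     (\<exists>D Bs \<beta>1 \<beta>2. branches P D Bs \<and> poly P x \<in> D \<and> \<beta>1 \<in> Bs \<and> \<beta>2 \<in> Bs \<and>
        \<beta>1 (poly P x) = x \<and> \<beta>2 (poly P x) = y \<and> (\<forall>w\<in>D. \<forall>Q\<in>\<Q>. poly Q (\<beta>1 w) = poly Q (\<beta>2 w)))"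

text \<open>The witnesses hidden in \<open>same_germ\<close> may be exchanged: the pairs of branches
  agree near \<open>poly P x\<close>, and the identity theorem spreads the equality over
  \<open>D'\<close>.\<close>

lemma same_germD:
  assumes E: "same_germ P B \<Q> x y" and br: "branches P D' Bs'" and z: "poly P x \<in> D'"
    and \<beta>: "\<beta>1' \<in> Bs'" "\<beta>2' \<in> Bs'" "\<beta>1' (poly P x) = x" "\<beta>2' (poly P x) = y" and w: "w \<in> D'" and Q: "Q \<in> \<Q>"
  shows "poly Q (\<beta>1' w) = poly Q (\<beta>2' w)"
proof -
  obtain D Bs \<beta>1 \<beta>2 where D: "branches P D Bs" "poly P x \<in> D" "\<beta>1 \<in> Bs" "\<beta>2 \<in> Bs"
    "\<beta>1 (poly P x) = x" "\<beta>2 (poly P x) = y" and eq: "\<And>w Q. w \<in> D \<Longrightarrow> Q \<in> \<Q> \<Longrightarrow> poly Q (\<beta>1 w) = poly Q (\<beta>2 w)"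
    using E unfolding same_germ_def by (elim exE conjE) simp
  from branches_agree[OF D(1) br D(2) z D(3) \<beta>(1)] D(5) \<beta>(3)
  obtain r1 where r1: "r1 > 0" "ball (poly P x) r1 \<subseteq> D \<inter> D'" "\<And>w. w \<in> ball (poly P x) r1 \<Longrightarrow> \<beta>1 w = \<beta>1' w" by metis
  from branches_agree[OF D(1) br D(2) z D(4) \<beta>(2)] D(6) \<beta>(4)
  obtain r2 where r2: "r2 > 0" "\<And>w. w \<in> ball (poly P x) r2 \<Longrightarrow> \<beta>2 w = \<beta>2' w" by metis
  let ?U = "ball (poly P x) (min r1 r2)"
  have hol: "(\<lambda>w. poly Q (\<beta> w)) holomorphic_on D'" if "\<beta> \<in> Bs'" for \<beta>
    using branchesD(4)[OF br that] by (rule holomorphic_on_poly_compose)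
  show ?thesis
  proof (rule analytic_continuation_open[of ?U D' "\<lambda>w. poly Q (\<beta>1' w)" "\<lambda>w. poly Q (\<beta>2' w)" w])
    show "?U \<subseteq> D'" "?U \<noteq> {}" using r1 r2 by auto
    show "open ?U" "open D'" "connected D'" "w \<in> D'" using branchesD(1,2)[OF br] w by simp_all
    show "(\<lambda>w. poly Q (\<beta>1' w)) holomorphic_on D'" "(\<lambda>w. poly Q (\<beta>2' w)) holomorphic_on D'"
      using hol \<beta> by blast+
    show "poly Q (\<beta>1' v) = poly Q (\<beta>2' v)" if "v \<in> ?U" for v
    proof -
      have "v \<in> D" "\<beta>1 v = \<beta>1' v" "\<beta>2 v = \<beta>2' v" using r1(2) r1(3)[of v] r2(2)[of v] that by auto
      then show ?thesis using eq[OF _ Q, of v] by simp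
    qed
  qed
qed

lemma fibre_relation_same_germ:
  assumes deg: "degree P > 0" and B: "finite B" and crit: "\<And>x. poly (pderiv P) x = 0 \<Longrightarrow> poly P x \<in> B"
  shows "fibre_relation P B (same_germ P B \<Q>)"
proof
  have ex: "\<exists>D Bs. z \<in> D \<and> D \<inter> B = {} \<and> branches P D Bs" if z: "z \<notin> B" for z
  proof -
    obtain r Bs where "r > 0" "ball z r \<subseteq> - B" "branches P (ball z r) Bs"
      using branches_exist[OF deg, of z "- B"] crit z B by (metis Compl_iff finite_imp_closed open_Compl)
    then show ?thesis by (intro exI[of _ "ball z r"] exI[of _ Bs]) auto
  qed
  show "degree P > 0" "finite B" by fact+
  show "same_germ P B \<Q> x x" if x: "poly P x \<notin> B" for x
  proof -
    obtain D Bs where D: "poly P x \<in> D" "branches P D Bs" using ex[OF x] by blast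
    obtain \<beta> where "\<beta> \<in> Bs" "\<beta> (poly P x) = x" using branches_obtain[OF D(2,1)] by blast
    then show ?thesis unfolding same_germ_def using D x
      by (intro conjI exI[of _ D] exI[of _ Bs] exI[of _ \<beta>]) auto
  qed
  show "same_germ P B \<Q> y x" if E: "same_germ P B \<Q> x y" for x y
  proof -
    obtain D Bs \<beta>1 \<beta>2 where "poly P x \<notin> B" "poly P y = poly P x" "branches P D Bs" "poly P x \<in> D" "\<beta>1 \<in> Bs" "\<beta>2 \<in> Bs"
      "\<beta>1 (poly P x) = x" "\<beta>2 (poly P x) = y" "\<forall>w\<in>D. \<forall>Q\<in>\<Q>. poly Q (\<beta>1 w) = poly Q (\<beta>2 w)"
      using E unfolding same_germ_def by (elim exE conjE)
    then show ?thesis unfolding same_germ_def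
      by (intro conjI exI[of _ D] exI[of _ Bs] exI[of _ \<beta>2] exI[of _ \<beta>1]) auto
  qed
  show "same_germ P B \<Q> x z" if E1: "same_germ P B \<Q> x y" and E2: "same_germ P B \<Q> y z" for x y z
  proof -
    obtain D Bs \<beta>1 \<beta>2 where D: "poly P x \<notin> B" "poly P y = poly P x" "branches P D Bs" "poly P x \<in> D" "\<beta>1 \<in> Bs" "\<beta>2 \<in> Bs"
      "\<beta>1 (poly P x) = x" "\<beta>2 (poly P x) = y" and eq: "\<forall>w\<in>D. \<forall>Q\<in>\<Q>. poly Q (\<beta>1 w) = poly Q (\<beta>2 w)"
      using E1 unfolding same_germ_def by (elim exE conjE)
    have zx: "poly P z = poly P x" using E2 D(2) unfolding same_germ_def by simp
    then obtain \<beta>3 where \<beta>3: "\<beta>3 \<in> Bs" "\<beta>3 (poly P x) = z" using branches_obtain[OF D(3), of z] D(4) by metis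
    \<comment> \<open>The second relation is moved to the sheets that witness the first one.\<close>
    have "poly Q (\<beta>2 w) = poly Q (\<beta>3 w)" if "w \<in> D" "Q \<in> \<Q>" for w Q
      by (rule same_germD[OF E2 D(3)]) (use D \<beta>3 that in simp_all)
    then show ?thesis unfolding same_germ_def using D \<beta>3 zx eq
      by (intro conjI exI[of _ D] exI[of _ Bs] exI[of _ \<beta>1] exI[of _ \<beta>3]) auto
  qed
  show "poly P x \<notin> B \<and> poly P y = poly P x" if "same_germ P B \<Q> x y" for x y
    using that unfolding same_germ_def by (elim conjE) simp
  show "\<exists>D Bs. z \<in> D \<and> D \<inter> B = {} \<and> branches P D Bs \<and>
      (\<forall>\<beta>1\<in>Bs. \<forall>\<beta>2\<in>Bs. \<forall>w\<in>D. \<forall>w'\<in>D. same_germ P B \<Q> (\<beta>1 w) (\<beta>2 w) \<longrightarrow> same_germ P B \<Q> (\<beta>1 w') (\<beta>2 w'))"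
    if z: "z \<notin> B" for z
  proof -
    obtain D Bs where D: "z \<in> D" "D \<inter> B = {}" "branches P D Bs" using ex[OF z] by blast
    have "same_germ P B \<Q> (\<beta>1 w') (\<beta>2 w')"
      if h: "\<beta>1 \<in> Bs" "\<beta>2 \<in> Bs" "w \<in> D" "w' \<in> D" "same_germ P B \<Q> (\<beta>1 w) (\<beta>2 w)" for \<beta>1 \<beta>2 w w'
    proof -
      note bv = branchesD(5)[OF D(3)]
      have "poly Q (\<beta>1 v) = poly Q (\<beta>2 v)" if "v \<in> D" "Q \<in> \<Q>" for v Q
        by (rule same_germD[OF h(5) D(3) _ h(1,2)]) (use h that in \<open>simp_all add: bv\<close>)
      then show ?thesis unfolding same_germ_def using h D(2,3)
        by (intro conjI exI[of _ D] exI[of _ Bs] exI[of _ \<beta>1] exI[of _ \<beta>2]) (auto simp: bv)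
    qed
    then show ?thesis using D by (intro exI[of _ D] exI[of _ Bs]) blast
  qed
qed

text \<open>Invariance under \<open>m\<close> steps of the monodromy at infinity identifies the
  germs of all members of \<open>\<Q>\<close> on sheets 0 and \<open>m\<close>. These are different
  points of one fibre, so a class of \<open>same_germ\<close> is nontrivial.\<close>

lemma (in infinity_chart) common_composition:
  assumes B: "finite B" and crit: "\<And>x. poly (pderiv P) x = 0 \<Longrightarrow> poly P x \<in> B"
    and m: "0 < m" "m < n"
    and inv: "\<And>Q t. Q \<in> \<Q> \<Longrightarrow> t \<in> A \<Longrightarrow> poly Q (1 / \<omega> (\<epsilon> ^ m * t)) = poly Q (1 / \<omega> t)"
  shows "\<exists>W. degree W \<ge> 2 \<and> (\<forall>R\<in>insert P \<Q>. \<exists>R'. R = pcompose R' W)"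
proof -
  have deg: "degree P > 0" using degP n0 by simp
  interpret fibre_relation P B "same_germ P B \<Q>" by (rule fibre_relation_same_germ[OF deg B crit])
  have "\<delta> / 2 \<in> A" unfolding A_def using \<delta> by auto
  obtain M where M: "\<And>z. z \<in> B \<Longrightarrow> norm z \<le> M" using finite_imp_bounded[OF B] unfolding bounded_iff by blast
  obtain r where r: "r > 0" "\<And>s. s \<in> A \<Longrightarrow> norm s < r \<Longrightarrow> M < norm (lead_coeff P / s ^ n)"
    using large_value[OF \<open>\<delta> / 2 \<in> A\<close>, of M] by blast
  define t0 :: complex where "t0 = of_real (min (r / 2) (\<delta> / 2))"
  have t0: "t0 \<in> A" "norm t0 < r" unfolding A_def t0_def using r \<delta> by auto
  let ?z = "lead_coeff P / t0 ^ n" and ?x = "1 / \<omega> (\<epsilon> ^ 0 * t0)" and ?y = "1 / \<omega> (\<epsilon> ^ m * t0)"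
  have zB: "?z \<notin> B" using r(2)[OF t0] M by (metis not_le)
  have Px: "poly P ?x = ?z" "poly P ?y = ?z" using P_rot[OF t0(1)] by blast+
  obtain D Bs where D: "?z \<in> D" "branches P D Bs" using E_lc[OF zB] by (elim exE conjE)
  obtain \<beta>1 where b1: "\<beta>1 \<in> Bs" "\<beta>1 ?z = ?x" using branches_obtain[OF D(2), of ?x] D(1) unfolding Px by blast
  obtain \<beta>2 where b2: "\<beta>2 \<in> Bs" "\<beta>2 ?z = ?y" using branches_obtain[OF D(2), of ?y] D(1) unfolding Px by blast
  have "eventually (\<lambda>t. (t \<in> A \<and> lead_coeff P / t ^ n \<in> D \<and> \<beta>1 (lead_coeff P / t ^ n) = 1 / \<omega> (\<epsilon> ^ 0 * t)) \<and>
      (t \<in> A \<and> lead_coeff P / t ^ n \<in> D \<and> \<beta>2 (lead_coeff P / t ^ n) = 1 / \<omega> (\<epsilon> ^ m * t))) (nhds t0)"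
    by (intro eventually_conj chart_sheet[OF D(2) b1(1) t0(1) D(1) b1(2)] chart_sheet[OF D(2) b2(1) t0(1) D(1) b2(2)])
  from value_open_image[OF t0(1) this]
  obtain V where V: "open V" "V \<noteq> {}" and Vt: "\<forall>w\<in>V. \<exists>t. ((t \<in> A \<and> lead_coeff P / t ^ n \<in> D \<and> \<beta>1 (lead_coeff P / t ^ n) = 1 / \<omega> (\<epsilon> ^ 0 * t)) \<and>
      (t \<in> A \<and> lead_coeff P / t ^ n \<in> D \<and> \<beta>2 (lead_coeff P / t ^ n) = 1 / \<omega> (\<epsilon> ^ m * t))) \<and> w = lead_coeff P / t ^ n"
    by (elim exE conjE)
  have hol: "(\<lambda>w. poly Q (\<beta> w)) holomorphic_on D" if "\<beta> \<in> Bs" for \<beta> Q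
    using branchesD(4)[OF D(2) that] by (rule holomorphic_on_poly_compose)
  have VQ: "w \<in> D \<and> poly Q (\<beta>1 w) = poly Q (\<beta>2 w)" if wV: "w \<in> V" and QQ: "Q \<in> \<Q>" for w Q
    using bspec[OF Vt wV]
  proof (elim exE conjE)
    fix t assume "t \<in> A" "lead_coeff P / t ^ n \<in> D" "\<beta>1 (lead_coeff P / t ^ n) = 1 / \<omega> (\<epsilon> ^ 0 * t)"
      "\<beta>2 (lead_coeff P / t ^ n) = 1 / \<omega> (\<epsilon> ^ m * t)" "w = lead_coeff P / t ^ n"
    then show ?thesis using inv[OF QQ] by simp
  qed
  have "poly Q (\<beta>1 w) = poly Q (\<beta>2 w)" if "w \<in> D" "Q \<in> \<Q>" for w Q
  proof (rule analytic_continuation_open[of V D "\<lambda>w. poly Q (\<beta>1 w)" "\<lambda>w. poly Q (\<beta>2 w)" w])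
    show "V \<subseteq> D" using VQ[OF _ that(2)] by blast
    show "poly Q (\<beta>1 v) = poly Q (\<beta>2 v)" if "v \<in> V" for v using VQ[OF that \<open>Q \<in> \<Q>\<close>] by simp
    show "(\<lambda>w. poly Q (\<beta>1 w)) holomorphic_on D" "(\<lambda>w. poly Q (\<beta>2 w)) holomorphic_on D" by (rule hol[OF b1(1)], rule hol[OF b2(1)])
  qed (use V that branchesD(1,2)[OF D(2)] in simp_all)
  then have E: "same_germ P B \<Q> ?x ?y"
    unfolding same_germ_def Px using zB D b1 b2
    by (intro conjI exI[of _ D] exI[of _ Bs] exI[of _ \<beta>1] exI[of _ \<beta>2]) auto
  have "?x \<noteq> ?y" using inj_onD[OF roots_inj[OF t0(1)], of 0 m] m by auto
  from nontrivial_class_composition[OF E this] obtain W where W: "degree W \<ge> 2"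
    "\<And>R. (\<forall>x y. same_germ P B \<Q> x y \<longrightarrow> poly R x = poly R y) \<Longrightarrow> (\<exists>R'. R = pcompose R' W)" by blast
  have *: "poly R x = poly R y" if R: "R \<in> insert P \<Q>" and xy: "same_germ P B \<Q> x y" for R x y
  proof (cases "R = P")
    case True
    then show ?thesis using E_fibre[OF xy] by simp
  next
    case False
    with R have "R \<in> \<Q>" by simp
    obtain D Bs \<beta>1 \<beta>2 where "poly P x \<in> D" "\<beta>1 (poly P x) = x" "\<beta>2 (poly P x) = y" "\<forall>w\<in>D. \<forall>Q\<in>\<Q>. poly Q (\<beta>1 w) = poly Q (\<beta>2 w)"
      using xy unfolding same_germ_def by (elim exE conjE)
    then show ?thesis using \<open>R \<in> \<Q>\<close> by metis
  qed
  show ?thesis by (rule exI[of _ W]) (intro conjI ballI W allI impI *)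
qed

section \<open>Logarithmic sections\<close>

text \<open>The values lie in the discrete set of multiples of 2 pi i, whose distinct elements are
  at least 2 pi apart.\<close>

lemma exp_one_constant:
  fixes f :: "complex \<Rightarrow> complex"
  assumes "connected S" "continuous_on S f" "\<And>x. x \<in> S \<Longrightarrow> exp (f x) = 1" "x \<in> S" "y \<in> S"
  shows "f x = f y"
proof -
  have "f constant_on S"
  proof (rule continuous_discrete_range_constant[OF assms(1,2)])
    fix x assume x: "x \<in> S"
    have "2 * pi \<le> norm (f y - f x)" if y: "y \<in> S" "f y \<noteq> f x" for y
    proof -
      have "exp (f y - f x) = 1" using assms(3)[OF x] assms(3)[OF y(1)] by (simp add: exp_diff)
      then obtain k :: int where k: "Re (f y - f x) = 0" "Im (f y - f x) = of_int (2 * k) * pi" unfolding exp_eq_1 by blast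
      have "k \<noteq> 0" using k y(2) by (auto simp: complex_eq_iff)
      then have "1 \<le> \<bar>of_int k :: real\<bar>" by linarith
      then have "2 * pi \<le> \<bar>of_int (2 * k) * pi\<bar>" by (simp add: abs_mult)
      also have "\<dots> \<le> norm (f y - f x)" unfolding k(2)[symmetric] by (rule abs_Im_le_cmod)
      finally show ?thesis .
    qed
    then show "\<exists>e>0. \<forall>y. y \<in> S \<and> f y \<noteq> f x \<longrightarrow> e \<le> norm (f y - f x)" by (intro exI[of _ "2 * pi"]) auto
  qed
  then show ?thesis using assms(4,5) by (auto simp: constant_on_def)
qed

locale log_sections =
  fixes P q :: "complex poly" and a b :: complex and B :: "complex set" and Ap :: "complex poly"
  assumes degP: "degree P > 0" and finB: "finite B"
    and crit: "\<And>x. poly (pderiv P) x = 0 \<Longrightarrow> poly P x \<in> B" and aB: "poly P a \<in> B" and bB: "poly P b \<in> B"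
begin

text \<open>A choice of logarithm on the fibres over \<open>D\<close> for which the Cauchy transform
  vanishes; \<open>Ap\<close> is the polynomial part of the transform. Two sections over the same
  \<open>D\<close> differ by integral multiples of 2 pi i, and this is where integral relations come
  from.\<close>

definition Sec :: "complex set \<Rightarrow> (complex \<Rightarrow> complex) \<Rightarrow> bool" where
  "Sec D l \<longleftrightarrow> l holomorphic_on (poly P -` D) \<and> (\<forall>x\<in>poly P -` D. exp (l x) = (b - x) / (a - x)) \<and>
     (\<forall>w\<in>D. poly Ap w + (\<Sum>x\<in>{x. poly P x = w}. poly q x / poly (pderiv P) x * l x) = 0)"

lemma SecD:
  assumes "Sec D l"
  shows "l holomorphic_on (poly P -` D)" "\<And>x. poly P x \<in> D \<Longrightarrow> exp (l x) = (b - x) / (a - x)"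
    "\<And>w. w \<in> D \<Longrightarrow> poly Ap w + (\<Sum>x\<in>{x. poly P x = w}. poly q x / poly (pderiv P) x * l x) = 0"
  using assms unfolding Sec_def by auto

lemma Sec_subset: "Sec D l \<Longrightarrow> D' \<subseteq> D \<Longrightarrow> Sec D' l"
  unfolding Sec_def by (auto intro: holomorphic_on_subset)

lemma sec_branch_continuous:
  assumes "Sec D l" "branches P D2 Bs" "\<beta> \<in> Bs" "V \<subseteq> D" "V \<subseteq> D2"
  shows "(\<lambda>w. l (\<beta> w)) holomorphic_on V"
proof -
  have "l \<circ> \<beta> holomorphic_on V"
  proof (rule holomorphic_on_compose)
    show "\<beta> holomorphic_on V" using branchesD(4)[OF assms(2,3)] assms(5) by (rule holomorphic_on_subset)
    have "\<beta> ` V \<subseteq> poly P -` D" using branchesD(5)[OF assms(2,3)] assms(4,5) by auto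
    then show "l holomorphic_on \<beta> ` V" using SecD(1)[OF assms(1)] holomorphic_on_subset by blast
  qed
  then show ?thesis by (simp add: o_def)
qed

lemma sec_difference_constant:
  assumes "Sec D l" "Sec D l'" "branches P D2 Bs" "\<beta> \<in> Bs" "V \<subseteq> D" "V \<subseteq> D2" "connected V" "V \<inter> B = {}" "w \<in> V" "w' \<in> V"
  shows "l (\<beta> w) - l' (\<beta> w) = l (\<beta> w') - l' (\<beta> w')"
proof (rule exp_one_constant[of V "\<lambda>w. l (\<beta> w) - l' (\<beta> w)"])
  show "continuous_on V (\<lambda>w. l (\<beta> w) - l' (\<beta> w))"
    using assms by (intro holomorphic_on_imp_continuous_on holomorphic_intros sec_branch_continuous)
  fix v assume v: "v \<in> V"
  have Pv: "poly P (\<beta> v) = v" using branchesD(5)[OF assms(3,4)] assms(6) v by blast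
  then have "\<beta> v \<noteq> a" "\<beta> v \<noteq> b" using aB bB v assms(8) by auto
  then have "(b - \<beta> v) / (a - \<beta> v) \<noteq> 0" by simp
  then show "exp (l (\<beta> v) - l' (\<beta> v)) = 1"
    using SecD(2)[OF assms(1), of "\<beta> v"] SecD(2)[OF assms(2), of "\<beta> v"] Pv v assms(5) by (auto simp: exp_diff)
qed (use assms in auto)

text \<open>Over the convex set \<open>D\<close> no sheet meets \<open>a\<close> or
  \<open>b\<close>, so the logarithm exists along each sheet, with its constant fixed at
  \<open>w0\<close> by \<open>l'\<close>. The relation extends by the identity theorem.\<close>

lemma sec_extend:
  assumes br: "branches P D Bs" and D: "convex D" "D \<inter> B = {}" and D': "D' \<subseteq> D" "open D'" "connected D'" "w0 \<in> D'"
    and sec: "Sec D' l'"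
  shows "\<exists>l. Sec D l \<and> (\<forall>x. poly P x \<in> D' \<longrightarrow> l x = l' x)"
proof -
  note bP = branchesD(5)[OF br]
  have w0D: "w0 \<in> D" using D' by blast
  have nz: "\<beta> w \<noteq> a \<and> \<beta> w \<noteq> b \<and> a \<noteq> \<beta> w \<and> b \<noteq> \<beta> w \<and> poly (pderiv P) (\<beta> w) \<noteq> 0" if "\<beta> \<in> Bs" "w \<in> D" for \<beta> w
    using bP[OF that] aB bB crit[of "\<beta> w"] D(2) that(2) by auto
  have "\<exists>g. g holomorphic_on D \<and> (\<forall>w\<in>D. exp (g w) = (b - \<beta> w) / (a - \<beta> w))" if \<beta>: "\<beta> \<in> Bs" for \<beta>
  proof -
    have 1: "(\<lambda>w. (b - \<beta> w) / (a - \<beta> w)) holomorphic_on D"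
      using nz[OF \<beta>] branchesD(4)[OF br \<beta>] by (intro holomorphic_intros) auto
    have 2: "(b - \<beta> w) / (a - \<beta> w) \<noteq> 0" if "w \<in> D" for w using nz[OF \<beta> that] by auto
    show ?thesis
    proof (rule holomorphic_logarithm_exists[OF D(1) branchesD(1)[OF br] 1 2 w0D])
      fix g assume "g holomorphic_on D" "\<And>x. x \<in> D \<Longrightarrow> exp (g x) = (b - \<beta> x) / (a - \<beta> x)"
      then show ?thesis by blast
    qed
  qed
  then obtain G where G: "\<And>\<beta>. \<beta> \<in> Bs \<Longrightarrow> G \<beta> holomorphic_on D"
    "\<And>\<beta> w. \<beta> \<in> Bs \<Longrightarrow> w \<in> D \<Longrightarrow> exp (G \<beta> w) = (b - \<beta> w) / (a - \<beta> w)" by metis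
  define c where "c \<beta> = l' (\<beta> w0) - G \<beta> w0" for \<beta>
  have ec: "exp (c \<beta>) = 1" if \<beta>: "\<beta> \<in> Bs" for \<beta>
  proof -
    have "exp (l' (\<beta> w0)) = (b - \<beta> w0) / (a - \<beta> w0)" using SecD(2)[OF sec, of "\<beta> w0"] bP[OF \<beta> w0D] D'(4) by simp
    then show ?thesis unfolding c_def using G(2)[OF \<beta> w0D] nz[OF \<beta> w0D] by (simp add: exp_diff)
  qed
  \<comment> \<open>The unique sheet through \<open>x\<close>; it glues the logarithms on the
    separate sheets to one function on the preimage of \<open>D\<close>.\<close>
  define br' where "br' x = (THE \<beta>. \<beta> \<in> Bs \<and> \<beta> (poly P x) = x)" for x
  have br'_eq: "br' (\<beta> w) = \<beta>" if "\<beta> \<in> Bs" "w \<in> D" for \<beta> w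
    unfolding br'_def
  proof (rule the_equality)
    show "\<beta> \<in> Bs \<and> \<beta> (poly P (\<beta> w)) = \<beta> w" using that bP by simp
    fix \<gamma> assume "\<gamma> \<in> Bs \<and> \<gamma> (poly P (\<beta> w)) = \<beta> w"
    then show "\<gamma> = \<beta>" using inj_onD[OF branchesD(6)[OF br that(2)], of \<gamma> \<beta>] that bP[OF that] by simp
  qed
  define l where "l x = G (br' x) (poly P x) + c (br' x)" for x
  have l: "l (\<beta> w) = G \<beta> w + c \<beta>" if "\<beta> \<in> Bs" "w \<in> D" for \<beta> w
    unfolding l_def br'_eq[OF that] bP[OF that] by simp
  have agree: "l (\<beta> w) = l' (\<beta> w)" if \<beta>: "\<beta> \<in> Bs" and w: "w \<in> D'" for \<beta> w
  proof -
    have "G \<beta> w + c \<beta> - l' (\<beta> w) = G \<beta> w0 + c \<beta> - l' (\<beta> w0)"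
    proof (rule exp_one_constant[of D' "\<lambda>w. G \<beta> w + c \<beta> - l' (\<beta> w)"])
      have "G \<beta> holomorphic_on D'" using G(1)[OF \<beta>] D'(1) by (rule holomorphic_on_subset)
      then show "continuous_on D' (\<lambda>w. G \<beta> w + c \<beta> - l' (\<beta> w))"
        using sec_branch_continuous[OF sec br \<beta> subset_refl D'(1)]
        by (intro holomorphic_on_imp_continuous_on holomorphic_intros)
      fix v assume v: "v \<in> D'"
      then have vD: "v \<in> D" using D' by blast
      show "exp (G \<beta> v + c \<beta> - l' (\<beta> v)) = 1"
        using SecD(2)[OF sec, of "\<beta> v"] bP[OF \<beta> vD] v G(2)[OF \<beta> vD] ec[OF \<beta>] nz[OF \<beta> vD]
        by (simp add: exp_diff exp_add)
    qed (use D' w in auto)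
    moreover have "w \<in> D" using w D' by blast
    ultimately show ?thesis using l[OF \<beta>] by (simp add: c_def)
  qed
  have sumb: "(\<Sum>x\<in>{x. poly P x = w}. g x) = (\<Sum>\<beta>\<in>Bs. g (\<beta> w))" if "w \<in> D" for w and g :: "complex \<Rightarrow> complex"
    unfolding branchesD(7)[OF br that] by (simp add: sum.reindex branchesD(6)[OF br that])
  have "l holomorphic_on poly P -` D"
  proof (rule holomorphic_on_locally)
    fix x assume "x \<in> poly P -` D"
    then have xD: "poly P x \<in> D" by simp
    obtain \<beta> where \<beta>: "\<beta> \<in> Bs" "\<beta> (poly P x) = x" using branches_obtain[OF br xD] by blast
    have PD: "poly P ` \<beta> ` D \<subseteq> D" using bP[OF \<beta>(1)] by auto
    have "G \<beta> \<circ> poly P holomorphic_on \<beta> ` D"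
      by (rule holomorphic_on_compose) (auto intro!: holomorphic_intros holomorphic_on_subset[OF G(1)[OF \<beta>(1)] PD])
    then have "(\<lambda>x. G \<beta> (poly P x) + c \<beta>) holomorphic_on \<beta> ` D" by (intro holomorphic_intros) (simp add: o_def)
    then have "l holomorphic_on \<beta> ` D"
    proof (rule holomorphic_transform)
      fix y assume "y \<in> \<beta> ` D"
      then obtain w where w: "w \<in> D" "y = \<beta> w" by blast
      show "G \<beta> (poly P y) + c \<beta> = l y" unfolding w(2) l[OF \<beta>(1) w(1)] bP[OF \<beta>(1) w(1)] by simp
    qed
    moreover have "open (\<beta> ` D)" using branch_image_open[OF br \<beta>(1)] branchesD(1)[OF br] by blast
    ultimately show "\<exists>T. open T \<and> x \<in> T \<and> l holomorphic_on T"
      using \<beta> xD by (intro exI[of _ "\<beta> ` D"]) (auto intro: image_eqI[of _ _ "poly P x"])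
  qed
  moreover have "exp (l x) = (b - x) / (a - x)" if xD: "poly P x \<in> D" for x
  proof -
    obtain \<beta> where \<beta>: "\<beta> \<in> Bs" "\<beta> (poly P x) = x" using branches_obtain[OF br xD] by blast
    show ?thesis using l[OF \<beta>(1) xD] G(2)[OF \<beta>(1) xD] ec[OF \<beta>(1)] \<beta>(2) by (simp add: exp_add)
  qed
  moreover have "poly Ap w + (\<Sum>x\<in>{x. poly P x = w}. poly q x / poly (pderiv P) x * l x) = 0" if w: "w \<in> D" for w
  proof -
    define K where "K w = poly Ap w + (\<Sum>\<beta>\<in>Bs. poly q (\<beta> w) / poly (pderiv P) (\<beta> w) * (G \<beta> w + c \<beta>))" for w
    have "K holomorphic_on D" unfolding K_def
      using nz G(1) branchesD(4)[OF br] by (intro holomorphic_intros) auto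
    moreover have K0: "K v = 0" if v: "v \<in> D'" for v
    proof -
      have vD: "v \<in> D" using v D' by blast
      have "K v = poly Ap v + (\<Sum>\<beta>\<in>Bs. poly q (\<beta> v) / poly (pderiv P) (\<beta> v) * l' (\<beta> v))"
        unfolding K_def using agree[OF _ v] l[OF _ vD] by (intro arg_cong2[of _ _ _ _ "(+)"] sum.cong refl) simp
      also have "\<dots> = 0" using SecD(3)[OF sec v] sumb[OF vD] by simp
      finally show ?thesis .
    qed
    ultimately have "K w = 0"
      using analytic_continuation_open[of D' D K "\<lambda>_. 0" w] D' branchesD(1,2)[OF br] w by auto
    moreover have "K w = poly Ap w + (\<Sum>\<beta>\<in>Bs. poly q (\<beta> w) / poly (pderiv P) (\<beta> w) * l (\<beta> w))"
      unfolding K_def using l[OF _ w] by (intro arg_cong2[of _ _ _ _ "(+)"] sum.cong refl) simp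
    ultimately show ?thesis using sumb[OF w] by simp
  qed
  moreover have "l x = l' x" if xD: "poly P x \<in> D'" for x
  proof -
    have "poly P x \<in> D" using xD D' by blast
    then obtain \<beta> where \<beta>: "\<beta> \<in> Bs" "\<beta> (poly P x) = x" using branches_obtain[OF br] by blast
    show ?thesis using agree[OF \<beta>(1) xD] \<beta>(2) by simp
  qed
  ultimately show ?thesis unfolding Sec_def by (intro exI[of _ l]) auto
qed

lemma branch_ball:
  assumes "z \<notin> B"
  obtains r Bs where "r > 0" "ball z r \<inter> B = {}" "branches P (ball z r) Bs"
proof -
  obtain r Bs where "r > 0" "ball z r \<subseteq> - B" "branches P (ball z r) Bs"
    using branches_exist[OF degP, of z "- B"] crit assms finB by (metis Compl_iff finite_imp_closed open_Compl)
  then show ?thesis using that[of r Bs] by blast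
qed

text \<open>Continuation from ball to ball in the connected complement of \<open>B\<close>. Sections
  over different neighbourhoods are not glued, so a change of value after a loop does no
  harm.\<close>

lemma sec_everywhere:
  assumes "z0 \<notin> B" "open D0" "z0 \<in> D0" "Sec D0 l0" "z \<notin> B"
  shows "\<exists>D l. open D \<and> z \<in> D \<and> Sec D l"
proof (rule connected_induction_simple[of "- B" z0 z "\<lambda>z. \<exists>D l. open D \<and> z \<in> D \<and> Sec D l"])
  show "connected (- B)" using connected_open_delete_finite[of "UNIV :: complex set" B] finB connected_UNIV
    by (simp add: Compl_eq_Diff_UNIV)
  show "\<exists>D l. open D \<and> z0 \<in> D \<and> Sec D l" using assms by blast
  fix u assume "u \<in> - B"
  then obtain r Bs where r: "r > 0" "ball u r \<inter> B = {}" "branches P (ball u r) Bs" using branch_ball[of u] by auto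
  have *: "\<exists>D l. open D \<and> y \<in> D \<and> Sec D l"
    if x: "x \<in> ball u r" and y: "y \<in> ball u r" and ex: "\<exists>D l. open D \<and> x \<in> D \<and> Sec D l" for x y
  proof -
    obtain D l where D: "open D" "x \<in> D" "Sec D l" using ex by blast
    obtain s where s: "s > 0" "ball x s \<subseteq> D \<inter> ball u r"
      using openE[of "D \<inter> ball u r" x] D x by auto
    have "\<exists>l'. Sec (ball u r) l' \<and> (\<forall>x'. poly P x' \<in> ball x s \<longrightarrow> l' x' = l x')"
      by (rule sec_extend[OF r(3) convex_ball r(2), of "ball x s" x]) (use s Sec_subset[OF D(3)] in auto)
    then show ?thesis using y by (metis open_ball)
  qed
  have 1: "openin (top_of_set (- B)) (ball u r)" using r(2) by (intro open_subset) auto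
  have 2: "u \<in> ball u r" using r(1) by simp
  show "\<exists>T. openin (top_of_set (- B)) T \<and> u \<in> T \<and>
     (\<forall>x\<in>T. \<forall>y\<in>T. (\<exists>D l. open D \<and> x \<in> D \<and> Sec D l) \<longrightarrow> (\<exists>D l. open D \<and> y \<in> D \<and> Sec D l))"
    by (rule exI[of _ "ball u r"]) (intro conjI ballI impI 1 2; rule * )
qed (use assms in auto)

text \<open>Two sections differ at \<open>x\<close> and at \<open>y\<close> by multiples of 2 pi i;
  the points are related if these multiples always agree. Quantifying over all pairs of sections
  takes account of every continuation without mentioning paths.\<close>

definition E :: "complex \<Rightarrow> complex \<Rightarrow> bool" where
  "E x y \<longleftrightarrow> poly P x \<notin> B \<and> poly P y = poly P x \<and>
     (\<forall>D l l'. open D \<longrightarrow> poly P x \<in> D \<longrightarrow> Sec D l \<longrightarrow> Sec D l' \<longrightarrow> l x - l y = l' x - l' y)"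

lemma ED: "E x y \<Longrightarrow> open D \<Longrightarrow> poly P x \<in> D \<Longrightarrow> Sec D l \<Longrightarrow> Sec D l' \<Longrightarrow> l x - l y = l' x - l' y"
  unfolding E_def by blast

text \<open>Sections near \<open>w'\<close> extend to the whole ball, and there the difference of
  two sections is constant along each sheet. So the test at \<open>w'\<close> can be made at
  \<open>w\<close>.\<close>

lemma E_transport:
  assumes br: "branches P (ball u r) Bs" "ball u r \<inter> B = {}"
    and h: "\<beta>1 \<in> Bs" "\<beta>2 \<in> Bs" "w \<in> ball u r" "w' \<in> ball u r" "E (\<beta>1 w) (\<beta>2 w)"
  shows "E (\<beta>1 w') (\<beta>2 w')"
proof -
  note bv = branchesD(5)[OF br(1)]
  have *: "l (\<beta>1 w') - l (\<beta>2 w') = l' (\<beta>1 w') - l' (\<beta>2 w')"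
    if D: "open D" "w' \<in> D" "Sec D l" "Sec D l'" for D l l'
  proof -
    obtain s where s: "s > 0" "ball w' s \<subseteq> D \<inter> ball u r" using openE[of "D \<inter> ball u r" w'] D h by auto
    have sD: "ball w' s \<subseteq> D" "ball w' s \<subseteq> ball u r" using s by auto
    obtain L where L: "Sec (ball u r) L" "\<And>x. poly P x \<in> ball w' s \<Longrightarrow> L x = l x"
      using sec_extend[OF br(1) convex_ball br(2) sD(2) open_ball connected_ball _ Sec_subset[OF D(3) sD(1)], of w'] s(1) by auto
    obtain L' where L': "Sec (ball u r) L'" "\<And>x. poly P x \<in> ball w' s \<Longrightarrow> L' x = l' x"
      using sec_extend[OF br(1) convex_ball br(2) sD(2) open_ball connected_ball _ Sec_subset[OF D(4) sD(1)], of w'] s(1) by auto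
    have "L (\<beta>1 w) - L (\<beta>2 w) = L' (\<beta>1 w) - L' (\<beta>2 w)"
      by (rule ED[OF h(5) open_ball _ L(1) L'(1)]) (use bv[OF h(1,3)] h in simp)
    moreover have "L (\<beta>1 w) - L' (\<beta>1 w) = L (\<beta>1 w') - L' (\<beta>1 w')"
      by (rule sec_difference_constant[OF L(1) L'(1) br(1) h(1) subset_refl subset_refl connected_ball br(2) h(3,4)])
    moreover have "L (\<beta>2 w) - L' (\<beta>2 w) = L (\<beta>2 w') - L' (\<beta>2 w')"
      by (rule sec_difference_constant[OF L(1) L'(1) br(1) h(2) subset_refl subset_refl connected_ball br(2) h(3,4)])
    ultimately have "L (\<beta>1 w') - L (\<beta>2 w') = L' (\<beta>1 w') - L' (\<beta>2 w')" by algebra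
    moreover have "poly P (\<beta>1 w') \<in> ball w' s" "poly P (\<beta>2 w') \<in> ball w' s"
      using bv[OF h(1,4)] bv[OF h(2,4)] s(1) by auto
    ultimately show ?thesis using L(2) L'(2) by simp
  qed
  have "w' \<notin> B" using h br(2) by blast
  then show ?thesis unfolding E_def bv[OF h(1,4)] bv[OF h(2,4)]
    by (intro conjI allI impI refl *)
qed

sublocale fibre_relation P B E
proof
  show "degree P > 0" "finite B" by (fact degP, fact finB)
  show "poly P x \<notin> B \<Longrightarrow> E x x" for x unfolding E_def by simp
  show "E y x" if "E x y" for x y
  proof -
    have xy: "poly P y = poly P x" "poly P x \<notin> B" using that unfolding E_def by auto
    have *: "l y - l x = l' y - l' x" if "open D" "poly P y \<in> D" "Sec D l" "Sec D l'" for D l l'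
    proof -
      have "l x - l y = l' x - l' y" by (rule ED[OF \<open>E x y\<close> that(1) _ that(3,4)]) (use that(2) xy in simp)
      then show ?thesis by algebra
    qed
    show "E y x" unfolding E_def by (intro conjI allI impI * ) (use xy in simp_all)
  qed
  show "E x z" if "E x y" "E y z" for x y z
  proof -
    have xy: "poly P y = poly P x" "poly P x \<notin> B" "poly P z = poly P x" using that unfolding E_def by auto
    have *: "l x - l z = l' x - l' z" if "open D" "poly P x \<in> D" "Sec D l" "Sec D l'" for D l l'
    proof -
      have "l x - l y = l' x - l' y" by (rule ED[OF \<open>E x y\<close> that])
      moreover have "l y - l z = l' y - l' z" by (rule ED[OF \<open>E y z\<close> that(1) _ that(3,4)]) (use that(2) xy in simp)
      ultimately show ?thesis by algebra
    qed
    show "E x z" unfolding E_def by (intro conjI allI impI * ) (use xy in simp_all)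
  qed
  show "poly P x \<notin> B \<and> poly P y = poly P x" if "E x y" for x y using that unfolding E_def by simp
  show "\<exists>D Bs. z \<in> D \<and> D \<inter> B = {} \<and> branches P D Bs \<and>
      (\<forall>\<beta>1\<in>Bs. \<forall>\<beta>2\<in>Bs. \<forall>w\<in>D. \<forall>w'\<in>D. E (\<beta>1 w) (\<beta>2 w) \<longrightarrow> E (\<beta>1 w') (\<beta>2 w'))" if z: "z \<notin> B" for z
  proof -
    obtain r Bs where r: "r > 0" "ball z r \<inter> B = {}" "branches P (ball z r) Bs" using branch_ball[OF z] by blast
    have *: "\<forall>\<beta>1\<in>Bs. \<forall>\<beta>2\<in>Bs. \<forall>w\<in>ball z r. \<forall>w'\<in>ball z r. E (\<beta>1 w) (\<beta>2 w) \<longrightarrow> E (\<beta>1 w') (\<beta>2 w')"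
      by (intro ballI impI) (rule E_transport[OF r(3,2)])
    have "z \<in> ball z r" using r(1) by simp
    then show ?thesis by (intro exI[of _ "ball z r"] exI[of _ Bs] conjI r(2,3) * )
  qed
qed

end

section \<open>Single-valued logarithms and orders of zeros\<close>

lemma no_punctured_log:
  fixes L :: "complex \<Rightarrow> complex"
  assumes r: "r > 0" and hol: "L holomorphic_on (ball x0 r - {x0})"
    and e: "\<And>x. x \<in> ball x0 r - {x0} \<Longrightarrow> exp (L x) = (x - x0) ^ k"
  shows "k = 0"
proof (rule ccontr)
  assume k: "k \<noteq> 0"
  have op: "open (ball x0 r - {x0})" by auto
  \<comment> \<open>Thus \<open>k / (x - x0)\<close> has the primitive \<open>L\<close> on the
    punctured disc and integral 0 around \<open>x0\<close>, while Cauchy's formula gives 2 pi i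
    times \<open>k\<close>.\<close>
  have dL: "(L has_field_derivative of_nat k / (x - x0)) (at x)" if x: "x \<in> ball x0 r - {x0}" for x
  proof -
    have x0: "x - x0 \<noteq> 0" using x by auto
    have d: "(L has_field_derivative deriv L x) (at x)" using holomorphic_derivI[OF hol op x] .
    have "((\<lambda>x. exp (L x)) has_field_derivative exp (L x) * deriv L x) (at x)"
      using d by (auto intro!: derivative_eq_intros)
    then have 1: "((\<lambda>x. (x - x0) ^ k) has_field_derivative exp (L x) * deriv L x) (at x)"
      by (rule has_field_derivative_transform_within_open[OF _ op x]) (simp add: e)
    have 2: "((\<lambda>x. (x - x0) ^ k) has_field_derivative of_nat k * (x - x0) ^ (k - 1)) (at x)"
      by (auto intro!: derivative_eq_intros)
    have "(x - x0) ^ k * deriv L x = of_nat k * (x - x0) ^ (k - 1)"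
      using DERIV_unique[OF 1 2] e[OF x] by simp
    moreover have "(x - x0) ^ k = (x - x0) * (x - x0) ^ (k - 1)" using k by (metis Suc_pred' gr0I power_Suc)
    ultimately have "(x - x0) ^ (k - 1) * ((x - x0) * deriv L x) = (x - x0) ^ (k - 1) * of_nat k" by (simp add: mult_ac)
    moreover have "(x - x0) ^ (k - 1) \<noteq> 0" using x0 by simp
    ultimately have "(x - x0) * deriv L x = of_nat k" using mult_left_cancel by blast
    then have "deriv L x = of_nat k / (x - x0)" using x0 by (simp add: field_simps)
    then show ?thesis using d by simp
  qed
  let ?c = "circlepath x0 (r/2)"
  have pi: "path_image ?c \<subseteq> ball x0 r - {x0}" using r by (auto simp: dist_norm)
  have "((\<lambda>x. of_nat k / (x - x0)) has_contour_integral (L (pathfinish ?c) - L (pathstart ?c))) ?c"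
    using contour_integral_primitive[of "ball x0 r - {x0}" L "\<lambda>x. of_nat k / (x - x0)" ?c] dL pi
    by (auto intro: has_field_derivative_at_within)
  then have 1: "contour_integral ?c (\<lambda>x. of_nat k / (x - x0)) = 0" by (simp add: contour_integral_unique)
  have "((\<lambda>x. of_nat k / (x - x0)) has_contour_integral 2 * complex_of_real pi * \<i> * of_nat k) ?c"
    using Cauchy_integral_circlepath_simple[of "\<lambda>_. of_nat k" x0 "r/2" x0] r by auto
  then have "2 * complex_of_real pi * \<i> * of_nat k = 0" using 1 contour_integral_unique by metis
  then show False using k by simp
qed

text \<open>If the order of \<open>U\<close> were larger by \<open>k > 0\<close>, then
  \<open>S\<close> minus a logarithm of the nonvanishing cofactor quotient would be a logarithm of
  \<open>(x - x0) ^ k\<close> on a punctured disc.\<close>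

lemma order_le_of_log:
  fixes U V :: "complex poly"
  assumes nz: "U \<noteq> 0" "V \<noteq> 0" and r: "r > 0" and hol: "S holomorphic_on (ball x0 r - {x0})"
    and eq: "\<And>x. x \<in> ball x0 r - {x0} \<Longrightarrow> poly U x = poly V x * exp (S x)"
  shows "order x0 U \<le> order x0 V"
proof (rule ccontr)
  assume "\<not> ?thesis"
  then obtain k where k: "order x0 U = order x0 V + k" "k > 0" by (metis less_imp_add_positive not_le)
  obtain U1 where U1: "U = [:-x0,1:] ^ order x0 U * U1" "\<not> [:-x0,1:] dvd U1" using order_decomp[OF nz(1)] by blast
  obtain V1 where V1: "V = [:-x0,1:] ^ order x0 V * V1" "\<not> [:-x0,1:] dvd V1" using order_decomp[OF nz(2)] by blast
  have n0: "poly U1 x0 \<noteq> 0" "poly V1 x0 \<noteq> 0" using U1 V1 by (auto simp: poly_eq_0_iff_dvd)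
  have "open ({x. poly U1 x \<noteq> 0} \<inter> {x. poly V1 x \<noteq> 0} \<inter> ball x0 r)"
    by (intro open_Int open_Collect_neq continuous_intros open_ball)
  moreover have "x0 \<in> {x. poly U1 x \<noteq> 0} \<inter> {x. poly V1 x \<noteq> 0} \<inter> ball x0 r" using n0 r by simp
  ultimately obtain s where s: "s > 0" "ball x0 s \<subseteq> {x. poly U1 x \<noteq> 0} \<inter> {x. poly V1 x \<noteq> 0} \<inter> ball x0 r"
    using openE by blast
  have nzs: "poly U1 x \<noteq> 0" "poly V1 x \<noteq> 0" "x \<in> ball x0 r" if "x \<in> ball x0 s" for x using s(2) that by auto
  have 1: "(\<lambda>x. poly U1 x / poly V1 x) holomorphic_on ball x0 s" using nzs by (intro holomorphic_intros) auto
  have 2: "poly U1 x / poly V1 x \<noteq> 0" if "x \<in> ball x0 s" for x using nzs[OF that] by simp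
  have 3: "x0 \<in> ball x0 s" using s by simp
  have "\<exists>H. H holomorphic_on ball x0 s \<and> (\<forall>x\<in>ball x0 s. exp (H x) = poly U1 x / poly V1 x)"
    by (rule holomorphic_logarithm_exists[OF convex_ball open_ball 1 2 3]) (assumption, blast)
  then obtain H where H: "H holomorphic_on ball x0 s" "\<And>x. x \<in> ball x0 s \<Longrightarrow> exp (H x) = poly U1 x / poly V1 x" by blast
  have "k = 0"
  proof (rule no_punctured_log[OF s(1)])
    show "(\<lambda>x. S x - H x) holomorphic_on ball x0 s - {x0}"
      by (intro holomorphic_intros holomorphic_on_subset[OF hol] holomorphic_on_subset[OF H(1)]) (use nzs in auto)
    fix x assume x: "x \<in> ball x0 s - {x0}"
    have xr: "x \<in> ball x0 r - {x0}" using x nzs by auto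
    have ne: "x - x0 \<noteq> 0" using x by auto
    have "poly U x = (x - x0) ^ (order x0 V + k) * poly U1 x" unfolding k(1)[symmetric]
      by (subst U1(1)) (simp add: poly_power)
    moreover have "poly V x = (x - x0) ^ order x0 V * poly V1 x" by (subst V1(1)) (simp add: poly_power)
    ultimately have "(x - x0) ^ (order x0 V + k) * poly U1 x = (x - x0) ^ order x0 V * poly V1 x * exp (S x)"
      using eq[OF xr] by (simp only:)
    then have "(x - x0) ^ order x0 V * ((x - x0) ^ k * poly U1 x) = (x - x0) ^ order x0 V * (poly V1 x * exp (S x))"
      by (simp only: power_add mult.assoc)
    moreover have "(x - x0) ^ order x0 V \<noteq> 0" using ne by simp
    ultimately have "(x - x0) ^ k * poly U1 x = poly V1 x * exp (S x)" using mult_left_cancel by blast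
    then have "exp (S x) = (x - x0) ^ k * (poly U1 x / poly V1 x)" using nzs x by (auto simp: field_simps)
    then show "exp (S x - H x) = (x - x0) ^ k" using H(2)[of x] x nzs[of x] by (simp add: exp_diff)
  qed
  then show False using k by simp
qed

lemma order_eq_of_log:
  fixes U V :: "complex poly"
  assumes nz: "U \<noteq> 0" "V \<noteq> 0" and r: "r > 0" and hol: "S holomorphic_on (ball x0 r - {x0})"
    and eq: "\<And>x. x \<in> ball x0 r - {x0} \<Longrightarrow> poly U x = poly V x * exp (S x)"
  shows "order x0 U = order x0 V"
proof (rule antisym)
  show "order x0 U \<le> order x0 V" by (rule order_le_of_log[OF nz r hol eq])
  show "order x0 V \<le> order x0 U"
  proof (rule order_le_of_log[OF nz(2,1) r])
    show "(\<lambda>x. - S x) holomorphic_on ball x0 r - {x0}" using hol by (intro holomorphic_intros)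
    fix x assume "x \<in> ball x0 r - {x0}"
    then show "poly V x = poly U x * exp (- S x)" using eq[of x] by (simp add: exp_minus)
  qed
qed

lemma full_order_power:
  assumes "N \<noteq> 0" "degree N \<le> e" "e \<le> order c N"
  shows "\<exists>k. k \<noteq> 0 \<and> N = smult k ([:-c,1:] ^ e)"
proof -
  have "[:-c,1:] ^ e dvd N" using order_divides[of c e N] assms by simp
  then obtain R where R: "N = [:-c,1:] ^ e * R" by (rule dvdE)
  have "R \<noteq> 0" using R assms(1) by auto
  then have "degree N = e + degree R" using R by (simp add: degree_mult_eq degree_linear_power)
  then have "degree R = 0" using assms(2) by simp
  then obtain k where k: "R = [:k:]" using degree_eq_zeroE by blast
  then show ?thesis using R \<open>R \<noteq> 0\<close> by (intro exI[of _ k]) (simp add: mult.commute)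
qed

lemma cross_multiply:
  fixes A :: complex
  assumes "A \<noteq> 0" "B' \<noteq> 0" "A' \<noteq> 0" "c = (B / A) / (B' / A')"
  shows "A * B' * c = B * A'"
  using assms by simp

context log_sections
begin

text \<open>For related points the difference \<open>l x - l y\<close> does not depend on the
  section, so any choice gives the same value; sections over all points outside \<open>B\<close>
  come from \<open>sec_everywhere\<close>.\<close>

definition C :: "complex \<Rightarrow> complex \<Rightarrow> complex" where
  "C x y = (SOME c. \<exists>D l. open D \<and> poly P x \<in> D \<and> Sec D l \<and> c = l x - l y)"

lemma C_eq:
  assumes E: "E x y" and D: "open D" "poly P x \<in> D" "Sec D l"
  shows "C x y = l x - l y"
proof -
  have "\<exists>D l. open D \<and> poly P x \<in> D \<and> Sec D l \<and> C x y = l x - l y"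
    unfolding C_def by (rule someI_ex) (use D in blast)
  then obtain D' l' where D': "open D'" "poly P x \<in> D'" "Sec D' l'" "C x y = l' x - l' y" by (elim exE conjE)
  have "l' x - l' y = l x - l y"
    by (rule ED[OF E, of "D \<inter> D'"]) (use D D' Sec_subset[OF D(3), of "D \<inter> D'"] Sec_subset[OF D'(3), of "D \<inter> D'"] in auto)
  then show ?thesis using D' by simp
qed

text \<open>The class functions \<open>N\<close> at \<open>a\<close> and at \<open>b\<close> are pure powers, because the function below is a
  single-valued logarithm of their quotient.\<close>
definition S :: "complex \<Rightarrow> complex" where "S x = (\<Sum>y\<in>cls x. C x y)"

lemma X_nz: "x \<in> X \<Longrightarrow> x \<noteq> a \<and> x \<noteq> b \<and> a - x \<noteq> 0 \<and> b - x \<noteq> 0"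
  unfolding X_def using aB bB by auto

lemma cls_X: "x \<in> X \<Longrightarrow> y \<in> cls x \<Longrightarrow> y \<in> X \<and> E x y"
  unfolding X_def cls_def using E_fibre by auto

lemma S_holomorphic:
  assumes ex: "z0 \<notin> B" "open D0" "z0 \<in> D0" "Sec D0 l0"
  shows "S holomorphic_on X"
proof (rule holomorphic_on_locally)
  fix x0 assume "x0 \<in> X"
  from local_cls[OF this] obtain D Bs \<beta>0 J where D: "branches P D Bs" "D \<inter> B = {}" "\<beta>0 \<in> Bs" "x0 \<in> \<beta>0 ` D" "J \<subseteq> Bs"
    "\<And>x. x \<in> \<beta>0 ` D \<Longrightarrow> cls x = (\<lambda>\<beta>. \<beta> (poly P x)) ` J"
    "\<And>x. x \<in> \<beta>0 ` D \<Longrightarrow> inj_on (\<lambda>\<beta>. \<beta> (poly P x)) J" by blast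
  have zB: "poly P x0 \<notin> B" using \<open>x0 \<in> X\<close> unfolding X_def by simp
  obtain D1 l where D1: "open D1" "poly P x0 \<in> D1" "Sec D1 l" using sec_everywhere[OF ex zB] by (elim exE conjE)
  define V where "V = D \<inter> D1"
  have V: "open V" "V \<subseteq> D" "V \<subseteq> D1" unfolding V_def using branchesD(1)[OF D(1)] D1 by auto
  note bv = branchesD(5)[OF D(1)]
  have PT: "poly P x \<in> V \<and> x \<in> \<beta>0 ` D" if "x \<in> \<beta>0 ` V" for x
    using that bv[OF D(3)] V(2) by auto
  have 1: "l holomorphic_on \<beta>0 ` V"
    using SecD(1)[OF D1(3)] by (rule holomorphic_on_subset) (use PT V(3) in auto)
  have 2: "(\<lambda>x. l (\<beta> (poly P x))) holomorphic_on \<beta>0 ` V" if "\<beta> \<in> J" for \<beta>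
  proof -
    have "(\<lambda>w. l (\<beta> w)) holomorphic_on V"
      using sec_branch_continuous[OF D1(3) D(1) _ V(3,2)] D(5) that by blast
    then have "(\<lambda>w. l (\<beta> w)) holomorphic_on poly P ` (\<beta>0 ` V)" by (rule holomorphic_on_subset) (use PT in auto)
    then have "(\<lambda>w. l (\<beta> w)) \<circ> poly P holomorphic_on \<beta>0 ` V"
      by (intro holomorphic_on_compose) (auto intro: holomorphic_intros)
    then show ?thesis by (simp add: o_def)
  qed
  have "(\<lambda>x. \<Sum>\<beta>\<in>J. l x - l (\<beta> (poly P x))) holomorphic_on \<beta>0 ` V"
    using 1 2 by (intro holomorphic_on_sum holomorphic_on_diff)
  then have "S holomorphic_on \<beta>0 ` V"
  proof (rule holomorphic_transform)
    fix x assume x: "x \<in> \<beta>0 ` V"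
    note px = PT[OF x]
    have "x \<in> X" using px V D(2) unfolding X_def by auto
    have "S x = (\<Sum>y\<in>cls x. l x - l y)" unfolding S_def
      by (intro sum.cong refl C_eq[OF _ D1(1) _ D1(3)]) (use px V cls_X[OF \<open>x \<in> X\<close>] in auto)
    also have "\<dots> = (\<Sum>\<beta>\<in>J. l x - l (\<beta> (poly P x)))"
      using D(6,7) px by (simp add: sum.reindex)
    finally show "(\<Sum>\<beta>\<in>J. l x - l (\<beta> (poly P x))) = S x" by simp
  qed
  moreover have "open (\<beta>0 ` V)" by (rule branch_image_open[OF D(1,3) V(1,2)])
  moreover have "x0 \<in> \<beta>0 ` V"
  proof -
    obtain w where w: "w \<in> D" "x0 = \<beta>0 w" using D(4) by blast
    then have "w \<in> V" using D1(2) bv[OF D(3) w(1)] unfolding V_def by simp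
    then show ?thesis using w by blast
  qed
  ultimately show "\<exists>T. open T \<and> x0 \<in> T \<and> S holomorphic_on T" by blast
qed

lemma exp_S:
  assumes ex: "z0 \<notin> B" "open D0" "z0 \<in> D0" "Sec D0 l0" and x: "x \<in> X"
  shows "(b - x) ^ e * (\<Prod>y\<in>cls x. a - y) = (a - x) ^ e * (\<Prod>y\<in>cls x. b - y) * exp (S x)"
proof -
  have zB: "poly P x \<notin> B" using x unfolding X_def by simp
  obtain D l where D: "open D" "poly P x \<in> D" "Sec D l" using sec_everywhere[OF ex zB] by (elim exE conjE)
  have "(a - x) * (b - y) * exp (C x y) = (b - x) * (a - y)" if y: "y \<in> cls x" for y
  proof -
    have yX: "y \<in> X" "E x y" using cls_X[OF x y] by auto
    have Py: "poly P y \<in> D" using E_fibre[OF yX(2)] D(2) by simp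
    have "exp (C x y) = exp (l x) / exp (l y)" unfolding C_eq[OF yX(2) D] by (rule exp_diff)
    also have "\<dots> = ((b - x) / (a - x)) / ((b - y) / (a - y))"
      using SecD(2)[OF D(3)] D(2) Py by simp
    finally show ?thesis using X_nz[OF x] X_nz[OF yX(1)] by (intro cross_multiply) auto
  qed
  then have "(\<Prod>y\<in>cls x. (a - x) * (b - y) * exp (C x y)) = (\<Prod>y\<in>cls x. (b - x) * (a - y))"
    by (rule prod.cong[OF refl])
  then have "(a - x) ^ e * (\<Prod>y\<in>cls x. b - y) * exp (S x) = (b - x) ^ e * (\<Prod>y\<in>cls x. a - y)"
    unfolding S_def by (simp add: prod.distrib card_cls[OF x] exp_sum[OF finite_cls])
  then show ?thesis by simp
qed

text \<open>By \<open>exp_S\<close> the polynomials \<open>?U\<close> and \<open>?V\<close> differ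
  by a factor with a single-valued logarithm, hence have equal orders everywhere. At
  \<open>a\<close> the polynomial \<open>?V\<close> has order at least \<open>e\<close> and
  \<open>b - x\<close> does not vanish, so \<open>Na\<close>, of degree at most \<open>e\<close>, is
  a multiple of \<open>(x - a) ^ e\<close>. The same holds at \<open>b\<close>, and both products
  are constant on classes.\<close>

lemma class_powers:
  assumes ab: "a \<noteq> b" and ex: "z0 \<notin> B" "open D0" "z0 \<in> D0" "Sec D0 l0" and xy: "E x y"
  shows "(x - a) ^ e = (y - a) ^ e" "(x - b) ^ e = (y - b) ^ e"
proof -
  obtain Na where Na: "degree Na \<le> e" "\<And>x. x \<in> X \<Longrightarrow> poly Na x = (\<Prod>y\<in>cls x. a - y)"
    using class_product_polynomial by blast
  obtain Nb where Nb: "degree Nb \<le> e" "\<And>x. x \<in> X \<Longrightarrow> poly Nb x = (\<Prod>y\<in>cls x. b - y)"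
    using class_product_polynomial by blast
  have nz: "(\<Prod>y\<in>cls x. c - y) \<noteq> 0" if "x \<in> X" "c \<in> {a, b}" for x c
    using cls_X[OF that(1)] X_nz that(2) finite_cls by auto
  obtain x1 where x1: "x1 \<in> X" using X_large by blast
  have N0: "Na \<noteq> 0" "Nb \<noteq> 0" using nz[OF x1, of a] nz[OF x1, of b] Na(2)[OF x1] Nb(2)[OF x1] by auto
  let ?U = "[:b,-1:] ^ e * Na" and ?V = "[:a,-1:] ^ e * Nb"
  have UV0: "?U \<noteq> 0" "?V \<noteq> 0" using N0 by auto
  have ord: "order x0 ?U = order x0 ?V" for x0
  proof -
    have "open (X \<union> {x0})"
    proof -
      have "X \<union> {x0} = - (- X - {x0})" by auto
      then show ?thesis using finite_compl_X by (metis finite_Diff finite_imp_closed open_Compl)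
    qed
    then obtain r where r: "r > 0" "ball x0 r \<subseteq> X \<union> {x0}" using openE[of "X \<union> {x0}" x0] by auto
    show ?thesis
    proof (rule order_eq_of_log[OF UV0 r(1)])
      show "S holomorphic_on ball x0 r - {x0}"
        using S_holomorphic[OF ex] by (rule holomorphic_on_subset) (use r in auto)
      fix x assume "x \<in> ball x0 r - {x0}"
      then have "x \<in> X" using r by auto
      then show "poly ?U x = poly ?V x * exp (S x)"
        using exp_S[OF ex \<open>x \<in> X\<close>] Na(2) Nb(2) by simp
    qed
  qed
  have lin: "order c ([:d,-1:] ^ e) = (if c = d then e else 0)" for c d :: complex
  proof -
    have eq: "[:d,-1:] = smult (-1) [:-d,1:]" by simp
    have "order c ([:d,-1:] ^ e) = order c ([:-d,1:] ^ e)"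
      unfolding eq smult_power by (rule order_smult) simp
    also have "\<dots> = (if c = d then e else 0)"
      using order_power_n_n[of d e] by (auto intro!: order_0I simp: poly_power)
    finally show ?thesis .
  qed
  have oa: "e \<le> order a Na" using ord[of a] ab UV0 by (simp add: order_mult lin)
  have ob: "e \<le> order b Nb" using ord[of b] ab UV0 by (simp add: order_mult lin)
  obtain k where k: "k \<noteq> 0" "Na = smult k ([:-a,1:] ^ e)" using full_order_power[OF N0(1) Na(1) oa] by blast
  obtain k' where k': "k' \<noteq> 0" "Nb = smult k' ([:-b,1:] ^ e)" using full_order_power[OF N0(2) Nb(1) ob] by blast
  have "x \<in> X" "y \<in> X" using E_fibre[OF xy] unfolding X_def by auto
  then have "poly Na x = poly Na y" "poly Nb x = poly Nb y" using Na(2) Nb(2) cls_eq[OF xy] by auto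
  then show "(x - a) ^ e = (y - a) ^ e" "(x - b) ^ e = (y - b) ^ e" using k k' by (auto simp: poly_power)
qed

text \<open>The ratios \<open>u\<close> and \<open>v\<close> of the distances to \<open>a\<close>
  and to \<open>b\<close> are \<open>e\<close>-th roots of unity, and \<open>(u - v) * x\<close> is
  bounded. For large \<open>x\<close> this forces \<open>u = v\<close>, and then
  \<open>a \<noteq> b\<close> forces \<open>u = 1\<close>.\<close>

lemma class_large_trivial:
  assumes ab: "a \<noteq> b" and ex: "z0 \<notin> B" "open D0" "z0 \<in> D0" "Sec D0 l0"
  shows "\<exists>K. \<forall>x y. E x y \<longrightarrow> norm x > K \<longrightarrow> x = y"
proof -
  have e0: "e > 0"
  proof -
    obtain x1 where x1: "x1 \<in> X" using X_large by blast
    then have "x1 \<in> cls x1" using E_refl unfolding cls_def X_def by simp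
    then show ?thesis using card_cls[OF x1] finite_cls[of x1] by (metis card_gt_0_iff empty_iff)
  qed
  define Z where "Z = {z::complex. z ^ e = 1}"
  have finZ: "finite Z" unfolding Z_def using finite_roots_unity[of e] e0 by simp
  \<comment> \<open>Distances between distinct roots of unity; 1 is inserted because there are none
    when \<open>e = 1\<close>.\<close>
  define \<Delta> where "\<Delta> = insert 1 ((\<lambda>(u,v). norm (u - v)) ` {(u,v). u \<in> Z \<and> v \<in> Z \<and> u \<noteq> v})"
  have "{(u,v). u \<in> Z \<and> v \<in> Z \<and> u \<noteq> v} \<subseteq> Z \<times> Z" by auto
  then have fin\<Delta>: "finite \<Delta>" unfolding \<Delta>_def using finite_subset[OF _ finite_cartesian_product[OF finZ finZ]] by auto
  define d where "d = Min \<Delta>"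
  have d0: "d > 0" unfolding d_def using fin\<Delta> by (subst Min_gr_iff) (auto simp: \<Delta>_def)
  have dle: "d \<le> norm (u - v)" if "u \<in> Z" "v \<in> Z" "u \<noteq> v" for u v
    unfolding d_def using fin\<Delta> that by (intro Min_le) (auto simp: \<Delta>_def)
  have "x = y" if xy: "E x y" and large: "norm x > (2 * norm a + 2 * norm b) / d" for x y
  proof -
    note pw = class_powers[OF ab ex xy]
    have X: "x \<in> X" using E_fibre[OF xy] unfolding X_def by auto
    define u where "u = (y - a) / (x - a)"
    define v where "v = (y - b) / (x - b)"
    have nz: "x - a \<noteq> 0" "x - b \<noteq> 0" using X_nz[OF X] by auto
    have "u ^ e = 1" unfolding u_def power_divide pw(1)[symmetric] using nz by simp
    moreover have "v ^ e = 1" unfolding v_def power_divide pw(2)[symmetric] using nz by simp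
    ultimately have uZ: "u \<in> Z" "v \<in> Z" unfolding Z_def by simp_all
    then have nu: "norm u = 1" "norm v = 1" unfolding Z_def
      using e0 power_eq_1_iff[of u e] power_eq_1_iff[of v e] by auto
    have y: "y = a + u * (x - a)" "y = b + v * (x - b)" unfolding u_def v_def using nz by auto
    have "u = v"
    proof (rule ccontr)
      assume "u \<noteq> v"
      have "(u - v) * x = b - a + u * a - v * b" using y by algebra
      then have "norm (u - v) * norm x = norm (b - a + u * a - v * b)" by (metis norm_mult)
      also have "\<dots> \<le> norm (b - a + u * a) + norm (v * b)" by (rule norm_triangle_ineq4)
      also have "\<dots> \<le> norm (b - a) + norm (u * a) + norm (v * b)" by (intro add_right_mono norm_triangle_ineq)
      also have "\<dots> \<le> norm b + norm a + norm (u * a) + norm (v * b)" by (intro add_right_mono norm_triangle_ineq4)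
      finally have "norm (u - v) * norm x \<le> 2 * norm a + 2 * norm b" by (simp add: norm_mult nu)
      moreover have "d * norm x \<le> norm (u - v) * norm x" by (intro mult_right_mono dle uZ \<open>u \<noteq> v\<close>) simp
      moreover have "2 * norm a + 2 * norm b < norm x * d" using large d0 by (simp only: pos_divide_less_eq)
      ultimately show False by (simp add: mult.commute)
    qed
    then have "a + u * (x - a) = b + u * (x - b)" using y by simp
    then have "(a - b) * (1 - u) = 0" by algebra
    then have "u = 1" using ab by simp
    then show "x = y" using y(1) by simp
  qed
  then show ?thesis by blast
qed

end

section \<open>The moment problem in prime power degree\<close>

lemma lagrange_partial_fractions:
  fixes P q :: "complex poly"
  assumes P: "degree P > 0" and q: "degree q < degree P"
    and simple: "\<And>x. poly P x = w \<Longrightarrow> poly (pderiv P) x \<noteq> 0" and t: "poly P t \<noteq> w"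
  shows "poly q t / (poly P t - w) = (\<Sum>x\<in>{x. poly P x = w}. poly q x / poly (pderiv P) x * (1 / (t - x)))"
proof -
  let ?Z = "{x. poly P x = w}"
  have fin: "finite ?Z" and card: "card ?Z = degree P"
    using card_fibre_le(1)[OF P] card_fibre_eq[OF P simple] by auto
  define R where "R x = (P - [:w:]) div [:-x,1:]" for x
  have R: "P - [:w:] = [:-x,1:] * R x" if "x \<in> ?Z" for x
  proof -
    have "[:-x,1:] dvd P - [:w:]" using that by (simp add: poly_eq_0_iff_dvd[symmetric])
    then show ?thesis unfolding R_def by (simp only: dvd_mult_div_cancel)
  qed
  have Rx: "poly (R x) x = poly (pderiv P) x" if "x \<in> ?Z" for x
  proof -
    have "pderiv (P - [:w:]) = pderiv ([:-x,1:] * R x)" using R[OF that] by simp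
    then have "pderiv P = [:-x,1:] * pderiv (R x) + R x" by (simp add: pderiv_diff pderiv_mult pderiv_pCons pderiv_smult)
    then have "poly (pderiv P) x = poly ([:-x,1:] * pderiv (R x) + R x) x" by simp
    then show ?thesis by simp
  qed
  have Rv: "poly P s - w = (s - x) * poly (R x) s" if "x \<in> ?Z" for x s
    using arg_cong[OF R[OF that], of "\<lambda>p. poly p s"] by (simp add: algebra_simps)
  have Ry: "poly (R x) y = 0" if "x \<in> ?Z" "y \<in> ?Z" "x \<noteq> y" for x y
    using Rv[OF that(1), of y] that by auto
  have dR: "degree (R x) < degree P" if "x \<in> ?Z" for x
  proof -
    have "P - [:w:] \<noteq> 0" using t by (metis poly_0 poly_diff poly_const_conv right_minus_eq)
    then have "R x \<noteq> 0" using R[OF that] by auto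
    then have "degree (P - [:w:]) = 1 + degree (R x)" using R[OF that] degree_mult_eq[of "[:-x,1:]" "R x"] by simp
    moreover have "degree (P - [:w:]) \<le> degree P" by (rule degree_diff_le) simp_all
    ultimately show ?thesis by linarith
  qed
  \<comment> \<open>The error of Lagrange interpolation of \<open>q\<close> on the fibre: its degree
    is below \<open>degree P\<close>, and it vanishes at \<open>degree P\<close> points.\<close>
  define T where "T = q - (\<Sum>x\<in>?Z. smult (poly q x / poly (pderiv P) x) (R x))"
  have dT: "degree T \<le> degree P - 1" unfolding T_def
  proof (rule degree_diff_le)
    show "degree q \<le> degree P - 1" using q by simp
    have "degree (smult c (R x)) \<le> degree P - 1" if "x \<in> ?Z" for x c
      using degree_smult_le[of c "R x"] dR[OF that] by linarith
    then show "degree (\<Sum>x\<in>?Z. smult (poly q x / poly (pderiv P) x) (R x)) \<le> degree P - 1"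
      by (intro degree_sum_le fin)
  qed
  have Ty: "poly T y = 0" if y: "y \<in> ?Z" for y
  proof -
    have "(\<Sum>x\<in>?Z. poly q x / poly (pderiv P) x * poly (R x) y) = (\<Sum>x\<in>?Z. if x = y then poly q y else 0)"
      by (intro sum.cong refl) (use Rx Ry y simple in auto)
    also have "\<dots> = poly q y" using fin y by simp
    finally show ?thesis unfolding T_def by (simp add: poly_sum)
  qed
  have "T = 0"
  proof (rule ccontr)
    assume ne: "T \<noteq> 0"
    have "card ?Z \<le> card {x. poly T x = 0}" using Ty by (intro card_mono poly_roots_finite[OF ne]) auto
    also have "\<dots> \<le> degree T" by (rule card_poly_roots_bound[OF ne])
    finally show False using card dT P by linarith
  qed
  then have "q = (\<Sum>x\<in>?Z. smult (poly q x / poly (pderiv P) x) (R x))" unfolding T_def by simp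
  from arg_cong[OF this, of "\<lambda>f. poly f t"]
  have "poly q t = (\<Sum>x\<in>?Z. poly q x / poly (pderiv P) x * poly (R x) t)"
    unfolding poly_sum poly_smult .
  then have "poly q t / (poly P t - w) = (\<Sum>x\<in>?Z. poly q x / poly (pderiv P) x * (poly (R x) t / (poly P t - w)))"
    by (simp add: sum_divide_distrib)
  also have "\<dots> = (\<Sum>x\<in>?Z. poly q x / poly (pderiv P) x * (1 / (t - x)))"
  proof (rule sum.cong[OF refl])
    fix x assume x: "x \<in> ?Z"
    have "t - x \<noteq> 0" using x t by auto
    moreover have "poly (R x) t \<noteq> 0" using Rv[OF x, of t] t by auto
    ultimately show "poly q x / poly (pderiv P) x * (poly (R x) t / (poly P t - w)) = poly q x / poly (pderiv P) x * (1 / (t - x))"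
      unfolding Rv[OF x, of t] by simp
  qed
  finally show ?thesis .
qed

text \<open>Division of \<open>q\<close> by \<open>P\<close>, together with
  \<open>P / (P - w) = 1 + w / (P - w)\<close>, lowers the degree of \<open>q\<close>. Each division
  adds the integral of the quotient and a factor \<open>w\<close> to the polynomial
  \<open>Ap\<close>, which serves all \<open>w\<close> at once.\<close>

lemma segment_integral_partial_fractions:
  fixes P q :: "complex poly"
  assumes P: "degree P > 0"
  shows "\<exists>Ap. \<forall>w. (\<forall>x. poly P x = w \<longrightarrow> poly (pderiv P) x \<noteq> 0) \<longrightarrow> (\<forall>t\<in>closed_segment a b. poly P t \<noteq> w) \<longrightarrow>
     ((\<lambda>t. poly q t / (poly P t - w)) has_contour_integral
       (poly Ap w + (\<Sum>x\<in>{x. poly P x = w}. poly q x / poly (pderiv P) x * contour_integral (linepath a b) (\<lambda>t. 1 / (t - x))))) (linepath a b)"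
proof (induction "degree q" arbitrary: q rule: less_induct)
  case less
  have small: "((\<lambda>t. poly r t / (poly P t - w)) has_contour_integral
       (\<Sum>x\<in>{x. poly P x = w}. poly r x / poly (pderiv P) x * contour_integral (linepath a b) (\<lambda>t. 1 / (t - x)))) (linepath a b)"
    if r: "degree r < degree P" and w: "\<forall>x. poly P x = w \<longrightarrow> poly (pderiv P) x \<noteq> 0" "\<forall>t\<in>closed_segment a b. poly P t \<noteq> w" for r w
  proof -
    have "((\<lambda>t. \<Sum>x\<in>{x. poly P x = w}. poly r x / poly (pderiv P) x * (1 / (t - x))) has_contour_integral
       (\<Sum>x\<in>{x. poly P x = w}. poly r x / poly (pderiv P) x * contour_integral (linepath a b) (\<lambda>t. 1 / (t - x)))) (linepath a b)"
    proof (intro has_contour_integral_sum has_contour_integral_lmul has_contour_integral_integral contour_integrable_continuous_linepath)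
      show "finite {x. poly P x = w}" by (rule card_fibre_le(1)[OF P])
      fix x assume "x \<in> {x. poly P x = w}"
      then show "continuous_on (closed_segment a b) (\<lambda>t. 1 / (t - x))"
        using w(2) by (intro continuous_intros) auto
    qed
    then show ?thesis
    proof (rule has_contour_integral_eq)
      fix t assume "t \<in> path_image (linepath a b)"
      then show "(\<Sum>x\<in>{x. poly P x = w}. poly r x / poly (pderiv P) x * (1 / (t - x))) = poly r t / (poly P t - w)"
        using lagrange_partial_fractions[OF P r, of w t] w by simp
    qed
  qed
  show ?case
  proof (cases "degree q < degree P")
    case True
    then show ?thesis using small by (intro exI[of _ 0]) simp
  next
    case False
    let ?r = "q mod P" and ?q1 = "q div P"
    have P0: "P \<noteq> 0" using P by auto
    have dr: "degree ?r < degree P" using degree_mod_less[OF P0, of q] P by auto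
    have "degree ?q1 < degree q"
    proof (cases "?q1 = 0")
      case True
      then show ?thesis using False P by simp
    next
      case nz: False
      have "degree (?q1 * P) = degree ?q1 + degree P" using nz P0 by (simp add: degree_mult_eq)
      moreover from this have "degree (?q1 * P + ?r) = degree (?q1 * P)" using dr by (intro degree_add_eq_left) simp
      ultimately show ?thesis using P by simp
    qed
    from less.hyps[OF this] obtain A1 where A1: "\<And>w. (\<forall>x. poly P x = w \<longrightarrow> poly (pderiv P) x \<noteq> 0) \<Longrightarrow> (\<forall>t\<in>closed_segment a b. poly P t \<noteq> w) \<Longrightarrow>
      ((\<lambda>t. poly ?q1 t / (poly P t - w)) has_contour_integral
       (poly A1 w + (\<Sum>x\<in>{x. poly P x = w}. poly ?q1 x / poly (pderiv P) x * contour_integral (linepath a b) (\<lambda>t. 1 / (t - x))))) (linepath a b)" by blast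
    have qv: "poly q t = poly ?r t + poly P t * poly ?q1 t" for t
      by (metis add.commute mult_div_mod_eq poly_add poly_mult)
    show ?thesis
    proof (intro exI[of _ "[:poly (pint a ?q1) b:] + [:0,1:] * A1"] allI impI)
      fix w assume w: "\<forall>x. poly P x = w \<longrightarrow> poly (pderiv P) x \<noteq> 0" "\<forall>t\<in>closed_segment a b. poly P t \<noteq> w"
      let ?I = "\<lambda>x. contour_integral (linepath a b) (\<lambda>t. 1 / (t - x))"
      let ?s = "\<lambda>f. \<Sum>x\<in>{x. poly P x = w}. poly f x / poly (pderiv P) x * ?I x"
      have "((\<lambda>t. poly ?r t / (poly P t - w) + (poly ?q1 t + w * (poly ?q1 t / (poly P t - w)))) has_contour_integral
        (?s ?r + (poly (pint a ?q1) b + w * (poly A1 w + ?s ?q1)))) (linepath a b)"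
        by (intro has_contour_integral_add has_contour_integral_lmul small[OF dr w] A1[OF w] contour_integral_pint)
      moreover have "?s ?r + (poly (pint a ?q1) b + w * (poly A1 w + ?s ?q1)) = poly ([:poly (pint a ?q1) b:] + [:0,1:] * A1) w + ?s q"
      proof -
        have "?s q = ?s ?r + w * ?s ?q1" unfolding sum_distrib_left sum.distrib[symmetric]
          by (intro sum.cong refl) (auto simp: qv add_divide_distrib algebra_simps)
        then show ?thesis by (simp add: algebra_simps)
      qed
      ultimately have "((\<lambda>t. poly ?r t / (poly P t - w) + (poly ?q1 t + w * (poly ?q1 t / (poly P t - w)))) has_contour_integral
        (poly ([:poly (pint a ?q1) b:] + [:0,1:] * A1) w + ?s q)) (linepath a b)" by (simp only:)
      then show "((\<lambda>t. poly q t / (poly P t - w)) has_contour_integral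
        (poly ([:poly (pint a ?q1) b:] + [:0,1:] * A1) w + ?s q)) (linepath a b)"
      proof (rule has_contour_integral_eq)
        fix t assume "t \<in> path_image (linepath a b)"
        then have "poly P t - w \<noteq> 0" using w(2) by simp
        then show "poly ?r t / (poly P t - w) + (poly ?q1 t + w * (poly ?q1 t / (poly P t - w))) = poly q t / (poly P t - w)"
          unfolding qv[of t] by (simp add: divide_simps) (simp add: algebra_simps)
      qed
    qed
  qed
qed

text \<open>Multiplying the integrand by \<open>P / w\<close> changes the integral only by a
  multiple of a moment, that is, not at all. After \<open>K\<close> multiplications the integrand is
  bounded by a multiple of \<open>(M / norm w) ^ K\<close>.\<close>

lemma cauchy_transform_zero:
  fixes P Q :: "complex poly"
  assumes mom: "moments_vanish a b P Q" and M: "\<And>t. t \<in> closed_segment a b \<Longrightarrow> norm (poly P t) \<le> M" and w: "norm w > M"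
  shows "contour_integral (linepath a b) (\<lambda>t. poly (pderiv Q) t / (poly P t - w)) = 0"
proof -
  let ?F = "\<lambda>t. poly (pderiv Q) t / (poly P t - w)"
  have M0: "M \<ge> 0" using M[of a] norm_ge_zero[of "poly P a"] by (metis ends_in_segment(1) order_trans)
  have w0: "w \<noteq> 0" using w M0 by auto
  have nz: "poly P t - w \<noteq> 0" if "t \<in> closed_segment a b" for t using M[OF that] w by auto
  have cont: "continuous_on (closed_segment a b) ?F" using nz by (intro continuous_intros) auto
  obtain Bd where Bd: "\<And>t. t \<in> closed_segment a b \<Longrightarrow> norm (?F t) \<le> Bd"
    using compact_imp_bounded[OF compact_continuous_image[OF cont compact_segment]] unfolding bounded_iff by blast
  have Bd0: "Bd \<ge> 0" using Bd[of a] norm_ge_zero[of "?F a"] by (metis ends_in_segment(1) order_trans)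
  have step: "contour_integral (linepath a b) (\<lambda>t. (poly P t / w) ^ K * ?F t) = contour_integral (linepath a b) ?F" for K
  proof (induction K)
    case (Suc K)
    have i1: "((\<lambda>t. (poly P t / w) ^ K * ?F t) has_contour_integral contour_integral (linepath a b) ?F) (linepath a b)"
    proof -
      have "(\<lambda>t. (poly P t / w) ^ K * ?F t) contour_integrable_on linepath a b"
        by (intro contour_integrable_continuous_linepath continuous_on_mult cont continuous_intros) (use w0 in auto)
      from has_contour_integral_integral[OF this] show ?thesis unfolding Suc.IH .
    qed
    have "((\<lambda>t. poly (P ^ K * pderiv Q) t) has_contour_integral 0) (linepath a b)"
      using contour_integral_pint[of "P ^ K * pderiv Q" a b] mom unfolding moments_vanish_def by (simp only:)
    then have i2: "((\<lambda>t. (1 / w ^ Suc K) * poly (P ^ K * pderiv Q) t) has_contour_integral (1 / w ^ Suc K) * 0) (linepath a b)"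
      by (rule has_contour_integral_lmul)
    have "((\<lambda>t. (poly P t / w) ^ K * ?F t + (1 / w ^ Suc K) * poly (P ^ K * pderiv Q) t) has_contour_integral
       contour_integral (linepath a b) ?F + (1 / w ^ Suc K) * 0) (linepath a b)"
      by (rule has_contour_integral_add[OF i1 i2])
    then have "((\<lambda>t. (poly P t / w) ^ Suc K * ?F t) has_contour_integral
       contour_integral (linepath a b) ?F + (1 / w ^ Suc K) * 0) (linepath a b)"
    proof (rule has_contour_integral_eq)
      fix t assume "t \<in> path_image (linepath a b)"
      then have n: "poly P t - w \<noteq> 0" using nz by simp
      have "(u / w) ^ K * (v / (u - w)) + 1 / w ^ Suc K * (u ^ K * v) = (u / w) ^ Suc K * (v / (u - w))"
        if "u - w \<noteq> 0" for u v :: complex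
        using that w0 by (simp add: power_divide divide_simps) (simp add: algebra_simps)
      from this[OF n] show "(poly P t / w) ^ K * ?F t + (1 / w ^ Suc K) * poly (P ^ K * pderiv Q) t = (poly P t / w) ^ Suc K * ?F t"
        by (simp add: poly_power)
    qed
    then show ?case by (simp add: contour_integral_unique)
  qed simp
  have bound: "norm (contour_integral (linepath a b) ?F) \<le> Bd * norm (b - a) * (M / norm w) ^ K" for K
  proof -
    have "norm (contour_integral (linepath a b) (\<lambda>t. (poly P t / w) ^ K * ?F t)) \<le> ((M / norm w) ^ K * Bd) * norm (b - a)"
    proof (rule contour_integral_bound_linepath)
      show "(\<lambda>t. (poly P t / w) ^ K * ?F t) contour_integrable_on linepath a b"
        by (intro contour_integrable_continuous_linepath continuous_on_mult cont continuous_intros) (use w0 in auto)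
      show "0 \<le> (M / norm w) ^ K * Bd" using M0 Bd0 by simp
      fix t assume t: "t \<in> closed_segment a b"
      show "norm ((poly P t / w) ^ K * ?F t) \<le> (M / norm w) ^ K * Bd"
        unfolding norm_mult norm_power norm_divide[of "poly P t" w]
        using M[OF t] M0 Bd[OF t] by (intro mult_mono power_mono divide_right_mono) auto
    qed
    then show ?thesis unfolding step by (simp add: mult_ac)
  qed
  have "(\<lambda>K. Bd * norm (b - a) * (M / norm w) ^ K) \<longlonglongrightarrow> Bd * norm (b - a) * 0"
    using M0 w by (intro tendsto_intros LIMSEQ_power_zero) (use w0 in \<open>simp add: divide_less_eq_1_pos\<close>)
  then have "norm (contour_integral (linepath a b) ?F) \<le> 0"
    using bound by (intro LIMSEQ_le_const[of _ 0 "norm (contour_integral (linepath a b) ?F)"]) auto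
  then show ?thesis by simp
qed

lemma segment_log:
  fixes x :: complex
  assumes "norm a < norm x" "norm b < norm x"
  shows "contour_integral (linepath a b) (\<lambda>t. 1 / (t - x)) = Ln (1 - b / x) - Ln (1 - a / x)"
proof -
  have x0: "x \<noteq> 0" using assms by auto
  have re: "1 - t / x \<notin> \<real>\<^sub>\<le>\<^sub>0" if "norm t < norm x" for t
  proof -
    have "Re (t / x) < 1" using complex_Re_le_cmod[of "t / x"] that x0 by (simp add: norm_divide) (meson divide_less_eq_1_pos le_less_trans zero_less_norm_iff)
    then have "Re (1 - t / x) > 0" by simp
    then show ?thesis unfolding complex_nonpos_Reals_iff by linarith
  qed
  have "((\<lambda>t. Ln (1 - t / x)) has_field_derivative 1 / (t - x)) (at t within ball 0 (norm x))" if "t \<in> ball 0 (norm x)" for t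
  proof -
    have t: "norm t < norm x" using that by simp
    have "((\<lambda>t. Ln (1 - t / x)) has_field_derivative inverse (1 - t / x) * (- (1 / x))) (at t within ball 0 (norm x))"
      using re[OF t] x0 by (auto intro!: derivative_eq_intros)
    moreover have "inverse (1 - t / x) * (- (1 / x)) = 1 / (t - x)"
    proof -
      have "t \<noteq> x" using t by auto
      then show ?thesis using x0 by (simp add: field_simps)
    qed
    ultimately show ?thesis by simp
  qed
  moreover have "path_image (linepath a b) \<subseteq> ball 0 (norm x)"
    using closed_segment_subset[of a "ball 0 (norm x)" b] assms by simp
  ultimately have "((\<lambda>t. 1 / (t - x)) has_contour_integral (Ln (1 - b / x) - Ln (1 - a / x))) (linepath a b)"
    using contour_integral_primitive[of "ball 0 (norm x)" "\<lambda>t. Ln (1 - t / x)" "\<lambda>t. 1 / (t - x)" "linepath a b"] by simp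
  then show ?thesis by (rule contour_integral_unique)
qed


text \<open>When \<open>w\<close> is large, every point of the fibre is farther out than the
  segment, so the integral of \<open>1 / (t - x)\<close> along the segment is an honest branch of
  the logarithm, expressed by principal values. The partial fraction formula is then the relation
  required by \<open>Sec\<close>.\<close>

lemma (in log_sections) section_at_infinity:
  assumes Ap: "\<forall>w. (\<forall>x. poly P x = w \<longrightarrow> poly (pderiv P) x \<noteq> 0) \<longrightarrow> (\<forall>t\<in>closed_segment a b. poly P t \<noteq> w) \<longrightarrow>
     ((\<lambda>t. poly q t / (poly P t - w)) has_contour_integral
       (poly Ap w + (\<Sum>x\<in>{x. poly P x = w}. poly q x / poly (pderiv P) x * contour_integral (linepath a b) (\<lambda>t. 1 / (t - x))))) (linepath a b)"
    and mom: "moments_vanish a b P Q" and q: "q = pderiv Q"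
  shows "\<exists>z0 D0 l0. z0 \<notin> B \<and> open D0 \<and> z0 \<in> D0 \<and> Sec D0 l0"
proof -
  let ?\<rho> = "norm a + norm b + 1"
  have "bounded (poly P ` cball 0 ?\<rho>)"
    by (intro compact_imp_bounded compact_continuous_image) (auto intro!: continuous_intros)
  then obtain M0 where M0: "\<forall>v\<in>poly P ` cball 0 ?\<rho>. norm v \<le> M0" unfolding bounded_iff by blast
  obtain M1 where M1: "\<And>z. z \<in> B \<Longrightarrow> norm z \<le> M1" using finite_imp_bounded[OF finB] unfolding bounded_iff by blast
  define D0 where "D0 = {w :: complex. norm w > max M0 M1}"
  define l0 where "l0 x = Ln (1 - b / x) - Ln (1 - a / x)" for x
  have op: "open D0" unfolding D0_def by (intro open_Collect_less continuous_intros)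
  have DB: "w \<notin> B" if "w \<in> D0" for w using M1[of w] that unfolding D0_def by auto
  have large: "norm x > ?\<rho>" if "poly P x \<in> D0" for x
  proof (rule ccontr)
    assume "\<not> norm x > ?\<rho>"
    then have "poly P x \<in> poly P ` cball 0 ?\<rho>" by simp
    then have "norm (poly P x) \<le> M0" using M0 by blast
    then show False using that unfolding D0_def by simp
  qed
  have small: "norm (poly P t) \<le> M0" if "t \<in> closed_segment a b" for t
  proof -
    have "closed_segment a b \<subseteq> cball 0 ?\<rho>" by (rule closed_segment_subset) (auto simp: add_increasing2)
    then show ?thesis using M0 that by blast
  qed
  have re: "1 - c / x \<notin> \<real>\<^sub>\<le>\<^sub>0 \<and> 1 - c / x \<noteq> 0" if "norm c < norm x" for c x :: complex
  proof -
    have "norm (c / x) < 1" using that by (simp add: norm_divide divide_less_eq_1)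
    then have "Re (c / x) < 1" using complex_Re_le_cmod[of "c / x"] by linarith
    then have pos: "Re (1 - c / x) > 0" by simp
    moreover have "1 - c / x \<noteq> 0"
    proof
      assume "1 - c / x = 0"
      then have "Re (1 - c / x) = 0" by (simp only: zero_complex.sel)
      then show False using pos by linarith
    qed
    moreover have "1 - c / x \<notin> \<real>\<^sub>\<le>\<^sub>0" unfolding complex_nonpos_Reals_iff using pos by linarith
    ultimately show ?thesis by blast
  qed
  have ab: "norm a < norm x" "norm b < norm x" "x \<noteq> 0" if "poly P x \<in> D0" for x
  proof -
    have "norm x > norm a + norm b + 1" using large[OF that] .
    then show "norm a < norm x" "norm b < norm x" using norm_ge_zero[of a] norm_ge_zero[of b] by linarith+
    then show "x \<noteq> 0" by auto
  qed
  have "Sec D0 l0" unfolding Sec_def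
  proof (intro conjI ballI)
    show "l0 holomorphic_on poly P -` D0" unfolding l0_def
      using ab re by (intro holomorphic_intros) auto
    fix x assume "x \<in> poly P -` D0"
    then have x: "poly P x \<in> D0" by simp
    have "exp (l0 x) = (1 - b / x) / (1 - a / x)" 
      unfolding l0_def exp_diff exp_Ln[OF conjunct2[OF re[OF ab(1)[OF x]]]] exp_Ln[OF conjunct2[OF re[OF ab(2)[OF x]]]] ..
    also have "\<dots> = ((x - b) / x) / ((x - a) / x)" using ab(3)[OF x] by (simp add: diff_divide_distrib)
    also have "\<dots> = (x - b) / (x - a)" using ab(3)[OF x] by simp
    also have "\<dots> = (b - x) / (a - x)" by (metis minus_diff_eq minus_divide_divide)
    finally show "exp (l0 x) = (b - x) / (a - x)" .
  next
    fix w assume w: "w \<in> D0"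
    have h1: "((\<lambda>t. poly q t / (poly P t - w)) has_contour_integral
       (poly Ap w + (\<Sum>x\<in>{x. poly P x = w}. poly q x / poly (pderiv P) x * contour_integral (linepath a b) (\<lambda>t. 1 / (t - x))))) (linepath a b)"
    proof (rule Ap[rule_format])
      fix x assume "poly P x = w" then show "poly (pderiv P) x \<noteq> 0" using crit[of x] DB[OF w] by auto
    next
      fix t assume "t \<in> closed_segment a b" then show "poly P t \<noteq> w" using small[of t] w unfolding D0_def by auto
    qed
    have h2: "contour_integral (linepath a b) (\<lambda>t. poly q t / (poly P t - w)) = 0"
      unfolding q by (rule cauchy_transform_zero[OF mom, of M0]) (use small w in \<open>auto simp: D0_def\<close>)
    have "poly Ap w + (\<Sum>x\<in>{x. poly P x = w}. poly q x / poly (pderiv P) x * contour_integral (linepath a b) (\<lambda>t. 1 / (t - x))) = 0"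
      using contour_integral_unique[OF h1] h2 by (simp only:)
    moreover have "contour_integral (linepath a b) (\<lambda>t. 1 / (t - x)) = l0 x" if "poly P x = w" for x
      unfolding l0_def using segment_log ab that w by simp
    ultimately show "poly Ap w + (\<Sum>x\<in>{x. poly P x = w}. poly q x / poly (pderiv P) x * l0 x) = 0" by simp
  qed
  moreover have "of_real (\<bar>max M0 M1\<bar> + 1) \<in> D0" unfolding D0_def by (simp only: mem_Collect_eq norm_of_real)
  ultimately show ?thesis using op DB by blast
qed

text \<open>If some \<open>Q\<close> with vanishing moments is not invariant under
  \<open>p ^ k\<close> steps at infinity, then \<open>relation_periodic\<close> gives equal integers
  on sheets 0 and \<open>p ^ k\<close> for all pairs of sections. These sheets are then related by
  \<open>L.E\<close>, against \<open>class_large_trivial\<close>. Otherwise all such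
  \<open>Q\<close> are invariant and share a composition factor.\<close>

lemma moment_core:
  assumes p: "prime p" and degP: "degree P = p ^ k * p" and ab: "a \<noteq> b"
  shows "\<exists>W. degree W \<ge> 2 \<and> (\<forall>R\<in>insert P {Q. moments_vanish a b P Q}. \<exists>R'. R = pcompose R' W)"
proof -
  let ?n = "p ^ k * p" and ?m = "p ^ k" and ?QQ = "{Q. moments_vanish a b P Q}"
  have p1: "p > 1" using prime_gt_1_nat[OF p] .
  then have n0: "?n > 0" by simp
  then have deg0: "degree P > 0" using degP by simp
  define B where "B = poly P ` {x. poly (pderiv P) x = 0} \<union> {poly P a, poly P b}"
  have "pderiv P \<noteq> 0" using deg0 by (simp add: pderiv_eq_0_iff)
  then have finB: "finite B" unfolding B_def using poly_roots_finite by auto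
  have crit: "poly P x \<in> B" if "poly (pderiv P) x = 0" for x unfolding B_def using that by blast
  have aB: "poly P a \<in> B" "poly P b \<in> B" unfolding B_def by auto
  obtain \<omega> \<delta> \<epsilon> where chart: "infinity_chart P \<omega> \<delta> ?n \<epsilon>" using infinity_chart_exists[OF degP n0] by blast
  interpret infinity_chart P \<omega> \<delta> ?n \<epsilon> by (rule chart)
  have m: "0 < ?m" "?m < ?n" using p1 by auto
  show ?thesis
  proof (cases "\<forall>Q\<in>?QQ. \<forall>t\<in>A. poly Q (1 / \<omega> (\<epsilon> ^ ?m * t)) = poly Q (1 / \<omega> t)")
    case True
    show ?thesis by (rule common_composition[OF finB crit m]) (use True in auto)
  next
    case False
    then obtain Q t1 where Q: "moments_vanish a b P Q" and t1: "t1 \<in> A" "poly Q (1 / \<omega> (\<epsilon> ^ ?m * t1)) \<noteq> poly Q (1 / \<omega> t1)" by blast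
    obtain Ap where Ap: "\<forall>w. (\<forall>x. poly P x = w \<longrightarrow> poly (pderiv P) x \<noteq> 0) \<longrightarrow> (\<forall>t\<in>closed_segment a b. poly P t \<noteq> w) \<longrightarrow>
     ((\<lambda>t. poly (pderiv Q) t / (poly P t - w)) has_contour_integral
       (poly Ap w + (\<Sum>x\<in>{x. poly P x = w}. poly (pderiv Q) x / poly (pderiv P) x * contour_integral (linepath a b) (\<lambda>t. 1 / (t - x))))) (linepath a b)"
      using segment_integral_partial_fractions[OF deg0, where q = "pderiv Q" and a = a and b = b] by (elim exE)
    interpret L: log_sections P "pderiv Q" a b B Ap
      by unfold_locales (use deg0 finB crit aB in auto)
    obtain z0 D0 l0 where ex: "z0 \<notin> B" "open D0" "z0 \<in> D0" "L.Sec D0 l0"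
      using L.section_at_infinity[OF Ap Q refl] by (elim exE conjE)
    obtain K where K: "\<And>x y. L.E x y \<Longrightarrow> norm x > K \<Longrightarrow> x = y" using L.class_large_trivial[OF ab ex] by blast
    have "bounded (poly P ` cball 0 K)"
      by (intro compact_imp_bounded compact_continuous_image) (auto intro!: continuous_intros)
    then obtain M0 where M0: "\<forall>v\<in>poly P ` cball 0 K. norm v \<le> M0" unfolding bounded_iff by blast
    obtain M1 where M1: "\<And>z. z \<in> B \<Longrightarrow> norm z \<le> M1" using finite_imp_bounded[OF finB] unfolding bounded_iff by blast
    have "\<delta> / 2 \<in> A" unfolding A_def using \<delta> by auto
    then obtain r where r: "r > 0" "\<And>s. s \<in> A \<Longrightarrow> norm s < r \<Longrightarrow> max M0 M1 < norm (lead_coeff P / s ^ ?n)"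
      using large_value[of "\<delta> / 2" "max M0 M1"] by blast
    define t0 :: complex where "t0 = of_real (min (r / 2) (\<delta> / 2))"
    have t0: "t0 \<in> A" "norm t0 < r" unfolding A_def t0_def using r \<delta> by auto
    let ?z = "lead_coeff P / t0 ^ ?n"
    define X where "X i t = 1 / \<omega> (\<epsilon> ^ i * t)" for i t
    have zB: "?z \<notin> B" using r(2)[OF t0] M1[of ?z] by auto
    have PX: "poly P (X i t) = lead_coeff P / t ^ ?n" if "t \<in> A" for i t unfolding X_def using P_rot[OF that] .
    have big: "norm (X 0 t0) > K"
    proof (rule ccontr)
      assume "\<not> norm (X 0 t0) > K"
      then have "poly P (X 0 t0) \<in> poly P ` cball 0 K" by simp
      then have "cmod (poly P (X 0 t0)) \<le> M0" using M0 by blast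
      then show False using r(2)[OF t0] unfolding PX[OF t0(1)] by linarith
    qed
    have "l (X 0 t0) - l (X ?m t0) = l' (X 0 t0) - l' (X ?m t0)"
      if D: "open D" "?z \<in> D" "L.Sec D l" "L.Sec D l'" for D l l'
    proof -
      have "continuous_on A (\<lambda>t. lead_coeff P / t ^ ?n)" unfolding A_def by (intro continuous_intros) auto
      then have "open (A \<inter> (\<lambda>t. lead_coeff P / t ^ ?n) -` (D - B))"
        using D(1) finB by (intro continuous_open_preimage open_A open_Diff finite_imp_closed)
      moreover have "t0 \<in> A \<inter> (\<lambda>t. lead_coeff P / t ^ ?n) -` (D - B)" using t0 D(2) zB by simp
      ultimately obtain s where s: "s > 0" "ball t0 s \<subseteq> A \<inter> (\<lambda>t. lead_coeff P / t ^ ?n) -` (D - B)" using openE by blast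
      have sA: "ball t0 s \<subseteq> A" using s(2) by blast
      have sD: "poly P (X i t) \<in> D" "poly P (X i t) \<notin> B" if "t \<in> ball t0 s" for i t
      proof -
        have "t \<in> A" "lead_coeff P / t ^ ?n \<in> D - B" using s(2) that by blast+
        then show "poly P (X i t) \<in> D" "poly P (X i t) \<notin> B" using PX[of t i] by simp_all
      qed
      have one: "exp (l (X i t) - l' (X i t)) = 1" if "t \<in> ball t0 s" for i t
      proof -
        have "(b - X i t) / (a - X i t) \<noteq> 0" using sD(2)[OF that, of i] aB by auto
        then show ?thesis using L.SecD(2)[OF D(3) sD(1)[OF that]] L.SecD(2)[OF D(4) sD(1)[OF that]] by (simp add: exp_diff)
      qed
      have hol: "(\<lambda>t. g (X i t)) holomorphic_on ball t0 s" if "L.Sec D g" for g i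
      proof -
        have "g \<circ> X i holomorphic_on ball t0 s"
        proof (rule holomorphic_on_compose)
          show "X i holomorphic_on ball t0 s" unfolding X_def using inv_hol sA by (rule holomorphic_on_subset)
          show "g holomorphic_on X i ` ball t0 s" using L.SecD(1)[OF that] by (rule holomorphic_on_subset) (use sD in auto)
        qed
        then show ?thesis by (simp add: o_def)
      qed
      have t0s: "t0 \<in> ball t0 s" using s(1) by simp
      have const: "l (X i t) - l' (X i t) = l (X i t0) - l' (X i t0)" if "t \<in> ball t0 s" for i t
      proof (rule exp_one_constant[of "ball t0 s" "\<lambda>t. l (X i t) - l' (X i t)"])
        show "continuous_on (ball t0 s) (\<lambda>t. l (X i t) - l' (X i t))"
          by (intro holomorphic_on_imp_continuous_on holomorphic_on_diff hol D(3) D(4))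
      qed (use one that t0s in simp_all)
      have "\<exists>k :: int. l (X i t0) - l' (X i t0) = 2 * of_real pi * \<i> * of_int k" for i
      proof -
        obtain k :: int where "Re (l (X i t0) - l' (X i t0)) = 0" "Im (l (X i t0) - l' (X i t0)) = of_int (2 * k) * pi"
          using one[OF t0s, of i] unfolding exp_eq_1 by blast
        then show ?thesis by (intro exI[of _ k]) (simp add: complex_eq_iff)
      qed
      then obtain f :: "nat \<Rightarrow> int" where f: "\<And>i. l (X i t0) - l' (X i t0) = 2 * of_real pi * \<i> * of_int (f i)" by metis
      \<comment> \<open>Subtracting the relations of the two sections cancels \<open>Ap\<close> and
        leaves integer coefficients up to the factor 2 pi i.\<close>
      have "f 0 = f ?m"
      proof (rule relation_periodic[OF p refl t0(1) s(1) sA _ t1])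
        fix t assume t: "t \<in> ball t0 s"
        have tA: "t \<in> A" using t sA by blast
        let ?w = "lead_coeff P / t ^ ?n" and ?g = "\<lambda>x. poly (pderiv Q) x / poly (pderiv P) x"
        have wD: "?w \<in> D" using s(2) t by auto
        have "(\<Sum>x\<in>{x. poly P x = ?w}. ?g x * l x) - (\<Sum>x\<in>{x. poly P x = ?w}. ?g x * l' x) = 0"
        proof -
          note S1 = L.SecD(3)[OF D(3) wD] and S2 = L.SecD(3)[OF D(4) wD]
          show ?thesis using trans[OF S1 S2[symmetric]] by (simp only: add_left_cancel right_minus_eq)
        qed
        then have "(\<Sum>i<?n. ?g (X i t) * (l (X i t) - l' (X i t))) = 0"
          unfolding sum_roots[OF tA] X_def by (simp add: sum_subtractf right_diff_distrib)
        then have "(\<Sum>i<?n. 2 * of_real pi * \<i> * (of_int (f i) * ?g (X i t))) = 0"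
          unfolding const[OF t] f by (simp add: mult_ac)
        then have "2 * of_real pi * \<i> * (\<Sum>i<?n. of_int (f i) * ?g (X i t)) = 0" by (simp only: sum_distrib_left)
        then show "(\<Sum>i<?n. of_int (f i) * (poly (pderiv Q) (1 / \<omega> (\<epsilon> ^ i * t)) / poly (pderiv P) (1 / \<omega> (\<epsilon> ^ i * t)))) = 0"
          unfolding X_def by simp
      qed
      then have "l (X 0 t0) - l' (X 0 t0) = l (X ?m t0) - l' (X ?m t0)" using f[of 0] f[of ?m] by simp
      then show ?thesis by (simp add: algebra_simps)
    qed
    then have "L.E (X 0 t0) (X ?m t0)" unfolding L.E_def PX[OF t0(1)] using zB by blast
    then have "X 0 t0 = X ?m t0" using K big by blast
    then show ?thesis using inj_onD[OF roots_inj[OF t0(1)], of 0 ?m] m unfolding X_def by auto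
  qed
qed

text \<open>\<open>moment_core\<close> strips a factor \<open>W\<close> but says nothing about its
  values at the ends. The outer factor of \<open>P\<close> again has a power of \<open>p\<close> as
  degree, with ends \<open>poly W a\<close> and \<open>poly W b\<close>, so the induction continues
  until the ends coincide.\<close>

theorem moment_composition:
  assumes p: "prime p"
  shows "degree P = p ^ r \<Longrightarrow> poly P a = poly P b \<Longrightarrow>
    \<exists>V. poly V a = poly V b \<and> degree V > 0 \<and> (\<forall>R\<in>insert P {Q. moments_vanish a b P Q}. \<exists>R'. R = pcompose R' V)"
proof (induction "degree P" arbitrary: P r a b rule: less_induct)
  case less
  show ?case
  proof (cases "a = b")
    case True
    have "\<exists>R'. R = pcompose R' [:0,1:]" for R :: "complex poly" by (intro exI[of _ R]) (simp add: pcompose_idR)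
    then show ?thesis using True by (intro exI[of _ "[:0,1:]"]) auto
  next
    case ab: False
    have p1: "p > 1" using prime_gt_1_nat[OF p] .
    \<comment> \<open>A polynomial of degree 1 is injective and cannot take equal values at distinct
      ends.\<close>
    have "r \<noteq> 0"
    proof
      assume "r = 0"
      then have "degree P = 1" using less.prems by simp
      have "{a, b} \<subseteq> {x. poly P x = poly P a}" using less.prems(2) by simp
      then have "card {a, b} \<le> card {x. poly P x = poly P a}"
        using card_fibre_le(1)[of P] \<open>degree P = 1\<close> by (intro card_mono) simp_all
      also have "\<dots> \<le> 1" using card_fibre_le(2)[of P "poly P a"] \<open>degree P = 1\<close> by simp
      finally show False using ab by simp
    qed
    then obtain k where k: "r = Suc k" using not0_implies_Suc by blast
    obtain W where W: "degree W \<ge> 2" "\<forall>R\<in>insert P {Q. moments_vanish a b P Q}. \<exists>R'. R = pcompose R' W"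
      using moment_core[OF p _ ab, of P k] less.prems(1) k by (auto simp: mult.commute)
    then obtain A where A: "P = pcompose A W" by blast
    have "degree P = degree A * degree W" unfolding A by (rule degree_pcompose)
    then have "degree A dvd p ^ r" using less.prems(1) by (metis dvd_triv_left)
    then obtain j where j: "degree A = p ^ j" using divides_primepow_nat[OF p] by blast
    have "degree P > 0" using less.prems(1) p1 by simp
    then have lt: "degree A < degree P" using \<open>degree P = degree A * degree W\<close> W(1) by simp
    have "poly A (poly W a) = poly A (poly W b)" using less.prems(2) unfolding A by (simp add: poly_pcompose)
    from less.hyps[OF lt j this] obtain V where V: "poly V (poly W a) = poly V (poly W b)" "degree V > 0"
      "\<forall>R\<in>insert A {Q. moments_vanish (poly W a) (poly W b) A Q}. \<exists>R'. R = pcompose R' V" by blast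
    have "\<exists>R'. R = pcompose R' (pcompose V W)" if R: "R \<in> insert P {Q. moments_vanish a b P Q}" for R
    proof -
      obtain R1 where R1: "R = pcompose R1 W" "R1 = A \<or> moments_vanish (poly W a) (poly W b) A R1"
      proof (cases "R = P")
        case True
        then show ?thesis using that A by blast
      next
        case False
        then have mR: "moments_vanish a b P R" using R by simp
        obtain R1 where R1: "R = pcompose R1 W" using W(2) R by blast
        have "moments_vanish (poly W a) (poly W b) A R1" using mR unfolding A R1 moments_vanish_pcompose .
        then show ?thesis using that R1 by blast
      qed
      then obtain R2 where "R1 = pcompose R2 V" using V(3) by blast
      then show ?thesis using R1 by (intro exI[of _ R2]) (simp add: pcompose_assoc)
    qed
    moreover have "poly (pcompose V W) a = poly (pcompose V W) b" using V(1) by (simp add: poly_pcompose)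
    moreover have "degree (pcompose V W) > 0" using V(2) W(1) by (simp add: degree_pcompose)
    ultimately show ?thesis by (intro exI[of _ "pcompose V W"]) blast
  qed
qed

section \<open>Constructible sets\<close>

text \<open>Polynomial functions of the first \<open>n\<close> coordinates, represented by their
  values on infinite sequences; this avoids a syntax of multivariate polynomials and makes
  substitution a composition of functions.\<close>

inductive polyfun :: "nat \<Rightarrow> ((nat \<Rightarrow> complex) \<Rightarrow> complex) \<Rightarrow> bool" for n where
  const: "polyfun n (\<lambda>e. c)"
| var: "i < n \<Longrightarrow> polyfun n (\<lambda>e. e i)"
| add: "polyfun n f \<Longrightarrow> polyfun n g \<Longrightarrow> polyfun n (\<lambda>e. f e + g e)"
| mult: "polyfun n f \<Longrightarrow> polyfun n g \<Longrightarrow> polyfun n (\<lambda>e. f e * g e)"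

lemma polyfun_uminus: "polyfun n f \<Longrightarrow> polyfun n (\<lambda>e. - f e)"
  using polyfun.mult[OF polyfun.const[of n "-1"]] by simp

lemma polyfun_diff: "polyfun n f \<Longrightarrow> polyfun n g \<Longrightarrow> polyfun n (\<lambda>e. f e - g e)"
  using polyfun.add[OF _ polyfun_uminus, of n f g] by simp

lemma polyfun_power: "polyfun n f \<Longrightarrow> polyfun n (\<lambda>e. f e ^ k)"
  by (induction k) (auto intro: polyfun.intros)

lemma polyfun_sum: "(\<And>i. i \<in> I \<Longrightarrow> polyfun n (f i)) \<Longrightarrow> polyfun n (\<lambda>e. \<Sum>i\<in>I. f i e)"
  by (induction I rule: infinite_finite_induct) (auto intro: polyfun.intros)

lemma polyfun_subst:
  "polyfun n f \<Longrightarrow> (\<And>i. i < n \<Longrightarrow> polyfun m (\<lambda>e. s e i)) \<Longrightarrow> polyfun m (\<lambda>e. f (s e))"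
  by (induction rule: polyfun.induct) (auto intro: polyfun.intros)

lemma polyfun_cong: "polyfun n f \<Longrightarrow> (\<And>i. i < n \<Longrightarrow> e i = e' i) \<Longrightarrow> f e = f e'"
  by (induction rule: polyfun.induct) auto

text \<open>Polynomials in one more variable over the parameters \<open>e\<close>. The bound on the
  degree is uniform, so sums over coefficients have a range independent of \<open>e\<close>.\<close>

definition ppoly :: "nat \<Rightarrow> ((nat \<Rightarrow> complex) \<Rightarrow> complex poly) \<Rightarrow> bool" where
  "ppoly n F \<longleftrightarrow> (\<exists>d. \<forall>e. degree (F e) \<le> d) \<and> (\<forall>i. polyfun n (\<lambda>e. coeff (F e) i))"

lemma ppolyI: "(\<And>e. degree (F e) \<le> d) \<Longrightarrow> (\<And>i. polyfun n (\<lambda>e. coeff (F e) i)) \<Longrightarrow> ppoly n F"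
  unfolding ppoly_def by blast

lemma ppoly_coeff: "ppoly n F \<Longrightarrow> polyfun n (\<lambda>e. coeff (F e) i)"
  unfolding ppoly_def by blast

lemma ppoly_const [intro]: "ppoly n (\<lambda>e. p)"
  by (rule ppolyI[of _ "degree p"]) (auto intro: polyfun.intros)

lemma ppoly_add [intro]:
  assumes "ppoly n F" "ppoly n G" shows "ppoly n (\<lambda>e. F e + G e)"
proof -
  obtain d d' where "\<And>e. degree (F e) \<le> d" "\<And>e. degree (G e) \<le> d'"
    using assms unfolding ppoly_def by blast
  then have "degree (F e + G e) \<le> max d d'" for e
    by (meson degree_add_le max.coboundedI1 max.coboundedI2)
  then show ?thesis using assms by (intro ppolyI) (auto intro: polyfun.intros ppoly_coeff)
qed

lemma ppoly_mult [intro]: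
  assumes "ppoly n F" "ppoly n G" shows "ppoly n (\<lambda>e. F e * G e)"
proof -
  obtain d d' where "\<And>e. degree (F e) \<le> d" "\<And>e. degree (G e) \<le> d'"
    using assms unfolding ppoly_def by blast
  then have "degree (F e * G e) \<le> d + d'" for e
    by (meson add_mono degree_mult_le order_trans)
  then show ?thesis using assms
    by (intro ppolyI) (auto simp: coeff_mult intro!: polyfun_sum polyfun.mult ppoly_coeff)
qed

lemma ppoly_monom [intro]: "polyfun n c \<Longrightarrow> ppoly n (\<lambda>e. monom (c e) i)"
proof (rule ppolyI[of _ i])
  assume "polyfun n c"
  then show "polyfun n (\<lambda>e. coeff (monom (c e) i) j)" for j
    by (cases "i = j") (auto intro: polyfun.intros)
qed (auto simp: degree_monom_le)

lemma ppoly_smult [intro]: "polyfun n c \<Longrightarrow> ppoly n F \<Longrightarrow> ppoly n (\<lambda>e. smult (c e) (F e))"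
  using ppoly_mult[OF ppoly_monom[of n c 0], of F] by (simp add: monom_0)

lemma ppoly_uminus [intro]: "ppoly n F \<Longrightarrow> ppoly n (\<lambda>e. - F e)"
  using ppoly_smult[OF polyfun.const[of n "-1"]] by simp

lemma ppoly_diff [intro]: "ppoly n F \<Longrightarrow> ppoly n G \<Longrightarrow> ppoly n (\<lambda>e. F e - G e)"
  using ppoly_add[OF _ ppoly_uminus, of n F G] by simp

lemma ppoly_sum [intro]: "(\<And>i. i \<in> I \<Longrightarrow> ppoly n (F i)) \<Longrightarrow> ppoly n (\<lambda>e. \<Sum>i\<in>I. F i e)"
  by (induction I rule: infinite_finite_induct) auto

lemma ppoly_power [intro]: "ppoly n F \<Longrightarrow> ppoly n (\<lambda>e. F e ^ k)"
  by (induction k) auto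

lemma polyfun_poly:
  assumes "ppoly n F" "polyfun n g" shows "polyfun n (\<lambda>e. poly (F e) (g e))"
proof -
  obtain d where d: "\<And>e. degree (F e) \<le> d" using assms unfolding ppoly_def by blast
  have "poly (F e) (g e) = (\<Sum>i\<le>d. coeff (F e) i * g e ^ i)" for e
    using d[of e] by (subst poly_as_sum_of_monoms'[OF d[of e], symmetric]) (simp add: poly_sum poly_monom)
  then show ?thesis using assms
    by (auto intro!: polyfun_sum polyfun.mult polyfun_power ppoly_coeff)
qed

lemma pcompose_monom: "pcompose (monom (c::complex) i) q = smult c (q ^ i)"
  by (induction i) (auto simp: monom_0 monom_Suc pcompose_pCons)

lemma ppoly_pcompose:
  assumes "ppoly n F" "ppoly n G" shows "ppoly n (\<lambda>e. pcompose (F e) (G e))"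
proof -
  obtain d where d: "\<And>e. degree (F e) \<le> d" using assms unfolding ppoly_def by blast
  have "pcompose (F e) (G e) = (\<Sum>i\<le>d. smult (coeff (F e) i) (G e ^ i))" for e
    by (subst poly_as_sum_of_monoms'[OF d[of e], symmetric])
      (simp add: pcompose_sum pcompose_monom)
  then show ?thesis using assms
    by (auto intro!: ppoly_sum ppoly_smult ppoly_power ppoly_coeff)
qed

lemma ppoly_pderiv [intro]:
  assumes "ppoly n F" shows "ppoly n (\<lambda>e. pderiv (F e))"
proof -
  obtain d where d: "\<And>e. degree (F e) \<le> d" using assms unfolding ppoly_def by blast
  have "degree (pderiv (F e)) \<le> d" for e
    using d[of e] by (simp add: degree_pderiv)
  then show ?thesis using assms
    by (intro ppolyI) (auto simp: coeff_pderiv intro!: polyfun.mult polyfun.const ppoly_coeff)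
qed

lemma polyfun_Suc_ppoly:
  assumes "polyfun (Suc n) f"
  shows "\<exists>F. ppoly n F \<and> (\<forall>e. f e = poly (F e) (e n))"
  using assms
proof (induction rule: polyfun.induct)
  case (const c)
  show ?case by (rule exI[of _ "\<lambda>e. [:c:]"]) auto
next
  case (var i)
  show ?case
  proof (cases "i = n")
    case True
    then show ?thesis by (intro exI[of _ "\<lambda>e. [:0,1:]"]) auto
  next
    case False
    with var have "i < n" by simp
    then show ?thesis by (intro exI[of _ "\<lambda>e. monom (e i) 0"]) (auto simp: poly_monom intro: polyfun.intros)
  qed
next
  case (add f g)
  then obtain F G where "ppoly n F" "\<forall>e. f e = poly (F e) (e n)" "ppoly n G" "\<forall>e. g e = poly (G e) (e n)"
    by blast
  then show ?case by (intro exI[of _ "\<lambda>e. F e + G e"]) auto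
next
  case (mult f g)
  then obtain F G where "ppoly n F" "\<forall>e. f e = poly (F e) (e n)" "ppoly n G" "\<forall>e. g e = poly (G e) (e n)"
    by blast
  then show ?case by (intro exI[of _ "\<lambda>e. F e * G e"]) auto
qed

lemma ppoly_cong:
  assumes "ppoly n F" "\<And>i. i < n \<Longrightarrow> e i = e' i" shows "F e = F e'"
  by (rule poly_eqI) (rule polyfun_cong[OF ppoly_coeff[OF assms(1)] assms(2)])

text \<open>Constructible sets. Complements are obtained by \<open>constr_not\<close> from the two
  kinds of atoms, and closure under projection is proved by elimination.\<close>

inductive constr :: "nat \<Rightarrow> ((nat \<Rightarrow> complex) \<Rightarrow> bool) \<Rightarrow> bool" for n where
  eq0: "polyfun n f \<Longrightarrow> constr n (\<lambda>e. f e = 0)"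
| neq0: "polyfun n f \<Longrightarrow> constr n (\<lambda>e. f e \<noteq> 0)"
| conj: "constr n S \<Longrightarrow> constr n T \<Longrightarrow> constr n (\<lambda>e. S e \<and> T e)"
| disj: "constr n S \<Longrightarrow> constr n T \<Longrightarrow> constr n (\<lambda>e. S e \<or> T e)"

lemma constr_not: "constr n S \<Longrightarrow> constr n (\<lambda>e. \<not> S e)"
proof (induction rule: constr.induct)
  case (eq0 f)
  then show ?case by (rule constr.neq0)
next
  case (neq0 f)
  then show ?case using constr.eq0[of n f] by simp
next
  case (conj S T)
  then show ?case unfolding de_Morgan_conj by (intro constr.disj)
next
  case (disj S T)
  then show ?case unfolding de_Morgan_disj by (intro constr.conj)
qed

lemma constr_True: "constr n (\<lambda>e. True)"
  using constr.eq0[OF polyfun.const[of n 0]] by simp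

lemma constr_False: "constr n (\<lambda>e. False)"
  using constr.neq0[OF polyfun.const[of n 0]] by simp

lemma constr_ball: "finite I \<Longrightarrow> (\<And>i. i \<in> I \<Longrightarrow> constr n (S i)) \<Longrightarrow> constr n (\<lambda>e. \<forall>i\<in>I. S i e)"
  by (induction rule: finite_induct) (auto intro: constr.intros constr_True)

lemma constr_bex: "finite I \<Longrightarrow> (\<And>i. i \<in> I \<Longrightarrow> constr n (S i)) \<Longrightarrow> constr n (\<lambda>e. \<exists>i\<in>I. S i e)"
  by (induction rule: finite_induct) (auto intro: constr.intros constr_False)

lemma constr_subst:
  "constr n S \<Longrightarrow> (\<And>i. i < n \<Longrightarrow> polyfun m (\<lambda>e. s e i)) \<Longrightarrow> constr m (\<lambda>e. S (s e))"
proof (induction rule: constr.induct)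
  case (eq0 f)
  then show ?case using constr.eq0[OF polyfun_subst, of n f m s] by simp
next
  case (neq0 f)
  then show ?case using constr.neq0[OF polyfun_subst, of n f m s] by simp
qed (auto intro: constr.intros)

lemma constr_cong: "constr n S \<Longrightarrow> (\<And>i. i < n \<Longrightarrow> e i = e' i) \<Longrightarrow> S e = S e'"
proof (induction rule: constr.induct)
  case (eq0 f)
  then show ?case using polyfun_cong[of n f e e'] by simp
next
  case (neq0 f)
  then show ?case using polyfun_cong[of n f e e'] by simp
qed simp_all

lemma constr_ppoly_eq_0:
  assumes "ppoly n F" shows "constr n (\<lambda>e. F e = 0)"
proof -
  obtain d where d: "\<And>e. degree (F e) \<le> d" using assms unfolding ppoly_def by blast
  have "F e = 0 \<longleftrightarrow> (\<forall>i\<in>{..d}. coeff (F e) i = 0)" for e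
  proof
    assume *: "\<forall>i\<in>{..d}. coeff (F e) i = 0"
    then have "lead_coeff (F e) = 0" using d[of e] by simp
    then show "F e = 0" by simp
  qed simp
  moreover have "constr n (\<lambda>e. \<forall>i\<in>{..d}. coeff (F e) i = 0)"
    by (intro constr_ball constr.eq0 ppoly_coeff[OF assms]) simp
  ultimately show ?thesis by (simp only:)
qed

text \<open>A clause is a finite set of equations with a single inequation, since several
  inequations can be multiplied together.\<close>

lemma constr_dnf:
  assumes "constr n S"
  shows "\<exists>L. finite L \<and> (\<forall>C\<in>L. finite (fst C) \<and> (\<forall>f\<in>fst C. polyfun n f) \<and> polyfun n (snd C)) \<and>
     (\<forall>e. S e \<longleftrightarrow> (\<exists>C\<in>L. (\<forall>f\<in>fst C. f e = 0) \<and> snd C e \<noteq> 0))"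
  using assms
proof (induction rule: constr.induct)
  case (eq0 f)
  then show ?case by (intro exI[of _ "{({f}, \<lambda>e. 1)}"]) (auto intro: polyfun.intros)
next
  case (neq0 f)
  then show ?case by (intro exI[of _ "{({}, f)}"]) auto
next
  case (conj S T)
  from conj.IH obtain L M where L: "finite L" "\<forall>C\<in>L. finite (fst C) \<and> (\<forall>f\<in>fst C. polyfun n f) \<and> polyfun n (snd C)"
      "\<forall>e. S e \<longleftrightarrow> (\<exists>C\<in>L. (\<forall>f\<in>fst C. f e = 0) \<and> snd C e \<noteq> 0)"
    and M: "finite M" "\<forall>C\<in>M. finite (fst C) \<and> (\<forall>f\<in>fst C. polyfun n f) \<and> polyfun n (snd C)"
      "\<forall>e. T e \<longleftrightarrow> (\<exists>C\<in>M. (\<forall>f\<in>fst C. f e = 0) \<and> snd C e \<noteq> 0)" by blast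
  let ?h = "\<lambda>X. (fst (fst X) \<union> fst (snd X), \<lambda>e. snd (fst X) e * snd (snd X) e)"
  show ?case
  proof (intro exI[of _ "?h ` (L \<times> M)"] conjI)
    show "finite (?h ` (L \<times> M))" using L M by simp
    show "\<forall>C\<in>?h ` (L \<times> M). finite (fst C) \<and> (\<forall>f\<in>fst C. polyfun n f) \<and> polyfun n (snd C)"
      using L(2) M(2) by (auto intro!: polyfun.mult)
    show "\<forall>e. (S e \<and> T e) \<longleftrightarrow> (\<exists>C\<in>?h ` (L \<times> M). (\<forall>f\<in>fst C. f e = 0) \<and> snd C e \<noteq> 0)"
    proof (intro allI iffI)
      fix e assume "S e \<and> T e"
      then obtain A B where AB: "A \<in> L" "\<forall>f\<in>fst A. f e = 0" "snd A e \<noteq> 0" "B \<in> M" "\<forall>f\<in>fst B. f e = 0" "snd B e \<noteq> 0"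
        using L(3) M(3) by blast
      show "\<exists>C\<in>?h ` (L \<times> M). (\<forall>f\<in>fst C. f e = 0) \<and> snd C e \<noteq> 0"
        using AB by (intro bexI[of _ "?h (A, B)"] imageI) auto
    next
      fix e assume "\<exists>C\<in>?h ` (L \<times> M). (\<forall>f\<in>fst C. f e = 0) \<and> snd C e \<noteq> 0"
      then obtain X where X: "X \<in> L \<times> M" "\<forall>f\<in>fst (?h X). f e = 0" "snd (?h X) e \<noteq> 0" by blast
      then have "fst X \<in> L" "snd X \<in> M" by auto
      moreover have "\<forall>f\<in>fst (fst X). f e = 0" "\<forall>f\<in>fst (snd X). f e = 0" "snd (fst X) e \<noteq> 0" "snd (snd X) e \<noteq> 0"
        using X(2,3) by auto
      ultimately show "S e \<and> T e" unfolding L(3)[rule_format] M(3)[rule_format] by blast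
    qed
  qed
next
  case (disj S T)
  from disj.IH obtain L M where "finite L" "\<forall>C\<in>L. finite (fst C) \<and> (\<forall>f\<in>fst C. polyfun n f) \<and> polyfun n (snd C)"
      "\<forall>e. S e \<longleftrightarrow> (\<exists>C\<in>L. (\<forall>f\<in>fst C. f e = 0) \<and> snd C e \<noteq> 0)"
    and "finite M" "\<forall>C\<in>M. finite (fst C) \<and> (\<forall>f\<in>fst C. polyfun n f) \<and> polyfun n (snd C)"
      "\<forall>e. T e \<longleftrightarrow> (\<exists>C\<in>M. (\<forall>f\<in>fst C. f e = 0) \<and> snd C e \<noteq> 0)" by blast
  then show ?case by (intro exI[of _ "L \<union> M"]) (simp add: ball_Un bex_Un)
qed

section \<open>Elimination of quantifiers over the complex numbers\<close>

lemma pseudo_remainder: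
  assumes F: "ppoly n F" "\<And>e. degree (F e) \<le> d" and d: "d > 0" and H: "ppoly n H" "\<And>e. degree (H e) \<le> h"
  shows "\<exists>R. ppoly n R \<and> (\<forall>e. degree (R e) < d) \<and>
     (\<forall>e. coeff (F e) d \<noteq> 0 \<longrightarrow> (F e dvd H e \<longleftrightarrow> F e dvd R e))"
  using H
proof (induction h arbitrary: H rule: less_induct)
  case (less h)
  show ?case
  proof (cases "h < d")
    case True
    then show ?thesis using less.prems by (intro exI[of _ H]) (meson le_less_trans)
  next
    case False
    \<comment> \<open>A division step without division: the formal leading coefficient of
      \<open>F\<close> multiplies \<open>H\<close>, which does not affect divisibility by
      \<open>F\<close> where that coefficient is nonzero.\<close>
    define H' where "H' e = smult (coeff (F e) d) (H e) - monom (coeff (H e) h) (h - d) * F e" for e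
    have deg: "degree (H' e) \<le> h - 1" for e
    proof (rule degree_le, intro allI impI)
      fix i assume i: "h - 1 < i"
      have *: "coeff (monom (coeff (H e) h) (h - d) * F e) i = coeff (H e) h * coeff (F e) (i - (h - d))"
        using i by (simp add: coeff_monom_mult)
      show "coeff (H' e) i = 0"
      proof (cases "i = h")
        case True
        then show ?thesis using False unfolding H'_def coeff_diff * by simp
      next
        case F2: False
        with i have "i > h" by simp
        then have "coeff (H e) i = 0" "coeff (F e) (i - (h - d)) = 0"
          using less.prems(2)[of e] F(2)[of e] False by (auto intro!: coeff_eq_0)
        then show ?thesis unfolding H'_def coeff_diff * by simp
      qed
    qed
    have "ppoly n H'" unfolding H'_def using F less.prems
      by (intro ppoly_diff ppoly_smult ppoly_mult ppoly_monom ppoly_coeff)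
    moreover have "h - 1 < h" using False d by simp
    ultimately obtain R where R: "ppoly n R" "\<forall>e. degree (R e) < d"
      "\<forall>e. coeff (F e) d \<noteq> 0 \<longrightarrow> (F e dvd H' e \<longleftrightarrow> F e dvd R e)"
      using less.IH[of "h - 1" H'] deg by blast
    have "F e dvd H' e \<longleftrightarrow> F e dvd H e" if "coeff (F e) d \<noteq> 0" for e
      unfolding H'_def using that by (metis dvd_add_left_iff dvd_diff_left_iff dvd_smult_iff dvd_triv_right)
    then show ?thesis using R by blast
  qed
qed

text \<open>With the top coefficient nonzero, \<open>F\<close> has degree \<open>d\<close>; all its
  roots are roots of \<open>G\<close> exactly when \<open>F\<close> divides \<open>G ^ d\<close>. A
  parametric pseudo-remainder decides this divisibility.\<close>

lemma constr_project_single: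
  assumes F: "ppoly n F" "\<And>e. degree (F e) \<le> d" and d: "d > 0" and G: "ppoly n G"
  shows "constr n (\<lambda>e. coeff (F e) d \<noteq> 0 \<and> (\<exists>x. poly (F e) x = 0 \<and> poly (G e) x \<noteq> 0))"
proof -
  have "ppoly n (\<lambda>e. G e ^ d)" using G by auto
  then obtain h where "\<And>e. degree (G e ^ d) \<le> h" and H: "ppoly n (\<lambda>e. G e ^ d)" unfolding ppoly_def by blast
  from pseudo_remainder[OF F d H this(1)] obtain R where R: "ppoly n R" "\<And>e. degree (R e) < d"
    "\<And>e. coeff (F e) d \<noteq> 0 \<Longrightarrow> (F e dvd G e ^ d \<longleftrightarrow> F e dvd R e)" by blast
  have "(\<exists>x. poly (F e) x = 0 \<and> poly (G e) x \<noteq> 0) \<longleftrightarrow> R e \<noteq> 0" if c: "coeff (F e) d \<noteq> 0" for e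
  proof -
    have deg: "degree (F e) = d" using F(2)[of e] c le_degree by (metis order_antisym)
    have "F e \<noteq> 0" using c by auto
    have "(\<exists>x. poly (F e) x = 0 \<and> poly (G e) x \<noteq> 0) \<longleftrightarrow> \<not> F e dvd G e ^ d"
      using nullstellensatz_univariate[of "F e" "G e"] \<open>F e \<noteq> 0\<close> deg by auto
    also have "\<dots> \<longleftrightarrow> R e \<noteq> 0" using R(3)[OF c] R(2)[of e] deg dvd_imp_degree_le[of "F e" "R e"] by fastforce
    finally show ?thesis .
  qed
  then have "(\<lambda>e. coeff (F e) d \<noteq> 0 \<and> (\<exists>x. poly (F e) x = 0 \<and> poly (G e) x \<noteq> 0)) =
     (\<lambda>e. coeff (F e) d \<noteq> 0 \<and> \<not> R e = 0)" by (intro ext conj_cong refl) simp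
  then show ?thesis
    using constr.conj[OF constr.neq0[OF ppoly_coeff[OF F(1), of d]] constr_not[OF constr_ppoly_eq_0[OF R(1)]]]
    by simp
qed

text \<open>Euclid's algorithm with parameters. The equation with the least degree bound is
  selected. Where its formal leading coefficient vanishes, its bound drops; where it does not,
  another equation is reduced by it, and a single remaining equation is settled by
  \<open>constr_project_single\<close>.\<close>

lemma constr_project_list:
  assumes "\<forall>(F,d)\<in>set Fs. ppoly n F \<and> (\<forall>e. degree (F e) \<le> d)" and G: "ppoly n G"
  shows "constr n (\<lambda>e. \<exists>x. (\<forall>(F,d)\<in>set Fs. poly (F e) x = 0) \<and> poly (G e) x \<noteq> 0)"
  using assms(1)
proof (induction "sum_list (map (\<lambda>(F,d). Suc d) Fs)" arbitrary: Fs rule: less_induct)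
  case less
  note prems = less.prems
  \<comment> \<open>\<open>Suc d\<close> rather than \<open>d\<close>, because discarding an
    equation with bound 0 must lower the measure too.\<close>
  let ?ms = "\<lambda>Fs. sum_list (map (\<lambda>(F,d). Suc d) Fs)"
  show ?case
  proof (cases "Fs = []")
    case True
    have "(\<exists>x. poly (G e) x \<noteq> 0) \<longleftrightarrow> \<not> G e = 0" for e
      using poly_all_0_iff_0 by blast
    then show ?thesis using True constr_not[OF constr_ppoly_eq_0[OF G]] by simp
  next
    case False
    then obtain F d where Fd: "(F,d) \<in> set Fs" and min: "\<And>F' d'. (F',d') \<in> set Fs \<Longrightarrow> d \<le> d'"
      using arg_min_if_finite[of "set Fs" snd] that[of "fst (arg_min_on snd (set Fs))" "snd (arg_min_on snd (set Fs))"]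
      by (simp add: not_less) (metis not_less prod.sel(2))
    define rest where "rest = remove1 (F,d) Fs"
    have set_eq: "set ((F,d) # rest) = set Fs"
    proof (intro set_eqI iffI)
      fix x assume "x \<in> set ((F,d) # rest)"
      then show "x \<in> set Fs" using Fd set_remove1_subset[of "(F,d)" Fs] unfolding rest_def by auto
    next
      fix x assume "x \<in> set Fs"
      then show "x \<in> set ((F,d) # rest)" using in_set_remove1[of x "(F,d)" Fs] unfolding rest_def
        by (cases "x = (F,d)") simp_all
    qed
    have ms: "?ms Fs = Suc d + ?ms rest"
      unfolding rest_def using sum_list_map_remove1[OF Fd, of "\<lambda>(F,d). Suc d"] by simp
    have F: "ppoly n F" "\<And>e. degree (F e) \<le> d" using prems Fd by auto
    have rest: "\<forall>(F,d)\<in>set rest. ppoly n F \<and> (\<forall>e. degree (F e) \<le> d)"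
      using prems set_eq by auto
    have ex_eq: "(\<lambda>e. \<exists>x. (\<forall>(F,d)\<in>set Fs. poly (F e) x = 0) \<and> poly (G e) x \<noteq> 0) =
      (\<lambda>e. \<exists>x. poly (F e) x = 0 \<and> (\<forall>(F,d)\<in>set rest. poly (F e) x = 0) \<and> poly (G e) x \<noteq> 0)"
      unfolding set_eq[symmetric] by auto
    define c where "c e = coeff (F e) d" for e
    have c: "polyfun n c" unfolding c_def using F by (auto intro: ppoly_coeff)
    show ?thesis
    proof (cases "d = 0")
      case True
      have "poly (F e) x = c e" for e x
        using F(2)[of e] True unfolding c_def by (simp add: poly_altdef)
      then have "(\<lambda>e. \<exists>x. (\<forall>(F,d)\<in>set Fs. poly (F e) x = 0) \<and> poly (G e) x \<noteq> 0) =
        (\<lambda>e. c e = 0 \<and> (\<exists>x. (\<forall>(F,d)\<in>set rest. poly (F e) x = 0) \<and> poly (G e) x \<noteq> 0))"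
        unfolding ex_eq by simp
      then show ?thesis using constr.conj[OF constr.eq0[OF c] less.hyps[OF _ rest]] ms by simp
    next
      case d0: False
      define F' where "F' e = F e - monom (c e) d" for e
      have degF': "degree (F' e) \<le> d - 1" for e
      proof (rule degree_le, intro allI impI)
        fix i assume "d - 1 < i"
        then show "coeff (F' e) i = 0" unfolding F'_def c_def
          using F(2)[of e] d0 by (cases "i = d") (auto simp: coeff_eq_0)
      qed
      have F': "ppoly n F'" unfolding F'_def using F c by (intro ppoly_diff ppoly_monom)
      have "constr n (\<lambda>e. \<exists>x. (\<forall>(F,d)\<in>set ((F',d-1)#rest). poly (F e) x = 0) \<and> poly (G e) x \<noteq> 0)"
        by (rule less.hyps) (use ms d0 rest F' degF' in auto)
      with constr.eq0[OF c]
      have S1: "constr n (\<lambda>e. c e = 0 \<and> (\<exists>x. (\<forall>(F,d)\<in>set ((F',d-1)#rest). poly (F e) x = 0) \<and> poly (G e) x \<noteq> 0))"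
        by (rule constr.conj)
      have S2: "constr n (\<lambda>e. c e \<noteq> 0 \<and> (\<exists>x. (\<forall>(F,d)\<in>set Fs. poly (F e) x = 0) \<and> poly (G e) x \<noteq> 0))"
      proof (cases rest)
        case Nil
        then have "set Fs = {(F,d)}" using set_eq by simp
        then show ?thesis using constr_project_single[OF F _ G] d0 unfolding c_def by simp
      next
        case (Cons Kk rest')
        obtain K k where Kk: "Kk = (K,k)" by force
        have K: "ppoly n K" "\<And>e. degree (K e) \<le> k" using rest Cons Kk by auto
        have dk: "d \<le> k" using min[of K k] set_eq Cons Kk by auto
        \<comment> \<open>On the zeros of \<open>F\<close>, and for \<open>c e\<close> nonzero,
          \<open>K'\<close> vanishes exactly where \<open>K\<close> does.\<close>
        define K' where "K' e = smult (c e) (K e) - monom (coeff (K e) k) (k - d) * F e" for e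
        have degK': "degree (K' e) \<le> k - 1" for e
        proof (rule degree_le, intro allI impI)
          fix i assume i: "k - 1 < i"
          have *: "coeff (monom (coeff (K e) k) (k - d) * F e) i = coeff (K e) k * coeff (F e) (i - (k - d))"
            using i d0 dk by (simp add: coeff_monom_mult)
          show "coeff (K' e) i = 0"
          proof (cases "i = k")
            case True
            then show ?thesis using dk unfolding K'_def c_def coeff_diff * by simp
          next
            case F2: False
            with i have "i > k" by simp
            then have "coeff (K e) i = 0" "coeff (F e) (i - (k - d)) = 0"
              using K(2)[of e] F(2)[of e] dk by (auto intro!: coeff_eq_0)
            then show ?thesis unfolding K'_def coeff_diff * by simp
          qed
        qed
        have K': "ppoly n K'" unfolding K'_def using F K c
          by (intro ppoly_diff ppoly_smult ppoly_mult ppoly_monom ppoly_coeff)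
        have IH: "constr n (\<lambda>e. \<exists>x. (\<forall>(F,d)\<in>set ((F,d)#(K',k-1)#rest'). poly (F e) x = 0) \<and> poly (G e) x \<noteq> 0)"
          by (rule less.hyps) (use ms d0 dk rest F K' degK' Cons Kk in auto)
        have "(\<lambda>e. c e \<noteq> 0 \<and> (\<exists>x. (\<forall>(F,d)\<in>set Fs. poly (F e) x = 0) \<and> poly (G e) x \<noteq> 0)) =
          (\<lambda>e. c e \<noteq> 0 \<and> (\<exists>x. (\<forall>(F,d)\<in>set ((F,d)#(K',k-1)#rest'). poly (F e) x = 0) \<and> poly (G e) x \<noteq> 0))"
          unfolding set_eq[symmetric] Cons Kk by (rule ext) (auto simp: K'_def)
        then show ?thesis using constr.conj[OF constr.neq0[OF c] IH] by simp
      qed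
      have "(\<lambda>e. \<exists>x. (\<forall>(F,d)\<in>set Fs. poly (F e) x = 0) \<and> poly (G e) x \<noteq> 0) =
        (\<lambda>e. (c e = 0 \<and> (\<exists>x. (\<forall>(F,d)\<in>set ((F',d-1)#rest). poly (F e) x = 0) \<and> poly (G e) x \<noteq> 0)) \<or>
          (c e \<noteq> 0 \<and> (\<exists>x. (\<forall>(F,d)\<in>set Fs. poly (F e) x = 0) \<and> poly (G e) x \<noteq> 0)))"
        unfolding set_eq[symmetric] by (rule ext) (auto simp: F'_def)
      then show ?thesis using constr.disj[OF S1 S2] by simp
    qed
  qed
qed

lemma ex_bex_swap: "(\<exists>x. \<exists>y\<in>L. Q x y) \<longleftrightarrow> (\<exists>y\<in>L. \<exists>x. Q x y)"
  by blast

lemma constr_project: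
  assumes "constr (Suc n) S"
  shows "constr n (\<lambda>e. \<exists>x. S (e(n := x)))"
proof -
  obtain L where L: "finite L" "\<forall>C\<in>L. finite (fst C) \<and> (\<forall>f\<in>fst C. polyfun (Suc n) f) \<and> polyfun (Suc n) (snd C)"
     "\<forall>e. S e \<longleftrightarrow> (\<exists>C\<in>L. (\<forall>f\<in>fst C. f e = 0) \<and> snd C e \<noteq> 0)"
    using constr_dnf[OF assms] by blast
  have "constr n (\<lambda>e. \<exists>x. (\<forall>f\<in>fst Ag. f (e(n:=x)) = 0) \<and> snd Ag (e(n:=x)) \<noteq> 0)" if "Ag \<in> L" for Ag
  proof -
    obtain A g where Ag: "Ag = (A,g)" by force
    have A: "finite A" "\<forall>f\<in>A. polyfun (Suc n) f" "polyfun (Suc n) g" using L(2) that Ag by auto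
    have "\<forall>f. \<exists>F. polyfun (Suc n) f \<longrightarrow> ppoly n F \<and> (\<forall>e. f e = poly (F e) (e n))"
      using polyfun_Suc_ppoly by blast
    then obtain \<Phi> where \<Phi>: "\<And>f. polyfun (Suc n) f \<Longrightarrow> ppoly n (\<Phi> f) \<and> (\<forall>e. f e = poly (\<Phi> f e) (e n))"
      by metis
    have ev: "f (e(n:=x)) = poly (\<Phi> f e) x" if "polyfun (Suc n) f" for f e x
    proof -
      have "\<Phi> f (e(n:=x)) = \<Phi> f e" by (rule ppoly_cong[OF conjunct1[OF \<Phi>[OF that]]]) simp
      then show ?thesis using conjunct2[OF \<Phi>[OF that], rule_format, of "e(n:=x)"] by simp
    qed
    have "\<forall>F. \<exists>d. ppoly n F \<longrightarrow> (\<forall>e. degree (F e) \<le> d)" unfolding ppoly_def by blast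
    then obtain \<delta> where \<delta>: "\<And>F e. ppoly n F \<Longrightarrow> degree (F e) \<le> \<delta> F" by metis
    obtain fs where fs: "set fs = A" using A(1) finite_list by blast
    have "constr n (\<lambda>e. \<exists>x. (\<forall>(F,d)\<in>set (map (\<lambda>f. (\<Phi> f, \<delta> (\<Phi> f))) fs). poly (F e) x = 0) \<and> poly (\<Phi> g e) x \<noteq> 0)"
      by (rule constr_project_list) (use A \<Phi> \<delta> fs in auto)
    then show ?thesis using A fs by (simp add: Ag ev)
  qed
  then have "constr n (\<lambda>e. \<exists>Ag\<in>L. \<exists>x. (\<forall>f\<in>fst Ag. f (e(n:=x)) = 0) \<and> snd Ag (e(n:=x)) \<noteq> 0)"
    by (intro constr_bex[OF L(1)])
  moreover have "(\<lambda>e. \<exists>x. S (e(n := x))) = (\<lambda>e. \<exists>Ag\<in>L. \<exists>x. (\<forall>f\<in>fst Ag. f (e(n:=x)) = 0) \<and> snd Ag (e(n:=x)) \<noteq> 0)"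
    unfolding L(3)[rule_format] by (rule ext) (rule ex_bex_swap)
  ultimately show ?thesis by simp
qed

lemma constr_project_many:
  assumes "constr (m + k) S"
  shows "constr m (\<lambda>e. \<exists>e'. (\<forall>i<m. e' i = e i) \<and> S e')"
  using assms
proof (induction k arbitrary: S)
  case 0
  then have "constr m S" by simp
  moreover have "(\<lambda>e. \<exists>e'. (\<forall>i<m. e' i = e i) \<and> S e') = S"
  proof (intro ext iffI)
    fix e assume "\<exists>e'. (\<forall>i<m. e' i = e i) \<and> S e'"
    then obtain e' where "\<forall>i<m. e' i = e i" "S e'" by blast
    then show "S e" using constr_cong[OF \<open>constr m S\<close>, of e' e] by simp
  qed auto
  ultimately show ?case by (simp only:)
next
  case (Suc k)
  have "constr m (\<lambda>e. \<exists>e'. (\<forall>i<m. e' i = e i) \<and> (\<exists>x. S (e'(m + k := x))))"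
    by (rule Suc.IH, rule constr_project) (use Suc.prems in simp)
  moreover have "(\<lambda>e. \<exists>e'. (\<forall>i<m. e' i = e i) \<and> (\<exists>x. S (e'(m + k := x)))) =
    (\<lambda>e. \<exists>e'. (\<forall>i<m. e' i = e i) \<and> S e')"
  proof (rule ext, rule iffI)
    fix e assume "\<exists>e'. (\<forall>i<m. e' i = e i) \<and> (\<exists>x. S (e'(m + k := x)))"
    then obtain e' x where "\<forall>i<m. e' i = e i" "S (e'(m + k := x))" by blast
    then show "\<exists>e'. (\<forall>i<m. e' i = e i) \<and> S e'" by (intro exI[of _ "e'(m + k := x)"]) auto
  next
    fix e assume "\<exists>e'. (\<forall>i<m. e' i = e i) \<and> S e'"
    then obtain e' where "\<forall>i<m. e' i = e i" "S (e'(m + k := e' (m + k)))" by auto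
    then show "\<exists>e'. (\<forall>i<m. e' i = e i) \<and> (\<exists>x. S (e'(m + k := x)))"
      by (intro exI[of _ e'] conjI exI[of _ "e' (m + k)"])
  qed
  ultimately show ?case by (simp only:)
qed

lemma finite_or_cofinite_Int: "finite A \<or> finite A' \<Longrightarrow> finite B \<or> finite B' \<Longrightarrow> finite (A \<inter> B) \<or> finite (A' \<union> B')"
  by auto

text \<open>A polynomial equation in one variable holds at finitely many points or everywhere, and
  the alternative survives conjunction and disjunction.\<close>

lemma constr_one_finite_or_cofinite:
  assumes "constr (Suc 0) S"
  shows "finite {x. S (\<lambda>_. x)} \<or> finite {x. \<not> S (\<lambda>_. x)}"
  using assms
proof (induction rule: constr.induct)
  case (eq0 f)
  obtain F where F: "ppoly 0 F" "\<And>e. f e = poly (F e) (e 0)" using polyfun_Suc_ppoly[OF eq0(1)] by auto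
  have "f (\<lambda>_. x) = poly (F (\<lambda>_. 0)) x" for x
    using ppoly_cong[OF F(1), of "\<lambda>_. x" "\<lambda>_. 0"] F(2) by simp
  then show ?case by (cases "F (\<lambda>_. 0) = 0") (simp_all add: poly_roots_finite)
next
  case (neq0 f)
  obtain F where F: "ppoly 0 F" "\<And>e. f e = poly (F e) (e 0)" using polyfun_Suc_ppoly[OF neq0(1)] by auto
  have "f (\<lambda>_. x) = poly (F (\<lambda>_. 0)) x" for x
    using ppoly_cong[OF F(1), of "\<lambda>_. x" "\<lambda>_. 0"] F(2) by simp
  then show ?case by (cases "F (\<lambda>_. 0) = 0") (simp_all add: poly_roots_finite)
next
  case (conj S T)
  have "{x. S (\<lambda>_. x) \<and> T (\<lambda>_. x)} = {x. S (\<lambda>_. x)} \<inter> {x. T (\<lambda>_. x)}"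
    "{x. \<not> (S (\<lambda>_. x) \<and> T (\<lambda>_. x))} = {x. \<not> S (\<lambda>_. x)} \<union> {x. \<not> T (\<lambda>_. x)}"
    by (simp_all only: Collect_conj_eq Collect_disj_eq de_Morgan_conj)
  then show ?case using finite_or_cofinite_Int[OF conj.IH] by (simp only:)
next
  case (disj S T)
  have "{x. S (\<lambda>_. x) \<or> T (\<lambda>_. x)} = {x. S (\<lambda>_. x)} \<union> {x. T (\<lambda>_. x)}"
    "{x. \<not> (S (\<lambda>_. x) \<or> T (\<lambda>_. x))} = {x. \<not> S (\<lambda>_. x)} \<inter> {x. \<not> T (\<lambda>_. x)}"
    by (simp_all only: Collect_conj_eq Collect_disj_eq de_Morgan_disj)
  then show ?case using finite_or_cofinite_Int[OF disj.IH[THEN disj_commute[THEN iffD1]]] by (simp only: disj_commute)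
qed

text \<open>By elimination each coordinate projection is finite or cofinite, and a bounded one is finite.\<close>
lemma constr_infinite_unbounded:
  assumes S: "constr n S" and inf: "infinite {e. S e \<and> (\<forall>i\<ge>n. e i = 0)}"
  shows "\<exists>e. S e \<and> (\<forall>i\<ge>n. e i = 0) \<and> (\<exists>i<n. norm (e i) > R)"
proof (rule ccontr)
  assume contra: "\<not> ?thesis"
  have *: "norm (e i) \<le> R" if "S e" "\<forall>i\<ge>n. e i = 0" "i < n" for e i
  proof (rule ccontr)
    assume "\<not> norm (e i) \<le> R"
    then have "\<exists>e. S e \<and> (\<forall>i\<ge>n. e i = 0) \<and> (\<exists>i<n. norm (e i) > R)"
      using that by (intro exI[of _ e] conjI exI[of _ i]) simp_all
    with contra show False by (rule notE)
  qed
  have bd: "norm (e i) \<le> R" if "S e" "i < n" for e i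
  proof -
    have "S (\<lambda>j. if j < n then e j else 0)"
      using constr_cong[OF S, of e "\<lambda>j. if j < n then e j else 0"] that by simp
    from *[OF this _ that(2)] show ?thesis using that(2) by simp
  qed
  define T where "T i = {x. \<exists>e. S e \<and> e i = x}" for i
  have "finite (T i)" if i: "i < n" for i
  proof -
    \<comment> \<open>The value of coordinate \<open>i\<close> is copied to a new coordinate 0 in
      front, since \<open>constr_project_many\<close> eliminates the last coordinates.\<close>
    have \<Theta>: "constr (1 + n) (\<lambda>e. S (\<lambda>j. e (Suc j)) \<and> e (Suc i) - e 0 = 0)"
    proof (intro constr.conj constr.eq0 polyfun_diff polyfun.var)
      show "constr (1 + n) (\<lambda>e. S (\<lambda>j. e (Suc j)))"
        by (rule constr_subst[OF S]) (auto intro: polyfun.var)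
    qed (use i in auto)
    have "constr (Suc 0) (\<lambda>e. \<exists>e'. (\<forall>i<1. e' i = e i) \<and> S (\<lambda>j. e' (Suc j)) \<and> e' (Suc i) - e' 0 = 0)"
      using constr_project_many[of 1 n, OF \<Theta>] by (simp only: One_nat_def)
    from constr_one_finite_or_cofinite[OF this]
    have "finite {x. \<exists>e'. e' 0 = x \<and> S (\<lambda>j. e' (Suc j)) \<and> e' (Suc i) = e' 0} \<or>
       finite {x. \<not> (\<exists>e'. e' 0 = x \<and> S (\<lambda>j. e' (Suc j)) \<and> e' (Suc i) = e' 0)}" by simp
    moreover have "{x. \<exists>e'. e' 0 = x \<and> S (\<lambda>j. e' (Suc j)) \<and> e' (Suc i) = e' 0} = T i"
    proof (intro set_eqI iffI)
      fix x assume "x \<in> T i"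
      then obtain e where "S e" "e i = x" unfolding T_def by blast
      then show "x \<in> {x. \<exists>e'. e' 0 = x \<and> S (\<lambda>j. e' (Suc j)) \<and> e' (Suc i) = e' 0}"
        by (auto intro!: exI[of _ "case_nat x e"])
    qed (auto simp: T_def)
    moreover have "{x. \<not> (\<exists>e'. e' 0 = x \<and> S (\<lambda>j. e' (Suc j)) \<and> e' (Suc i) = e' 0)} = - T i"
      unfolding calculation(2)[symmetric] by (simp only: Collect_neg_eq)
    ultimately have "finite (T i) \<or> finite (- T i)" by (simp only:)
    moreover have "infinite (- T i)"
    proof
      assume "finite (- T i)"
      moreover have "T i \<subseteq> cball 0 R" using bd[OF _ i] by (auto simp: T_def)
      ultimately have "bounded (- T i \<union> T i)"
        using bounded_Un bounded_subset[OF bounded_cball] finite_imp_bounded by blast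
      then have "bounded (UNIV :: complex set)" by simp
      then show False using not_bounded_UNIV by blast
    qed
    ultimately show ?thesis by blast
  qed
  then have "finite (PiE {..<n} T)" by (intro finite_PiE) auto
  moreover have "inj_on (\<lambda>e. restrict e {..<n}) {e. S e \<and> (\<forall>i\<ge>n. e i = 0)}"
  proof (rule inj_onI, rule ext)
    fix e e' :: "nat \<Rightarrow> complex" and i
    assume *: "e \<in> {e. S e \<and> (\<forall>i\<ge>n. e i = 0)}" "e' \<in> {e. S e \<and> (\<forall>i\<ge>n. e i = 0)}"
      "restrict e {..<n} = restrict e' {..<n}"
    show "e i = e' i"
      using *(1,2) fun_cong[OF *(3), of i] by (cases "i < n") simp_all
  qed
  moreover have "(\<lambda>e. restrict e {..<n}) ` {e. S e \<and> (\<forall>i\<ge>n. e i = 0)} \<subseteq> PiE {..<n} T"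
    by (rule image_subsetI) (auto simp: restrict_PiE_iff T_def)
  ultimately show False using inf by (meson finite_imageD finite_subset)
qed

section \<open>The first integral of the Abel equation\<close>

text \<open>Coefficients of the first integral \<open>\<Sum>k. \<psi> k (x) y ^ k\<close> normalised by \<open>\<psi>(a, y) = y\<close>; unlike the
  Taylor coefficients of the solution itself they satisfy a linear recursion.\<close>
fun psi :: "complex \<Rightarrow> complex poly \<Rightarrow> complex poly \<Rightarrow> nat \<Rightarrow> complex poly" where
  "psi a p q 0 = 0"
| "psi a p q (Suc 0) = 1"
| "psi a p q (Suc (Suc k)) = - pint a (of_nat k * p * psi a p q k + of_nat (Suc k) * q * psi a p q (Suc k))"

lemma pderiv_psi:
  "pderiv (psi a p q (Suc (Suc k))) = - (of_nat k * p * psi a p q k + of_nat (Suc k) * q * psi a p q (Suc k))"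
  by (simp add: pderiv_minus)

lemma psi_start: "poly (psi a p q k) a = (if k = 1 then 1 else 0)"
  by (induction a p q k rule: psi.induct) simp_all

lemma psi_pcompose:
  "\<exists>F. psi a (pderiv (pcompose A W)) (pderiv (pcompose B W)) k = pcompose F W"
proof (induction a "pderiv (pcompose A W)" "pderiv (pcompose B W)" k rule: psi.induct)
  case (1 a)
  show ?case by (intro exI[of _ 0]) simp
next
  case (2 a)
  show ?case by (intro exI[of _ 1]) (simp add: pcompose_1)
next
  case (3 a k)
  obtain F where F: "psi a (pderiv (pcompose A W)) (pderiv (pcompose B W)) k = pcompose F W" using 3(1) by blast
  obtain G where G: "psi a (pderiv (pcompose A W)) (pderiv (pcompose B W)) (Suc k) = pcompose G W" using 3(2) by blast
  have nat: "of_nat j = pcompose (of_nat j) W" for j by (simp add: of_nat_poly pcompose_const)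
  have "of_nat k * pderiv (pcompose A W) * pcompose F W + of_nat (Suc k) * pderiv (pcompose B W) * pcompose G W
     = pcompose (of_nat k * pderiv A * F + of_nat (Suc k) * pderiv B * G) W * pderiv W"
    unfolding pcompose_add pcompose_mult pderiv_pcompose by (subst (1 2) nat) (simp only: algebra_simps)
  then show ?case unfolding psi.simps F G pint_pcompose by (metis pcompose_uminus pint_pcompose)
qed

lemma psi_end_composition:
  assumes "poly W a = poly W b" "k \<noteq> 1"
  shows "poly (psi a (pderiv (pcompose A W)) (pderiv (pcompose B W)) k) b = 0"
proof -
  obtain F where F: "psi a (pderiv (pcompose A W)) (pderiv (pcompose B W)) k = pcompose F W" using psi_pcompose by blast
  have "poly (pcompose F W) b = poly (pcompose F W) a" using assms(1) by (simp add: poly_pcompose)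
  then show ?thesis using psi_start[of a _ _ k] F assms(2) by metis
qed

text \<open>Majorant argument with \<open>u = 1 + 2 * K * norm (x - a)\<close>. By the recursion and
  the induction hypothesis the derivative of the next coefficient is at most
  \<open>2 * K * k * u ^ (k - 1)\<close> in norm, which is the radial derivative of
  \<open>u ^ k\<close>.\<close>

lemma psi_bound:
  assumes K: "\<And>x. x \<in> ball a R \<Longrightarrow> norm (poly p x) \<le> K \<and> norm (poly q x) \<le> K" and "K \<ge> 0"
  shows "x \<in> ball a R \<Longrightarrow> norm (poly (psi a p q (Suc k)) x) \<le> (1 + 2 * K * norm (x - a)) ^ k"
proof (induction k arbitrary: x rule: less_induct)
  case (less k)
  show ?case
  proof (cases k)
    case 0
    then show ?thesis by simp
  next
    case (Suc j)
    let ?h = "\<lambda>r::real. (1 + 2 * K * r) ^ k"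
    let ?g = "\<lambda>t::real. poly (psi a p q (Suc k)) (a + of_real t * (x - a))"
    let ?r = "norm (x - a)"
    have R: "?r < R" using less.prems by (simp add: dist_norm norm_minus_commute)
    have inb: "a + of_real t * (x - a) \<in> ball a R" if "t \<in> {0..1}" for t :: real
    proof -
      have "norm (of_real t * (x - a)) \<le> 1 * ?r" unfolding norm_mult using that by (intro mult_right_mono) auto
      then show ?thesis using R by (simp add: dist_norm)
    qed
    have "norm (?g 1 - ?g 0) \<le> ?h (1 * ?r) - ?h (0 * ?r)"
    proof (rule differentiable_bound_general[of 0 1 ?g "\<lambda>t. ?h (t * ?r)"
        "\<lambda>t. (x - a) * poly (pderiv (psi a p q (Suc k))) (a + of_real t * (x - a))"
        "\<lambda>t. 2 * K * ?r * (of_nat k * (1 + 2 * K * (t * ?r)) ^ (k - 1))"])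
      show "continuous_on {0..1} ?g" by (intro continuous_intros)
      show "continuous_on {0..1} (\<lambda>t. ?h (t * ?r))" by (intro continuous_intros)
      fix t :: real assume t: "0 < t" "t < 1"
      show "(?g has_vector_derivative (x - a) * poly (pderiv (psi a p q (Suc k))) (a + of_real t * (x - a))) (at t)"
      proof -
        have "((\<lambda>t::real. a + of_real t * (x - a)) has_vector_derivative (x - a)) (at t)"
          by (auto intro!: derivative_eq_intros)
        from field_vector_diff_chain_at[OF this poly_DERIV[of "psi a p q (Suc k)"]]
        show ?thesis by (simp add: o_def)
      qed
      have "((\<lambda>t. ?h (t * ?r)) has_real_derivative 2 * K * ?r * (of_nat k * (1 + 2 * K * (t * ?r)) ^ (k - 1))) (at t)"
        by (auto intro!: derivative_eq_intros)
      then show "((\<lambda>t. ?h (t * ?r)) has_vector_derivative 2 * K * ?r * (of_nat k * (1 + 2 * K * (t * ?r)) ^ (k - 1))) (at t)"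
        by (simp add: has_real_derivative_iff_has_vector_derivative)
      let ?z = "a + of_real t * (x - a)"
      have z: "?z \<in> ball a R" using inb t by simp
      have nz: "norm (?z - a) = t * ?r" using t by (simp add: norm_mult)
      let ?u = "1 + 2 * K * (t * ?r)"
      have u1: "?u \<ge> 1" using t \<open>K \<ge> 0\<close> by simp
      have "norm (poly (psi a p q (Suc j)) ?z) \<le> ?u ^ j" using less.IH[of j ?z] Suc z nz by simp
      moreover have "norm (poly (psi a p q j) ?z) \<le> ?u ^ j"
      proof (cases j)
        case (Suc i)
        then have "norm (poly (psi a p q j) ?z) \<le> ?u ^ i" using less.IH[of i ?z] \<open>k = Suc j\<close> z nz by simp
        also have "\<dots> \<le> ?u ^ j" using Suc u1 by (intro power_increasing) auto
        finally show ?thesis .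
      qed simp
      ultimately have "norm (poly (pderiv (psi a p q (Suc k))) ?z) \<le> of_nat j * K * ?u ^ j + of_nat (Suc j) * K * ?u ^ j"
        unfolding Suc pderiv_psi poly_minus poly_add poly_mult norm_minus_cancel
        using K[OF z] \<open>K \<ge> 0\<close> u1
        by (intro norm_triangle_le add_mono) (auto simp: norm_mult simp del: of_nat_Suc intro!: mult_mono)
      also have "\<dots> \<le> 2 * K * (of_nat k * ?u ^ (k - 1))"
        unfolding Suc using \<open>K \<ge> 0\<close> u1 by (simp add: algebra_simps)
      finally have "?r * norm (poly (pderiv (psi a p q (Suc k))) ?z) \<le> ?r * (2 * K * (of_nat k * ?u ^ (k - 1)))"
        by (rule mult_left_mono) simp
      then show "norm ((x - a) * poly (pderiv (psi a p q (Suc k))) ?z) \<le> 2 * K * ?r * (of_nat k * ?u ^ (k - 1))"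
        by (simp add: norm_mult mult_ac)
    qed simp
    moreover have "?g 0 = 0" using psi_start[of a p q "Suc k"] Suc by simp
    moreover have "?h (1 * ?r) - ?h (0 * ?r) \<le> ?h ?r" by simp
    ultimately show ?thesis by simp
  qed
qed

text \<open>Along a solution the recursion cancels all contributions to the derivative except those
  of the last two coefficients, whose partners are cut off by the truncation.\<close>

lemma psi_partial_sum_deriv:
  assumes y: "(y has_field_derivative (poly p x * y x ^ 3 + poly q x * y x ^ 2)) (at x)"
  shows "((\<lambda>x. \<Sum>k\<le>Suc N. poly (psi a p q k) x * y x ^ k) has_field_derivative
     (of_nat N * poly p x * poly (psi a p q N) x * y x ^ (N + 2) +
      of_nat (Suc N) * poly (psi a p q (Suc N)) x * y x ^ N * (poly p x * y x ^ 3 + poly q x * y x ^ 2))) (at x)"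
proof (induction N)
  case 0
  then show ?case using y by simp
next
  case (Suc N)
  let ?d = "poly p x * y x ^ 3 + poly q x * y x ^ 2"
  have gen: "((\<lambda>x. poly f x * y x ^ Suc k) has_field_derivative
      (poly (pderiv f) x * y x ^ Suc k + of_nat (Suc k) * y x ^ k * ?d * poly f x)) (at x)" for f k
    using DERIV_mult[OF poly_DERIV[of f] DERIV_power[OF y, of "Suc k"]] by (simp add: mult_ac)
  have "((\<lambda>x. poly (psi a p q (Suc (Suc N))) x * y x ^ Suc (Suc N)) has_field_derivative
      (poly (pderiv (psi a p q (Suc (Suc N)))) x * y x ^ Suc (Suc N) +
       of_nat (Suc (Suc N)) * y x ^ Suc N * ?d * poly (psi a p q (Suc (Suc N))) x)) (at x)" by (rule gen)
  from DERIV_add[OF Suc this]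
  have 1: "((\<lambda>x. \<Sum>k\<le>Suc (Suc N). poly (psi a p q k) x * y x ^ k) has_field_derivative
     (of_nat N * poly p x * poly (psi a p q N) x * y x ^ (N + 2) +
      of_nat (Suc N) * poly (psi a p q (Suc N)) x * y x ^ N * ?d) +
     (poly (pderiv (psi a p q (Suc (Suc N)))) x * y x ^ Suc (Suc N) +
       of_nat (Suc (Suc N)) * y x ^ Suc N * ?d * poly (psi a p q (Suc (Suc N))) x)) (at x)"
    by (simp only: sum.atMost_Suc)
  have "(of_nat N * poly p x * poly (psi a p q N) x * y x ^ (N + 2) +
      of_nat (Suc N) * poly (psi a p q (Suc N)) x * y x ^ N * ?d) +
     (poly (pderiv (psi a p q (Suc (Suc N)))) x * y x ^ Suc (Suc N) +
       of_nat (Suc (Suc N)) * y x ^ Suc N * ?d * poly (psi a p q (Suc (Suc N))) x) =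
     of_nat (Suc N) * poly p x * poly (psi a p q (Suc N)) x * y x ^ (Suc N + 2) +
      of_nat (Suc (Suc N)) * poly (psi a p q (Suc (Suc N))) x * y x ^ Suc N * ?d"
    unfolding pderiv_psi poly_minus poly_add poly_mult poly_of_nat
    by (simp add: algebra_simps power2_eq_square power3_eq_cube del: psi.simps)
  with 1 show ?case by (simp only:)
qed

text \<open>Below the stated size of \<open>y\<close> each term is at most \<open>(1/2) ^ k\<close>,
  so the derivatives of the partial sums tend to 0 uniformly on \<open>S\<close>. The limit is
  therefore constant and equals its value at \<open>a\<close>.\<close>

lemma psi_first_integral:
  assumes sol: "abel_solution_on p q S y" and S: "S \<subseteq> ball a R" "convex S" "a \<in> S" "x \<in> S"
    and K: "\<And>x. x \<in> ball a R \<Longrightarrow> norm (poly p x) \<le> K \<and> norm (poly q x) \<le> K" "K \<ge> 0"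
    and small: "\<And>x. x \<in> S \<Longrightarrow> norm (y x) < 1 / (2 * (1 + 2 * K * R))"
  shows "(\<lambda>k. poly (psi a p q k) x * y x ^ k) sums (y a)"
proof -
  let ?F = "\<lambda>N x. \<Sum>k\<le>Suc N. poly (psi a p q k) x * y x ^ k"
  let ?\<rho> = "1 + 2 * K * R"
  have R: "R > 0" using S by (metis ball_eq_empty empty_iff not_le subsetD)
  have \<rho>: "?\<rho> \<ge> 1" using K(2) R by simp
  have sm: "norm (poly (psi a p q k) z) * norm (y z) ^ k \<le> (1/2) ^ k" and y1: "norm (y z) \<le> 1" if z: "z \<in> S" for z k
  proof -
    have yz: "norm (y z) \<le> 1 / (2 * ?\<rho>)" using small[OF z] by simp
    have "1 / (2 * ?\<rho>) \<le> 1" using \<rho> by simp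
    then show "norm (y z) \<le> 1" using yz by linarith
    show "norm (poly (psi a p q k) z) * norm (y z) ^ k \<le> (1/2) ^ k"
    proof (cases k)
      case (Suc j)
      have zb: "z \<in> ball a R" using z S by blast
      have "norm (poly (psi a p q k) z) \<le> (1 + 2 * K * norm (z - a)) ^ j"
        unfolding Suc by (rule psi_bound[OF K zb])
      also have "\<dots> \<le> ?\<rho> ^ j" using zb K(2) by (intro power_mono add_left_mono mult_left_mono) (auto simp: dist_norm norm_minus_commute)
      also have "\<dots> \<le> ?\<rho> ^ k" unfolding Suc using \<rho> by (intro power_increasing) auto
      finally have "norm (poly (psi a p q k) z) * norm (y z) ^ k \<le> ?\<rho> ^ k * (1 / (2 * ?\<rho>)) ^ k"
        using yz \<rho> by (intro mult_mono power_mono) auto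
      also have "\<dots> = (1/2) ^ k"
      proof -
        have "r * (1 / (2 * r)) = 1/2" if "r \<noteq> 0" for r :: real using that by simp
        then show ?thesis using \<rho> unfolding power_mult_distrib[symmetric] by (metis not_one_le_zero)
      qed
      finally show ?thesis .
    qed simp
  qed
  \<comment> \<open>The factor 3 counts the term with coefficient \<open>N\<close> and the two
    parts, with \<open>p\<close> and with \<open>q\<close>, of the term with coefficient
    \<open>Suc N\<close>.\<close>
  define b where "b N = 3 * (of_nat (Suc N) * K * (1/2) ^ N)" for N :: nat
  have der: "norm (of_nat N * poly p z * poly (psi a p q N) z * y z ^ (N + 2) +
      of_nat (Suc N) * poly (psi a p q (Suc N)) z * y z ^ N * (poly p z * y z ^ 3 + poly q z * y z ^ 2)) \<le> b N"
    if z: "z \<in> S" for z N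
  proof -
    have pq: "norm (poly p z) \<le> K" "norm (poly q z) \<le> K" using K(1) S z by blast+
    have le: "norm (y z) ^ j \<le> 1" for j using y1[OF z] by (simp add: power_le_one)
    have 1: "norm (of_nat N * poly p z * poly (psi a p q N) z * y z ^ (N + 2)) \<le> of_nat (Suc N) * K * (1/2) ^ N"
    proof -
      have "norm (of_nat N * poly p z * poly (psi a p q N) z * y z ^ (N + 2)) =
        of_nat N * norm (poly p z) * (norm (poly (psi a p q N) z) * norm (y z) ^ N) * norm (y z) ^ 2"
        by (simp add: norm_mult norm_power power_add power2_eq_square mult_ac)
      also have "\<dots> \<le> of_nat (Suc N) * K * (1/2) ^ N * 1"
        using pq K(2) sm[OF z] le by (intro mult_mono) (auto intro!: mult_nonneg_nonneg)
      finally show ?thesis by simp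
    qed
    have 2: "norm (of_nat (Suc N) * poly (psi a p q (Suc N)) z * y z ^ N * (c * y z ^ (j + 1))) \<le> of_nat (Suc N) * K * (1/2) ^ N"
      if c: "norm c \<le> K" for c j
    proof -
      have "norm (of_nat (Suc N) * poly (psi a p q (Suc N)) z * y z ^ N * (c * y z ^ (j + 1))) =
        of_nat (Suc N) * norm c * (norm (poly (psi a p q (Suc N)) z) * norm (y z) ^ Suc N) * norm (y z) ^ j"
        by (simp add: norm_mult norm_power mult_ac del: of_nat_Suc psi.simps)
      also have "\<dots> \<le> of_nat (Suc N) * K * (1/2) ^ Suc N * 1"
        using c K(2) sm[OF z] le by (intro mult_mono) (auto intro!: mult_nonneg_nonneg simp del: psi.simps power_Suc)
      also have "\<dots> \<le> of_nat (Suc N) * K * (1/2) ^ N" using K(2) by (simp add: mult_left_le)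
      finally show ?thesis .
    qed
    define A where "A = of_nat N * poly p z * poly (psi a p q N) z * y z ^ (N + 2)"
    define T1 where "T1 = of_nat (Suc N) * poly (psi a p q (Suc N)) z * y z ^ N * (poly p z * y z ^ (2 + 1))"
    define T2 where "T2 = of_nat (Suc N) * poly (psi a p q (Suc N)) z * y z ^ N * (poly q z * y z ^ (1 + 1))"
    have e: "(3::nat) = 2 + 1" "(2::nat) = 1 + 1" by simp_all
    have "of_nat (Suc N) * poly (psi a p q (Suc N)) z * y z ^ N * (poly p z * y z ^ 3 + poly q z * y z ^ 2) = T1 + T2"
      unfolding T1_def T2_def distrib_left by (simp add: power2_eq_square)
    moreover have "norm (A + (T1 + T2)) \<le> norm A + (norm T1 + norm T2)"
      by (intro norm_triangle_le add_mono norm_triangle_ineq order_refl)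
    moreover have "norm A + (norm T1 + norm T2) \<le> b N"
      using 1 2[OF pq(1), of 2] 2[OF pq(2), of 1] unfolding A_def T1_def T2_def b_def by linarith
    ultimately show ?thesis unfolding A_def by simp
  qed
  have bound: "norm (?F N x - y a) \<le> b N * norm (x - a)" for N
  proof -
    have "norm (?F N x - ?F N a) \<le> b N * norm (x - a)"
    proof (rule field_differentiable_bound[OF S(2) _ _ S(4,3)])
      fix z assume z: "z \<in> S"
      have "(y has_field_derivative (poly p z * y z ^ 3 + poly q z * y z ^ 2)) (at z)"
        using sol z unfolding abel_solution_on_def by blast
      from psi_partial_sum_deriv[OF this]
      show "(?F N has_field_derivative of_nat N * poly p z * poly (psi a p q N) z * y z ^ (N + 2) +
        of_nat (Suc N) * poly (psi a p q (Suc N)) z * y z ^ N * (poly p z * y z ^ 3 + poly q z * y z ^ 2)) (at z within S)"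
        by (rule has_field_derivative_at_within)
    qed (rule der)
    moreover have "?F N a = y a"
    proof -
      have "?F N a = (\<Sum>k\<le>Suc N. if k = 1 then y a else 0)" by (intro sum.cong refl) (simp add: psi_start)
      then show ?thesis by simp
    qed
    ultimately show ?thesis by simp
  qed
  have "b \<longlonglongrightarrow> 0"
  proof -
    have "(\<lambda>N. 3 * ((real N * (1/2) ^ N + (1/2) ^ N) * K)) \<longlonglongrightarrow> 3 * ((0 + 0) * K)"
      by (intro tendsto_intros powser_times_n_limit_0 LIMSEQ_power_zero) auto
    moreover have "b = (\<lambda>N. 3 * ((real N * (1/2) ^ N + (1/2) ^ N) * K))"
      by (rule ext) (simp add: b_def algebra_simps)
    ultimately show ?thesis by simp
  qed
  then have "(\<lambda>N. b N * norm (x - a)) \<longlonglongrightarrow> 0" using tendsto_mult_left_zero by blast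
  then have "(\<lambda>N. ?F N x - y a) \<longlonglongrightarrow> 0"
    by (rule Lim_null_comparison[OF always_eventually[OF allI[OF bound]]])
  then have "(\<lambda>N. ?F N x) \<longlonglongrightarrow> y a" by (simp only: LIM_zero_iff)
  then have "(\<lambda>N. \<Sum>k<Suc (Suc N). poly (psi a p q k) x * y x ^ k) \<longlonglongrightarrow> y a" by (simp only: lessThan_Suc_atMost)
  then have "(\<lambda>N. \<Sum>k<N. poly (psi a p q k) x * y x ^ k) \<longlonglongrightarrow> y a"
    by (rule LIMSEQ_imp_Suc[OF LIMSEQ_imp_Suc])
  then show ?thesis unfolding sums_def .
qed

section \<open>Small solutions: existence on a disc and uniqueness\<close>

lemma norm_pint_le:
  assumes "\<And>x. x \<in> ball a R \<Longrightarrow> norm (poly f x) \<le> M" "x \<in> ball a R" "M \<ge> 0"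
  shows "norm (poly (pint a f) x) \<le> M * R"
proof -
  have "a \<in> ball a R" using assms(2) by (metis centre_in_ball dist_self mem_ball not_le dual_order.strict_trans2 zero_le_dist)
  have "norm (poly (pint a f) x - poly (pint a f) a) \<le> M * norm (x - a)"
  proof (rule field_differentiable_bound[OF convex_ball _ _ assms(2) \<open>a \<in> ball a R\<close>])
    fix z assume "z \<in> ball a R"
    show "(poly (pint a f) has_field_derivative poly f z) (at z within ball a R)"
      using poly_DERIV[of "pint a f" z] by (simp add: has_field_derivative_at_within)
  qed (rule assms(1))
  also have "\<dots> \<le> M * R" using assms(2,3) by (intro mult_left_mono) (auto simp: dist_norm norm_minus_commute)
  finally show ?thesis by simp
qed

primrec picard :: "complex \<Rightarrow> complex poly \<Rightarrow> complex poly \<Rightarrow> complex \<Rightarrow> nat \<Rightarrow> complex poly" where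
  "picard a p q c 0 = [:c:]"
| "picard a p q c (Suc n) = [:c:] + pint a (p * picard a p q c n ^ 3 + q * picard a p q c n ^ 2)"

text \<open>Picard iteration with polynomial iterates. They stay below \<open>2 * norm c\<close>
  because \<open>8 * K * R * norm c\<close> is at most 1, and the hypothesis with 20 makes the
  integral operator contract by 1/2.\<close>

lemma abel_small_solution:
  assumes R: "R > 0" and K: "\<And>x. x \<in> ball a R \<Longrightarrow> norm (poly p x) \<le> K \<and> norm (poly q x) \<le> K" "K \<ge> 0"
    and c: "norm c \<le> 1/2" "20 * K * R * norm c \<le> 1"
  shows "\<exists>y. abel_solution_on p q (ball a R) y \<and> y a = c \<and> (\<forall>x\<in>ball a R. norm (y x) \<le> 2 * norm c)"
proof -
  let ?P = "picard a p q c"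
  let ?c = "norm c"
  have bd: "norm (poly (?P n) x) \<le> 2 * ?c" if "x \<in> ball a R" for n x
    using that
  proof (induction n arbitrary: x)
    case (Suc n)
    have "norm (poly (p * ?P n ^ 3 + q * ?P n ^ 2) z) \<le> 8 * K * ?c ^ 2" if z: "z \<in> ball a R" for z
    proof -
      have i: "norm (poly (?P n) z) \<le> 2 * ?c" using Suc.IH[OF z] .
      have "norm (poly (p * ?P n ^ 3 + q * ?P n ^ 2) z) \<le> K * (2 * ?c) ^ 3 + K * (2 * ?c) ^ 2"
        unfolding poly_add poly_mult poly_power using K(1)[OF z] K(2) power_mono[OF i, of 3] power_mono[OF i, of 2]
        by (intro norm_triangle_le add_mono; unfold norm_mult norm_power; intro mult_mono) simp_all
      also have "\<dots> \<le> K * (2 * ?c) ^ 2 + K * (2 * ?c) ^ 2"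
        using K(2) c(1) by (intro add_right_mono mult_left_mono power_decreasing) auto
      finally show ?thesis by (simp add: power2_eq_square)
    qed
    then have "norm (poly (pint a (p * ?P n ^ 3 + q * ?P n ^ 2)) x) \<le> 8 * K * ?c ^ 2 * R"
      using K(2) by (intro norm_pint_le Suc.prems) auto
    also have "\<dots> = (8 * K * R * ?c) * ?c" by (simp add: power2_eq_square)
    also have "\<dots> \<le> 1 * ?c"
    proof (rule mult_right_mono)
      have "0 \<le> K * R * ?c" using K(2) R by simp
      then show "8 * K * R * ?c \<le> 1" using c(2) by simp
    qed simp
    finally show ?case by (simp add: norm_triangle_le)
  qed simp
  have diff: "norm (poly (?P (Suc n)) x - poly (?P n) x) \<le> 3 * ?c * (1/2) ^ n" if "x \<in> ball a R" for n x
    using that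
  proof (induction n arbitrary: x)
    case 0
    have "norm (poly (?P (Suc 0)) x - poly (?P 0) x) \<le> norm (poly (?P (Suc 0)) x) + norm (poly (?P 0) x)"
      by (rule norm_triangle_ineq4)
    also have "\<dots> \<le> 2 * ?c + ?c" using bd[OF 0, of "Suc 0"] by (intro add_mono) simp_all
    finally show ?case by simp
  next
    case (Suc n)
    let ?g = "p * ?P (Suc n) ^ 3 + q * ?P (Suc n) ^ 2 + smult (-1) (p * ?P n ^ 3 + q * ?P n ^ 2)"
    \<comment> \<open>On arguments of norm at most \<open>2 * norm c\<close>, with
      \<open>norm c\<close> at most 1/2, the cubic part contributes \<open>6 * K * norm c\<close> to
      the Lipschitz constant and the quadratic part \<open>4 * K * norm c\<close>.\<close>
    have "norm (poly ?g z) \<le> 10 * K * ?c * (3 * ?c * (1/2) ^ n)" if z: "z \<in> ball a R" for z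
    proof -
      define u where "u = poly (?P (Suc n)) z"
      define v where "v = poly (?P n) z"
      have uv: "norm u \<le> 2 * ?c" "norm v \<le> 2 * ?c" "norm (u - v) \<le> 3 * ?c * (1/2) ^ n"
        unfolding u_def v_def using bd[OF z] Suc.IH[OF z] by (simp_all del: picard.simps)
      have geq: "poly ?g z = (poly p z * (u * u + u * v + v * v) + poly q z * (u + v)) * (u - v)"
        unfolding u_def v_def by (simp add: algebra_simps power2_eq_square power3_eq_cube del: picard.simps)
      moreover have "norm (poly p z * (u * u + u * v + v * v) + poly q z * (u + v)) \<le> 10 * K * ?c"
      proof -
        have m: "norm (s * t) \<le> 2 * ?c" if "norm s \<le> 2 * ?c" "norm t \<le> 2 * ?c" for s t :: complex
        proof -
          have "norm (s * t) \<le> (2 * ?c) * (2 * ?c)" unfolding norm_mult using that by (intro mult_mono) auto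
          also have "\<dots> \<le> (2 * ?c) * 1" using c(1) by (intro mult_left_mono) auto
          finally show ?thesis by simp
        qed
        have "norm (u * u + u * v + v * v) \<le> 2 * ?c + 2 * ?c + 2 * ?c"
          by (intro norm_triangle_le add_mono m uv)
        moreover have "norm (u + v) \<le> 2 * ?c + 2 * ?c" by (intro norm_triangle_le add_mono uv)
        ultimately have "norm (poly p z * (u * u + u * v + v * v) + poly q z * (u + v)) \<le> K * (6 * ?c) + K * (4 * ?c)"
          using K(1)[OF z] K(2) by (intro norm_triangle_le add_mono) (auto simp: norm_mult intro!: mult_mono)
        then show ?thesis by simp
      qed
      ultimately have "norm (poly p z * (u * u + u * v + v * v) + poly q z * (u + v)) * norm (u - v) \<le> 10 * K * ?c * (3 * ?c * (1/2) ^ n)"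
        using uv(3) K(2) by (intro mult_mono) auto
      then show ?thesis unfolding geq norm_mult .
    qed
    then have A: "norm (poly (pint a ?g) x) \<le> 10 * K * ?c * (3 * ?c * (1/2) ^ n) * R"
      using K(2) by (intro norm_pint_le Suc.prems) auto
    have B: "poly (?P (Suc (Suc n))) x - poly (?P (Suc n)) x = poly (pint a ?g) x"
      unfolding pint_add pint_smult by (simp add: pint_add)
    have "10 * K * ?c * (3 * ?c * (1/2) ^ n) * R \<le> 3 * ?c * (1/2) ^ Suc n"
    proof -
      have "10 * K * ?c * (3 * ?c * (1/2) ^ n) * R = (20 * K * R * ?c) * (3 * ?c * (1/2) ^ Suc n)" by simp
      also have "\<dots> \<le> 1 * (3 * ?c * (1/2) ^ Suc n)" using c(2) by (intro mult_right_mono) auto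
      finally show ?thesis by simp
    qed
    with A show ?case unfolding B by (rule order_trans)
  qed
  define y where "y x = c + (\<Sum>n. poly (?P (Suc n)) x - poly (?P n) x)" for x
  have "uniform_limit (ball a R) (\<lambda>N x. \<Sum>n<N. poly (?P (Suc n)) x - poly (?P n) x)
      (\<lambda>x. \<Sum>n. poly (?P (Suc n)) x - poly (?P n) x) sequentially"
    by (rule Weierstrass_m_test[OF diff]) (auto intro!: summable_mult)
  then have ul0: "uniform_limit (ball a R) (\<lambda>N x. c + (\<Sum>n<N. poly (?P (Suc n)) x - poly (?P n) x)) y sequentially"
    unfolding y_def by (intro uniform_limit_add uniform_limit_const)
  have tel: "c + (\<Sum>n<N. poly (?P (Suc n)) x - poly (?P n) x) = poly (?P N) x" for N x
    using sum_lessThan_telescope[of "\<lambda>n. poly (?P n) x" N] by simp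
  have ul: "uniform_limit (ball a R) (\<lambda>N x. poly (?P N) x) y sequentially" using ul0 unfolding tel .
  have lim: "(\<lambda>N. poly (?P N) x) \<longlonglongrightarrow> y x" if "x \<in> ball a R" for x using tendsto_uniform_limitI[OF ul that] .
  have ul1: "uniform_limit (ball a R) (\<lambda>N x. poly (?P (Suc N)) x) y sequentially"
    using filterlim_compose[OF ul filterlim_Suc] by simp
  have "\<exists>g'. \<forall>x\<in>ball a R. (y has_field_derivative g' x) (at x) \<and>
      ((\<lambda>n. poly (p * ?P n ^ 3 + q * ?P n ^ 2) x) \<longlonglongrightarrow> g' x)"
  proof (rule has_complex_derivative_uniform_sequence[OF open_ball])
    fix n x
    show "(poly (?P (Suc n)) has_field_derivative poly (p * ?P n ^ 3 + q * ?P n ^ 2) x) (at x)"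
    proof -
      have "pderiv (?P (Suc n)) = p * ?P n ^ 3 + q * ?P n ^ 2" by (simp add: pderiv_add pderiv_pCons)
      then show ?thesis using poly_DERIV[of "?P (Suc n)" x] by (simp only:)
    qed
  next
    fix x assume "x \<in> ball a R"
    then obtain d where "d > 0" "cball x d \<subseteq> ball a R" using open_contains_cball open_ball by metis
    then show "\<exists>d>0. cball x d \<subseteq> ball a R \<and> uniform_limit (cball x d) (\<lambda>n. poly (?P (Suc n))) y sequentially"
      by (intro exI[of _ d] conjI uniform_limit_on_subset[OF ul1])
  qed
  then obtain g' where g': "\<And>x. x \<in> ball a R \<Longrightarrow> (y has_field_derivative g' x) (at x)"
    "\<And>x. x \<in> ball a R \<Longrightarrow> (\<lambda>n. poly (p * ?P n ^ 3 + q * ?P n ^ 2) x) \<longlonglongrightarrow> g' x" by blast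
  have "g' x = poly p x * y x ^ 3 + poly q x * y x ^ 2" if x: "x \<in> ball a R" for x
  proof -
    have "(\<lambda>n. poly (p * ?P n ^ 3 + q * ?P n ^ 2) x) \<longlonglongrightarrow> poly p x * y x ^ 3 + poly q x * y x ^ 2"
      unfolding poly_add poly_mult poly_power by (intro tendsto_intros lim[OF x])
    then show ?thesis using g'(2)[OF x] LIMSEQ_unique by blast
  qed
  then have "abel_solution_on p q (ball a R) y" unfolding abel_solution_on_def using g'(1) by metis
  moreover have aR: "a \<in> ball a R" using R by simp
  moreover have "y a = c"
  proof -
    have "poly (?P N) a = c" for N by (cases N) simp_all
    then show ?thesis using lim[OF aR] LIMSEQ_unique[OF _ tendsto_const] by simp
  qed
  moreover have "norm (y x) \<le> 2 * ?c" if x: "x \<in> ball a R" for x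
    using bd[OF x] by (intro LIMSEQ_le_const2[OF tendsto_norm[OF lim[OF x]]]) auto
  ultimately show ?thesis by blast
qed

text \<open>The difference of two solutions satisfies the linear equation with coefficient
  \<open>g\<close>. Multiplication by \<open>exp (- G)\<close>, with \<open>G\<close> a primitive of
  \<open>g\<close>, makes it constant near \<open>a\<close>; the identity theorem does the
  rest.\<close>

lemma abel_uniqueness:
  assumes y: "abel_solution_on p q S y" and z: "abel_solution_on p q S z" and S: "open S" "connected S"
    and a: "a \<in> S" "y a = z a" and x: "x \<in> S"
  shows "y x = z x"
proof -
  have dy: "(y has_field_derivative (poly p t * y t ^ 3 + poly q t * y t ^ 2)) (at t)" if "t \<in> S" for t
    using y that unfolding abel_solution_on_def by blast
  have dz: "(z has_field_derivative (poly p t * z t ^ 3 + poly q t * z t ^ 2)) (at t)" if "t \<in> S" for t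
    using z that unfolding abel_solution_on_def by blast
  have hol: "y holomorphic_on S" "z holomorphic_on S"
    using dy dz S(1) by (auto simp: holomorphic_on_open)
  obtain r where r: "r > 0" "ball a r \<subseteq> S" using openE[OF S(1) a(1)] by blast
  define g where "g t = poly p t * (y t * y t + y t * z t + z t * z t) + poly q t * (y t + z t)" for t
  have hr: "y holomorphic_on ball a r" "z holomorphic_on ball a r" using hol r(2) holomorphic_on_subset by blast+
  have "g holomorphic_on ball a r" unfolding g_def by (intro holomorphic_intros hr)
  from holomorphic_convex_primitive'[OF convex_ball open_ball this]
  obtain G where "\<And>t. t \<in> ball a r \<Longrightarrow> (G has_field_derivative g t) (at t within ball a r)" by blast
  then have G: "(G has_field_derivative g t) (at t)" if "t \<in> ball a r" for t
    using that at_within_open[OF that open_ball] by metis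
  define h where "h t = (y t - z t) * exp (- G t)" for t
  have "(h has_field_derivative 0) (at t within ball a r)" if t: "t \<in> ball a r" for t
  proof -
    have tS: "t \<in> S" using t r by blast
    have "(h has_field_derivative ((poly p t * y t ^ 3 + poly q t * y t ^ 2) - (poly p t * z t ^ 3 + poly q t * z t ^ 2)) * exp (- G t)
       + exp (- G t) * (- g t) * (y t - z t)) (at t)"
      unfolding h_def by (rule derivative_eq_intros dy[OF tS] dz[OF tS] G[OF t] refl)+
    moreover have "((poly p t * y t ^ 3 + poly q t * y t ^ 2) - (poly p t * z t ^ 3 + poly q t * z t ^ 2)) * exp (- G t)
       + exp (- G t) * (- g t) * (y t - z t) = 0"
      unfolding g_def by (simp add: algebra_simps power2_eq_square power3_eq_cube)
    ultimately show ?thesis by (simp add: has_field_derivative_at_within)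
  qed
  then obtain k where k: "\<And>t. t \<in> ball a r \<Longrightarrow> h t = k" using has_field_derivative_zero_constant[OF convex_ball] by metis
  have "k = 0" using k[of a] r(1) a(2) unfolding h_def by simp
  then have eq: "y t = z t" if "t \<in> ball a r" for t using k[OF that] unfolding h_def by simp
  show ?thesis
    by (rule analytic_continuation_open[of "ball a r" S y z]) (use eq r S hol x in auto)
qed

text \<open>For each small \<open>c\<close> a solution on the disc satisfies the series identity of
  \<open>psi_first_integral\<close> at \<open>b\<close>. If \<open>y b = c\<close> always, comparing
  coefficients of a power series in \<open>c\<close> gives the equations; conversely the equations
  reduce the series to its linear term \<open>y b\<close>.\<close>

lemma abel_center_iff_psi:
  "abel_center a b p q \<longleftrightarrow> (\<forall>k\<ge>2. poly (psi a p q k) b = 0)"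
proof -
  define R where "R = norm (b - a) + 1"
  have R: "R > 0" unfolding R_def by (simp add: add_nonneg_pos)
  have ab: "a \<in> ball a R" "b \<in> ball a R" using R unfolding R_def by (auto simp: dist_norm norm_minus_commute)
  have seg: "closed_segment a b \<subseteq> ball a R" using ab by (intro closed_segment_subset) auto
  have "bounded (poly p ` cball a R \<union> poly q ` cball a R)"
    by (intro compact_imp_bounded compact_Un compact_continuous_image) (auto intro!: continuous_intros)
  then obtain K0 where K0: "\<forall>v\<in>poly p ` cball a R \<union> poly q ` cball a R. norm v \<le> K0" unfolding bounded_iff by blast
  define K where "K = max K0 0"
  have K: "norm (poly p x) \<le> K \<and> norm (poly q x) \<le> K" if "x \<in> ball a R" for x
  proof -
    have "x \<in> cball a R" using that by simp
    then have "norm (poly p x) \<le> K0" "norm (poly q x) \<le> K0" using K0 by blast+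
    then show ?thesis unfolding K_def by (simp add: le_max_iff_disj)
  qed
  have Kp: "K \<ge> 0" unfolding K_def by simp
  \<comment> \<open>Small enough for both hypotheses of \<open>abel_small_solution\<close> and for
    the bound \<open>2 * norm c\<close> to meet the requirement of
    \<open>psi_first_integral\<close>.\<close>
  define c0 where "c0 = 1 / (20 * (1 + 2 * K * R))"
  have \<rho>: "1 + 2 * K * R \<ge> 1" using Kp R by simp
  have c0: "c0 > 0" unfolding c0_def using \<rho> by simp
  have ex: "\<exists>y. abel_solution_on p q (ball a R) y \<and> y a = c \<and> (\<lambda>k. poly (psi a p q k) b * y b ^ k) sums c"
    if c: "norm c < c0" for c
  proof -
    have 1: "norm c * (20 * (1 + 2 * K * R)) < 1" using c \<rho> unfolding c0_def by (simp add: pos_less_divide_eq)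
    have KR: "0 \<le> K * R * norm c" using Kp R by simp
    have c1: "20 * norm c + 40 * (K * R * norm c) < 1" using 1 by (simp add: algebra_simps)
    then have "20 * (K * R * norm c) \<le> 1" using KR norm_ge_zero[of c] by linarith
    moreover have "norm c \<le> 1/2" using c1 KR norm_ge_zero[of c] by linarith
    ultimately have "norm c \<le> 1/2" "20 * K * R * norm c \<le> 1" by (simp_all only: mult.assoc)
    from abel_small_solution[OF R K Kp this]
    obtain y where y: "abel_solution_on p q (ball a R) y" "y a = c" "\<And>x. x \<in> ball a R \<Longrightarrow> norm (y x) \<le> 2 * norm c" by blast
    have "2 * norm c * (2 * (1 + 2 * K * R)) = 4 * norm c + 8 * (K * R * norm c)" by (simp add: algebra_simps)
    then have "2 * norm c * (2 * (1 + 2 * K * R)) < 1" using c1 KR norm_ge_zero[of c] by linarith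
    then have "2 * norm c < 1 / (2 * (1 + 2 * K * R))" using \<rho> by (simp add: pos_less_divide_eq)
    then have "norm (y x) < 1 / (2 * (1 + 2 * K * R))" if "x \<in> ball a R" for x using y(3)[OF that] by linarith
    from psi_first_integral[OF y(1) subset_refl convex_ball ab K Kp this] y show ?thesis by blast
  qed
  show ?thesis
  proof
    assume "abel_center a b p q"
    then obtain \<epsilon> where \<epsilon>: "\<epsilon> > 0" "\<And>S y. open S \<Longrightarrow> closed_segment a b \<subseteq> S \<Longrightarrow> abel_solution_on p q S y \<Longrightarrow> norm (y a) < \<epsilon> \<Longrightarrow> y a = y b"
      unfolding abel_center_def by blast
    define d where "d k = poly (psi a p q k) b - (if k = 1 then 1 else 0)" for k
    have s0: "(\<lambda>k. d k * (c - 0) ^ k) sums 0" if c: "norm (c - 0) < min c0 \<epsilon>" for c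
    proof -
      obtain y where y: "abel_solution_on p q (ball a R) y" "y a = c" "(\<lambda>k. poly (psi a p q k) b * y b ^ k) sums c"
        using ex[of c] c by auto
      have "y b = c" using \<epsilon>(2)[OF open_ball seg y(1)] y(2) c by simp
      then have 1: "(\<lambda>k. poly (psi a p q k) b * c ^ k) sums c" using y(3) by simp
      have 2: "(\<lambda>k. if k = 1 then c else 0) sums c" using sums_single[of 1 "\<lambda>_. c"] by simp
      have "(\<lambda>k. poly (psi a p q k) b * c ^ k - (if k = 1 then c else 0)) sums (c - c)" by (rule sums_diff[OF 1 2])
      moreover have "poly (psi a p q k) b * c ^ k - (if k = 1 then c else 0) = d k * (c - 0) ^ k" for k
        unfolding d_def by (simp add: algebra_simps)
      ultimately show ?thesis by simp
    qed
    have "d k = 0" if "k \<ge> 2" for k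
    proof (rule ccontr)
      assume dk: "d k \<noteq> 0"
      have r: "min c0 \<epsilon> > 0" using c0 \<epsilon>(1) by simp
      have k: "k > 0" using that by simp
      show False
      proof (rule powser_0_nonzero[where f = "\<lambda>_. 0" and \<xi> = 0, OF r s0 refl dk k])
        fix s :: real assume "0 < s" and *: "\<And>z :: complex. z \<in> cball 0 s - {0} \<Longrightarrow> (0::complex) \<noteq> 0"
        then have "of_real s \<in> cball (0::complex) s - {0}" by simp
        from *[OF this] show False by simp
      qed
    qed
    then show "\<forall>k\<ge>2. poly (psi a p q k) b = 0" unfolding d_def by auto
  next
    assume z: "\<forall>k\<ge>2. poly (psi a p q k) b = 0"
    show "abel_center a b p q" unfolding abel_center_def
    proof (intro exI[of _ c0] conjI c0 allI impI)
      fix S y0 assume S: "open S" "closed_segment a b \<subseteq> S" "abel_solution_on p q S y0" "norm (y0 a) < c0"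
      obtain y where y: "abel_solution_on p q (ball a R) y" "y a = y0 a" "(\<lambda>k. poly (psi a p q k) b * y b ^ k) sums (y0 a)"
        using ex[OF S(4)] by blast
      \<comment> \<open>An arbitrary \<open>S\<close> need not lie in the disc nor be connected; the
        component containing the segment is where the two solutions can be compared.\<close>
      define T where "T = connected_component_set (S \<inter> ball a R) a"
      have T: "open T" "connected T" "T \<subseteq> S" "T \<subseteq> ball a R"
        unfolding T_def using S(1) open_connected_component[of "S \<inter> ball a R" a] connected_component_subset[of "S \<inter> ball a R" a]
        by (auto intro: open_Int)
      have "closed_segment a b \<subseteq> T" unfolding T_def
        by (rule connected_component_maximal) (use S seg in auto)
      then have abT: "a \<in> T" "b \<in> T" by auto
      have "y0 b = y b"
        by (rule abel_uniqueness[of p q T y0 y a]) (use S y T abT in \<open>auto simp: abel_solution_on_def\<close>)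
      moreover have "(\<lambda>k. poly (psi a p q k) b * y b ^ k) = (\<lambda>k. if k = 1 then y b else 0)"
      proof
        fix k show "poly (psi a p q k) b * y b ^ k = (if k = 1 then y b else 0)"
          using z by (cases "k \<ge> 2") (auto simp: not_le less_2_cases_iff simp del: psi.simps(3))
      qed
      moreover have "(\<lambda>k. if k = 1 then y b else 0) sums y b" using sums_single[of 1 "\<lambda>_. y b"] by simp
      ultimately show "y0 a = y0 b" using y(3) sums_unique2 by metis
    qed
  qed
qed

section \<open>Expansion near infinity\<close>

text \<open>The coefficient of \<open>\<eta> ^ j\<close> in
  \<open>psi a p (smult \<eta> q) k\<close>, obtained by collecting powers of \<open>\<eta>\<close>
  in the recursion.\<close>

fun psi_coeff :: "complex \<Rightarrow> complex poly \<Rightarrow> complex poly \<Rightarrow> nat \<Rightarrow> nat \<Rightarrow> complex poly" where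
  "psi_coeff a p q j 0 = 0"
| "psi_coeff a p q j (Suc 0) = (if j = 0 then 1 else 0)"
| "psi_coeff a p q j (Suc (Suc k)) = - pint a (of_nat k * p * psi_coeff a p q j k +
     (if j = 0 then 0 else of_nat (Suc k) * q * psi_coeff a p q (j - 1) (Suc k)))"

lemma pint_sum: "pint a (\<Sum>i\<in>I. f i) = (\<Sum>i\<in>I. pint a (f i))"
  by (induction I rule: infinite_finite_induct) (simp_all add: pint_add)

lemma psi_expand:
  "k \<le> N \<Longrightarrow> psi a p (smult \<eta> q) k = (\<Sum>j<N. smult (\<eta> ^ j) (psi_coeff a p q j k))"
proof (induction k arbitrary: N rule: less_induct)
  case (less k)
  consider "k = 0" | "k = Suc 0" | m where "k = Suc (Suc m)" using not0_implies_Suc by metis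
  then show ?case
  proof cases
    case 1
    then show ?thesis by simp
  next
    case 2
    then have "N > 0" using less.prems by simp
    have "(\<Sum>j<N. smult (\<eta> ^ j) (psi_coeff a p q j k)) = (\<Sum>j<N. if j = 0 then 1 else 0)"
      unfolding 2 by (intro sum.cong refl) simp
    then show ?thesis using 2 \<open>N > 0\<close> by simp
  next
    case (3 m)
    obtain M where M: "N = Suc M" "Suc m \<le> M" using less.prems 3 by (cases N) auto
    let ?c = "psi_coeff a p q"
    have A: "psi a p (smult \<eta> q) m = (\<Sum>j<Suc M. smult (\<eta> ^ j) (?c j m))"
      using less.IH[of m "Suc M"] 3 M by simp
    have B: "psi a p (smult \<eta> q) (Suc m) = (\<Sum>j<M. smult (\<eta> ^ j) (?c j (Suc m)))"
      using less.IH[of "Suc m" M] 3 M by simp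
    have "(\<Sum>j<Suc M. smult (\<eta> ^ j) (if j = 0 then 0 else of_nat (Suc m) * q * ?c (j - 1) (Suc m)))
       = (\<Sum>j<M. smult (\<eta> ^ Suc j) (of_nat (Suc m) * q * ?c j (Suc m)))"
      unfolding sum.lessThan_Suc_shift by simp
    also have "\<dots> = of_nat (Suc m) * smult \<eta> q * (\<Sum>j<M. smult (\<eta> ^ j) (?c j (Suc m)))"
      unfolding sum_distrib_left by (intro sum.cong refl) (simp add: mult_ac)
    finally have C: "of_nat (Suc m) * smult \<eta> q * psi a p (smult \<eta> q) (Suc m) =
       (\<Sum>j<Suc M. smult (\<eta> ^ j) (if j = 0 then 0 else of_nat (Suc m) * q * ?c (j - 1) (Suc m)))"
      unfolding B by simp
    have D: "of_nat m * p * psi a p (smult \<eta> q) m = (\<Sum>j<Suc M. smult (\<eta> ^ j) (of_nat m * p * ?c j m))"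
      unfolding A sum_distrib_left by (intro sum.cong refl) (simp add: mult_ac)
    have "psi a p (smult \<eta> q) k = (\<Sum>j<Suc M. smult (\<eta> ^ j) (?c j (Suc (Suc m))))"
      unfolding 3 psi.simps C D sum.distrib[symmetric] smult_add_right[symmetric] pint_sum psi_coeff.simps pint_smult smult_minus_right sum_negf[symmetric]
      by (rule refl)
    then show ?thesis unfolding M(1) 3 .
  qed
qed

text \<open>The effect of replacing the unknown \<open>y\<close> by \<open>l * y\<close> in the
  equation, read off on the first integral normalised at \<open>a\<close>.\<close>

lemma psi_scale:
  "psi a (smult (l ^ 2) p) (smult l q) k = smult (if k = 0 then 0 else l ^ (k - 1)) (psi a p q k)"
proof (induction k rule: less_induct)
  case (less k)
  consider "k = 0" | "k = Suc 0" | m where "k = Suc (Suc m)" using not0_implies_Suc by metis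
  then show ?case
  proof cases
    case (3 m)
    have A: "of_nat m * smult (l ^ 2) p * psi a (smult (l ^ 2) p) (smult l q) m = smult (l ^ Suc m) (of_nat m * p * psi a p q m)"
      using less.IH[of m] 3 by (cases m) (simp_all add: power2_eq_square mult_ac)
    have B: "of_nat (Suc m) * smult l q * psi a (smult (l ^ 2) p) (smult l q) (Suc m)
        = smult (l ^ Suc m) (of_nat (Suc m) * q * psi a p q (Suc m))"
      using less.IH[of "Suc m"] 3 by (simp add: mult_ac)
    show ?thesis unfolding 3 psi.simps A B smult_add_right[symmetric] pint_smult by simp
  qed simp_all
qed

text \<open>Without \<open>q\<close> the equation is separable, with first integral
  \<open>y / sqrt (1 + 2 * P * y ^ 2)\<close>; these are its Taylor coefficients. The upper index
  \<open>n + 1/2\<close> is chosen to fit the Vandermonde sum in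
  \<open>psi_coeff_first\<close>.\<close>

lemma psi_coeff_zeroth:
  assumes "poly P a = 0"
  shows "psi_coeff a (pderiv P) q 0 (2 * n) = 0"
    and "psi_coeff a (pderiv P) q 0 (Suc (2 * n)) = smult ((-2) ^ n * ((of_nat n + 1/2) gchoose n) / of_nat (2 * n + 1)) (P ^ n)"
proof -
  show "psi_coeff a (pderiv P) q 0 (2 * n) = 0" by (induction n) simp_all
  define d :: "nat \<Rightarrow> complex" where "d n = (-2) ^ n * ((of_nat n + 1/2) gchoose n) / of_nat (2 * n + 1)" for n
  have d: "- (of_nat (2 * n + 1) * d n) = of_nat (Suc n) * d (Suc n)" for n
  proof -
    have "of_nat (Suc n) * ((of_nat (Suc n) + 1/2 :: complex) gchoose Suc n) = (of_nat (Suc n) + 1/2) * ((of_nat (Suc n) + 1/2 - 1) gchoose n)"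
      by (rule gbinomial_absorption)
    then have g: "of_nat (Suc n) * ((of_nat (Suc n) + 1/2 :: complex) gchoose Suc n) = (of_nat n + 3/2) * ((of_nat n + 1/2) gchoose n)"
      by (simp add: algebra_simps)
    have nz: "(of_nat (2 * n + 1) :: complex) \<noteq> 0" "(of_nat (2 * Suc n + 1) :: complex) \<noteq> 0"
      unfolding of_nat_eq_0_iff by simp_all
    have "of_nat (Suc n) * d (Suc n) = (-2) ^ Suc n * (of_nat (Suc n) * ((of_nat (Suc n) + 1/2) gchoose Suc n)) / of_nat (2 * Suc n + 1)"
      unfolding d_def by (simp only: times_divide_eq_right mult_ac)
    also have "\<dots> = (-2) ^ Suc n * ((of_nat n + 3/2) * ((of_nat n + 1/2) gchoose n)) / of_nat (2 * Suc n + 1)" unfolding g by simp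
    also have "of_nat (2 * Suc n + 1) = 2 * (of_nat n + 3/2 :: complex)" by simp
    also have "(-2) ^ Suc n * ((of_nat n + 3/2) * ((of_nat n + 1/2) gchoose n)) / (2 * (of_nat n + 3/2 :: complex)) = - ((-2) ^ n * ((of_nat n + 1/2) gchoose n))"
    proof -
      have "2 * (of_nat n + 3/2 :: complex) \<noteq> 0" using nz(2) by (simp add: add.commute)
      then show ?thesis by (simp add: divide_eq_eq)
    qed
    also have "\<dots> = - (of_nat (2 * n + 1) * d n)" unfolding d_def using nz(1) by simp
    finally show ?thesis by simp
  qed
  have "psi_coeff a (pderiv P) q 0 (Suc (2 * n)) = smult (d n) (P ^ n)" for n
  proof (induction n)
    case 0
    show ?case unfolding d_def by simp
  next
    case (Suc n)
    have "psi_coeff a (pderiv P) q 0 (Suc (2 * Suc n)) = - pint a (of_nat (2 * n + 1) * pderiv P * smult (d n) (P ^ n))"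
      using Suc by simp
    also have "\<dots> = smult (d (Suc n)) (P ^ Suc n)"
    proof -
      have "pint a (of_nat (2 * n + 1) * pderiv P * smult (d n) (P ^ n)) = - smult (d (Suc n)) (P ^ Suc n)"
      proof (rule pint_unique)
        have "pderiv (- smult (d (Suc n)) (P ^ Suc n)) = smult (- (of_nat (Suc n) * d (Suc n))) (P ^ n * pderiv P)"
          by (simp add: pderiv_minus pderiv_smult pderiv_power_Suc mult_ac del: of_nat_Suc power_Suc)
        then show "pderiv (- smult (d (Suc n)) (P ^ Suc n)) = of_nat (2 * n + 1) * pderiv P * smult (d n) (P ^ n)"
          unfolding d[symmetric] by (simp add: of_nat_poly mult_ac del: of_nat_Suc of_nat_add of_nat_mult)
      qed (use assms in simp)
      then show ?thesis by simp
    qed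
    finally show ?case .
  qed
  then show "psi_coeff a (pderiv P) q 0 (Suc (2 * n)) = smult ((-2) ^ n * ((of_nat n + 1/2) gchoose n) / of_nat (2 * n + 1)) (P ^ n)"
    unfolding d_def .
qed

text \<open>Verified by differentiation: each summand yields a term with \<open>pderiv P\<close>,
  matching the previous formula by absorption of binomials, and a multiple of
  \<open>P ^ n * q\<close>. The latter multiples add up, by Vandermonde, to the zeroth coefficient.
  At an end with \<open>P = 0\<close> only the last moment survives.\<close>

lemma psi_coeff_first:
  assumes "poly P a = 0"
  shows "psi_coeff a (pderiv P) q 1 (2 * n) =
    (\<Sum>j<n. smult (- ((-2) ^ (n - 1) * of_nat ((n - 1) choose j) * ((1/2) gchoose j))) (P ^ (n - 1 - j) * pint a (P ^ j * q)))"
proof (induction n)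
  case 0
  show ?case by simp
next
  case (Suc n)
  let ?e = "\<lambda>n j. - ((-2) ^ (n - 1) * of_nat ((n - 1) choose j) * ((1/2) gchoose j)) :: complex"
  let ?I = "\<lambda>j. pint a (P ^ j * q)"
  let ?d = "(-2) ^ n * ((of_nat n + 1/2) gchoose n) / of_nat (2 * n + 1) :: complex"
  let ?R = "\<Sum>j<Suc n. smult (?e (Suc n) j) (P ^ (n - j) * ?I j)"
  have e1: "?e (Suc n) j * of_nat (n - j) = - of_nat (2 * n) * ?e n j" if "j < n" for j
  proof -
    have "(n - j) * (n choose j) = n * ((n - 1) choose j)" using binomial_absorb_comp[of n j] by simp
    then have c: "of_nat (n choose j) * of_nat (n - j) = (of_nat n * of_nat ((n - 1) choose j) :: complex)"
      by (metis of_nat_mult mult.commute)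
    have "(-2 :: complex) ^ n = (-2) * (-2) ^ (n - 1)" using that by (cases n) simp_all
    then have "?e (Suc n) j * of_nat (n - j) = 2 * (-2) ^ (n - 1) * ((1/2) gchoose j) * (of_nat (n choose j) * of_nat (n - j))"
      by simp
    then show ?thesis unfolding c by simp
  qed
  have "(\<Sum>j\<le>n. ((1/2) gchoose j) * (of_nat n gchoose (n - j))) = ((1/2 + of_nat n) gchoose n :: complex)"
    using gbinomial_Vandermonde[of "1/2 :: complex" "of_nat n" n] by (simp only: atLeast0AtMost)
  moreover have "(of_nat n gchoose (n - j) :: complex) = of_nat (n choose j)" if "j \<le> n" for j
    using that binomial_symmetric[OF that] by (simp add: binomial_gbinomial)
  ultimately have V: "(\<Sum>j\<le>n. ((1/2) gchoose j) * of_nat (n choose j)) = ((of_nat n + 1/2) gchoose n :: complex)"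
    by (simp add: add.commute)
  have e2: "(\<Sum>j<Suc n. ?e (Suc n) j) = - (of_nat (2 * n + 1) * ?d)"
  proof -
    have "(\<Sum>j<Suc n. ?e (Suc n) j) = - ((-2) ^ n * (\<Sum>j\<le>n. ((1/2) gchoose j) * of_nat (n choose j)))"
      unfolding lessThan_Suc_atMost sum_negf sum_distrib_left by (simp add: mult_ac)
    moreover have "(of_nat (2 * n + 1) :: complex) \<noteq> 0" unfolding of_nat_eq_0_iff by simp
    ultimately show ?thesis unfolding V by simp
  qed
  have dR: "pderiv (smult c (P ^ (n - j) * ?I j)) =
      smult (c * of_nat (n - j)) (P ^ (n - 1 - j) * ?I j) * pderiv P + smult c (P ^ n * q)" if "j \<le> n" for c j
  proof -
    have A: "P ^ n = P ^ (n - j) * P ^ j" using that by (simp flip: power_add)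
    have "n - j - 1 = n - 1 - j" by simp
    then have B: "pderiv (P ^ (n - j)) = smult (of_nat (n - j)) (P ^ (n - 1 - j)) * pderiv P"
      by (simp only: pderiv_power mult_smult_left)
    show ?thesis unfolding pderiv_smult pderiv_mult B pderiv_pint A
      by (simp add: smult_add_right mult_ac)
  qed
  have "pint a (of_nat (2 * n) * pderiv P * psi_coeff a (pderiv P) q 1 (2 * n) + of_nat (2 * n + 1) * q * psi_coeff a (pderiv P) q 0 (Suc (2 * n))) = - ?R"
  proof (rule pint_unique)
    have "pderiv ?R = (\<Sum>j<Suc n. smult (?e (Suc n) j * of_nat (n - j)) (P ^ (n - 1 - j) * ?I j) * pderiv P) + (\<Sum>j<Suc n. smult (?e (Suc n) j) (P ^ n * q))"
      unfolding pderiv_sum sum.distrib[symmetric] by (intro sum.cong refl dR) simp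
    also have "(\<Sum>j<Suc n. smult (?e (Suc n) j * of_nat (n - j)) (P ^ (n - 1 - j) * ?I j) * pderiv P)
        = (\<Sum>j<n. smult (- of_nat (2 * n) * ?e n j) (P ^ (n - 1 - j) * ?I j) * pderiv P)"
    proof -
      have "(\<Sum>j<n. smult (?e (Suc n) j * of_nat (n - j)) (P ^ (n - 1 - j) * ?I j) * pderiv P)
        = (\<Sum>j<n. smult (- of_nat (2 * n) * ?e n j) (P ^ (n - 1 - j) * ?I j) * pderiv P)"
        by (intro sum.cong refl) (simp only: e1 lessThan_iff)
      then show ?thesis by simp
    qed
    also have "\<dots> = - (of_nat (2 * n) * pderiv P * psi_coeff a (pderiv P) q 1 (2 * n))"
      unfolding Suc sum_distrib_left sum_negf[symmetric] by (intro sum.cong refl) (simp add: of_nat_poly mult_ac)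
    also have "(\<Sum>j<Suc n. smult (?e (Suc n) j) (P ^ n * q)) = smult (\<Sum>j<Suc n. ?e (Suc n) j) (P ^ n * q)"
      by (simp only: smult_sum)
    also have "\<dots> = - (of_nat (2 * n + 1) * q * psi_coeff a (pderiv P) q 0 (Suc (2 * n)))"
      unfolding e2 psi_coeff_zeroth(2)[OF assms] by (simp add: of_nat_poly mult_ac del: of_nat_add of_nat_mult)
    finally show "pderiv (- ?R) = of_nat (2 * n) * pderiv P * psi_coeff a (pderiv P) q 1 (2 * n) + of_nat (2 * n + 1) * q * psi_coeff a (pderiv P) q 0 (Suc (2 * n))"
      by (simp only: pderiv_minus minus_add_distrib minus_minus)
  next
    show "poly (- ?R) a = 0" by (simp add: poly_sum)
  qed
  then have "psi_coeff a (pderiv P) q 1 (Suc (Suc (2 * n))) = ?R"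
    by (simp only: psi_coeff.simps one_neq_zero if_False diff_self_eq_0 minus_minus Suc_eq_plus1[of "2 * n", symmetric])
  moreover have "2 * Suc n = Suc (Suc (2 * n))" by simp
  ultimately show ?case by (simp only: diff_Suc_1)
qed

lemma psi_coeff_zeroth_end:
  assumes "poly P a = 0" "poly P b = 0" "k \<ge> 2"
  shows "poly (psi_coeff a (pderiv P) q 0 k) b = 0"
proof (cases "even k")
  case True
  then show ?thesis using psi_coeff_zeroth(1)[OF assms(1)] by (metis evenE poly_0)
next
  case False
  then obtain n where "k = 2 * n + 1" by (rule oddE)
  moreover from this have "n \<noteq> 0" using assms(3) by simp
  ultimately show ?thesis using psi_coeff_zeroth(2)[OF assms(1), of q n] assms(2) by simp
qed

text \<open>The constant is nonzero because \<open>1/2\<close> minus a natural number never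
  vanishes, and it does not depend on \<open>P\<close>, so it can be cancelled along a
  sequence.\<close>

lemma psi_coeff_first_end:
  "\<exists>e. e \<noteq> 0 \<and> (\<forall>P. poly P a = 0 \<longrightarrow> poly P b = 0 \<longrightarrow>
      poly (psi_coeff a (pderiv P) q 1 (2 * Suc n)) b = e * poly (pint a (P ^ n * q)) b)"
proof -
  let ?e = "- ((-2) ^ n * ((1/2) gchoose n)) :: complex"
  have "(1/2 :: complex) - of_nat i \<noteq> 0" for i
  proof
    assume "(1/2 :: complex) - of_nat i = 0"
    then have "of_nat 1 = (of_nat (2 * i) :: complex)" by (simp add: mult.commute)
    then have "1 = 2 * i" by (simp only: of_nat_eq_iff)
    then show False by presburger
  qed
  then have "((1/2 :: complex) gchoose n) \<noteq> 0" by (simp add: gbinomial_prod_rev)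
  then have "?e \<noteq> 0" by simp
  moreover have "poly (psi_coeff a (pderiv P) q 1 (2 * Suc n)) b = ?e * poly (pint a (P ^ n * q)) b"
    if P: "poly P a = 0" "poly P b = 0" for P
  proof -
    have "poly (psi_coeff a (pderiv P) q 1 (2 * Suc n)) b = (\<Sum>j<Suc n. if j = n then ?e * poly (pint a (P ^ n * q)) b else 0)"
      unfolding psi_coeff_first[OF P(1)] poly_sum by (intro sum.cong refl) (use P(2) in \<open>auto simp: zero_power\<close>)
    then show ?thesis by simp
  qed
  ultimately show "\<exists>e. e \<noteq> 0 \<and> (\<forall>P. poly P a = 0 \<longrightarrow> poly P b = 0 \<longrightarrow>
      poly (psi_coeff a (pderiv P) q 1 (2 * Suc n)) b = e * poly (pint a (P ^ n * q)) b)" by blast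
qed

section \<open>Coefficientwise convergence of polynomials of bounded degree\<close>

definition pconv :: "(nat \<Rightarrow> complex poly) \<Rightarrow> complex poly \<Rightarrow> bool" where
  "pconv X x \<longleftrightarrow> (\<exists>d. \<forall>N. degree (X N) \<le> d) \<and> (\<forall>i. (\<lambda>N. coeff (X N) i) \<longlonglongrightarrow> coeff x i)"

lemma pconvI:
  "(\<And>N. degree (X N) \<le> d) \<Longrightarrow> (\<And>i. (\<lambda>N. coeff (X N) i) \<longlonglongrightarrow> coeff x i) \<Longrightarrow> pconv X x"
  unfolding pconv_def by blast

lemma pconv_coeff: "pconv X x \<Longrightarrow> (\<lambda>N. coeff (X N) i) \<longlonglongrightarrow> coeff x i"
  unfolding pconv_def by blast

lemma pconv_degree:
  assumes "pconv X x"
  obtains d where "\<And>N. degree (X N) \<le> d" "degree x \<le> d"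
proof -
  obtain d where d: "\<And>N. degree (X N) \<le> d" using assms unfolding pconv_def by blast
  have "degree x \<le> d"
  proof (rule degree_le, intro allI impI)
    fix i assume "d < i"
    then have "(\<lambda>N. coeff (X N) i) = (\<lambda>N. 0)" using d by (intro ext coeff_eq_0) (rule le_less_trans)
    then show "coeff x i = 0" using pconv_coeff[OF assms, of i] LIMSEQ_unique tendsto_const by metis
  qed
  then show ?thesis using d that by blast
qed

lemma pconv_const: "pconv (\<lambda>N. p) p"
  by (rule pconvI[of _ "degree p"]) simp_all

lemma pconv_subseq:
  assumes "pconv X x" "strict_mono r" shows "pconv (X \<circ> r) x"
proof -
  obtain d where "\<And>N. degree (X N) \<le> d" using assms(1) unfolding pconv_def by blast
  then show ?thesis
    using LIMSEQ_subseq_LIMSEQ[OF pconv_coeff[OF assms(1)] assms(2)] by (intro pconvI[of _ d]) (simp_all add: o_def)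
qed

lemma pconv_add:
  assumes "pconv X x" "pconv Y y" shows "pconv (\<lambda>N. X N + Y N) (x + y)"
proof -
  obtain d d' where "\<And>N. degree (X N) \<le> d" "\<And>N. degree (Y N) \<le> d'" using assms unfolding pconv_def by blast
  then have "degree (X N + Y N) \<le> max d d'" for N by (meson degree_add_le max.coboundedI1 max.coboundedI2)
  then show ?thesis by (rule pconvI) (simp add: tendsto_add pconv_coeff assms)
qed

lemma pconv_mult:
  assumes "pconv X x" "pconv Y y" shows "pconv (\<lambda>N. X N * Y N) (x * y)"
proof -
  obtain d d' where "\<And>N. degree (X N) \<le> d" "\<And>N. degree (Y N) \<le> d'" using assms unfolding pconv_def by blast
  then have "degree (X N * Y N) \<le> d + d'" for N by (meson add_mono degree_mult_le order_trans)
  then show ?thesis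
    by (rule pconvI) (unfold coeff_mult, intro tendsto_sum tendsto_mult pconv_coeff assms)
qed

lemma pconv_smult:
  assumes "c \<longlonglongrightarrow> l" "pconv X x" shows "pconv (\<lambda>N. smult (c N) (X N)) (smult l x)"
proof -
  obtain d where "\<And>N. degree (X N) \<le> d" using assms(2) unfolding pconv_def by blast
  then have "degree (smult (c N) (X N)) \<le> d" for N by (meson degree_smult_le order_trans)
  then show ?thesis by (rule pconvI) (simp add: tendsto_mult pconv_coeff assms)
qed

lemma pconv_uminus: "pconv X x \<Longrightarrow> pconv (\<lambda>N. - X N) (- x)"
  using pconv_smult[OF tendsto_const[of "-1"]] by simp

lemma pconv_diff: "pconv X x \<Longrightarrow> pconv Y y \<Longrightarrow> pconv (\<lambda>N. X N - Y N) (x - y)"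
  using pconv_add[OF _ pconv_uminus, of X x Y y] by simp

lemma pconv_sum: "(\<And>i. i \<in> I \<Longrightarrow> pconv (X i) (x i)) \<Longrightarrow> pconv (\<lambda>N. \<Sum>i\<in>I. X i N) (\<Sum>i\<in>I. x i)"
  by (induction I rule: infinite_finite_induct) (simp_all add: pconv_const pconv_add)

lemma pconv_power: "pconv X x \<Longrightarrow> pconv (\<lambda>N. X N ^ n) (x ^ n)"
  by (induction n) (simp_all add: pconv_const pconv_mult)

lemma linear_poly_expand:
  fixes \<pi> :: "complex poly \<Rightarrow> complex poly"
  assumes add: "\<And>f g. \<pi> (f + g) = \<pi> f + \<pi> g" and smult: "\<And>c f. \<pi> (smult c f) = smult c (\<pi> f)"
    and deg: "degree f \<le> d"
  shows "\<pi> f = (\<Sum>i\<le>d. smult (coeff f i) (\<pi> (monom 1 i)))"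
proof -
  have "\<pi> 0 = 0" using smult[of 0 0] by simp
  then have "\<pi> (\<Sum>i\<in>I. g i) = (\<Sum>i\<in>I. \<pi> (g i))" for I :: "nat set" and g
    by (induction I rule: infinite_finite_induct) (simp_all add: add)
  moreover have "f = (\<Sum>i\<le>d. smult (coeff f i) (monom 1 i))"
    using poly_as_sum_of_monoms'[OF deg] by (simp add: smult_monom)
  ultimately show ?thesis by (metis (no_types, lifting) smult sum.cong)
qed

text \<open>On bounded degree a linear map is determined by its values on finitely many monomials,
  so it is continuous without further assumptions.\<close>

lemma pconv_linear:
  fixes \<pi> :: "complex poly \<Rightarrow> complex poly"
  assumes "\<And>f g. \<pi> (f + g) = \<pi> f + \<pi> g" "\<And>c f. \<pi> (smult c f) = smult c (\<pi> f)" "pconv X x"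
  shows "pconv (\<lambda>N. \<pi> (X N)) (\<pi> x)"
proof -
  obtain d where d: "\<And>N. degree (X N) \<le> d" "degree x \<le> d" using pconv_degree[OF assms(3)] by blast
  show ?thesis unfolding linear_poly_expand[of \<pi>, OF assms(1,2) d(1)] linear_poly_expand[of \<pi>, OF assms(1,2) d(2)]
    by (intro pconv_sum pconv_smult pconv_coeff[OF assms(3)] pconv_const)
qed

lemma pconv_pint: "pconv X x \<Longrightarrow> pconv (\<lambda>N. pint a (X N)) (pint a x)"
  by (rule pconv_linear) (rule pint_add, rule pint_smult)

lemma pconv_pderiv: "pconv X x \<Longrightarrow> pconv (\<lambda>N. pderiv (X N)) (pderiv x)"
  by (rule pconv_linear) (rule pderiv_add, rule pderiv_smult)

lemma pconv_poly:
  assumes "pconv X x" shows "(\<lambda>N. poly (X N) t) \<longlonglongrightarrow> poly x t"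
proof -
  obtain d where d: "\<And>N. degree (X N) \<le> d" "degree x \<le> d" using pconv_degree[OF assms] by blast
  have eq: "poly f t = (\<Sum>i\<le>d. coeff f i * t ^ i)" if "degree f \<le> d" for f
    by (subst poly_as_sum_of_monoms'[OF that, symmetric]) (simp add: poly_sum poly_monom)
  show ?thesis unfolding eq[OF d(1)] eq[OF d(2)] by (intro tendsto_intros pconv_coeff assms)
qed

lemma pconv_psi_coeff: "pconv X x \<Longrightarrow> pconv (\<lambda>N. psi_coeff a (X N) q j k) (psi_coeff a x q j k)"
proof (induction a x q j k rule: psi_coeff.induct)
  case (3 a x q j k)
  have "pconv (\<lambda>N. if j = 0 then 0 else of_nat (Suc k) * q * psi_coeff a (X N) q (j - 1) (Suc k))
     (if j = 0 then 0 else of_nat (Suc k) * q * psi_coeff a x q (j - 1) (Suc k))"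
    using 3 by (cases "j = 0") (auto intro!: pconv_mult pconv_const simp del: of_nat_Suc)
  then show ?case unfolding psi_coeff.simps
    by (intro pconv_uminus pconv_pint pconv_add pconv_mult pconv_const 3)
qed (simp_all add: pconv_const)

text \<open>Difference quotients with the division by \<open>s N\<close> already carried out, by
  \<open>X u - Y v = (X - Y) u + Y (u - v)\<close>. The limit \<open>e\<close> stays unidentified
  here; \<open>limit_moments_difference\<close> determines the value it needs from the explicit
  formula.\<close>

lemma psi_coeff_difference:
  assumes "pconv X x" "pconv Y y" "pconv Z z" "\<And>N. X N - Y N = smult (s N) (Z N)"
  shows "\<exists>D e. pconv D e \<and> (\<forall>N. psi_coeff a (X N) q j k - psi_coeff a (Y N) q j k = smult (s N) (D N))"
proof (induction a x q j k rule: psi_coeff.induct)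
  case (1 a x q j)
  show ?case by (intro exI[of _ "\<lambda>_. 0"] exI[of _ 0]) (simp add: pconv_const)
next
  case (2 a x q j)
  show ?case by (intro exI[of _ "\<lambda>_. 0"] exI[of _ 0]) (simp add: pconv_const)
next
  case (3 a x' q j k)
  let ?X = "\<lambda>j k N. psi_coeff a (X N) q j k" and ?Y = "\<lambda>j k N. psi_coeff a (Y N) q j k"
  obtain D e where D: "pconv D e" "\<And>N. ?X j k N - ?Y j k N = smult (s N) (D N)" using 3(1) by blast
  have "\<exists>D' e'. pconv D' e' \<and> (\<forall>N. (if j = 0 then 0 else of_nat (Suc k) * q * ?X (j - 1) (Suc k) N)
      - (if j = 0 then 0 else of_nat (Suc k) * q * ?Y (j - 1) (Suc k) N) = smult (s N) (D' N))"
  proof (cases "j = 0")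
    case True
    then show ?thesis by (intro exI[of _ "\<lambda>_. 0"] exI[of _ 0]) (simp add: pconv_const)
  next
    case False
    obtain E f where E: "pconv E f" "\<And>N. ?X (j - 1) (Suc k) N - ?Y (j - 1) (Suc k) N = smult (s N) (E N)"
      using 3(2)[OF False] by blast
    have "of_nat (Suc k) * q * ?X (j - 1) (Suc k) N - of_nat (Suc k) * q * ?Y (j - 1) (Suc k) N = smult (s N) (of_nat (Suc k) * q * E N)" for N
      unfolding right_diff_distrib[symmetric] E(2) by simp
    moreover have "pconv (\<lambda>N. of_nat (Suc k) * q * E N) (of_nat (Suc k) * q * f)" by (intro pconv_mult pconv_const E)
    ultimately show ?thesis using False by auto
  qed
  then obtain D' e' where D': "pconv D' e'" "\<And>N. (if j = 0 then 0 else of_nat (Suc k) * q * ?X (j - 1) (Suc k) N)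
      - (if j = 0 then 0 else of_nat (Suc k) * q * ?Y (j - 1) (Suc k) N) = smult (s N) (D' N)" by blast
  let ?W = "\<lambda>N. - pint a (of_nat k * (Z N * ?X j k N + Y N * D N) + D' N)"
  have "pconv ?W (- pint a (of_nat k * (z * psi_coeff a x q j k + y * e) + e'))"
    by (intro pconv_uminus pconv_pint pconv_add pconv_mult pconv_const pconv_psi_coeff assms D D')
  moreover have "?X j (Suc (Suc k)) N - ?Y j (Suc (Suc k)) N = smult (s N) (?W N)" for N
  proof -
    have "(of_nat k * X N * ?X j k N + u) - (of_nat k * Y N * ?Y j k N + v) = smult (s N) (of_nat k * (Z N * ?X j k N + Y N * D N) + D' N)"
      if "u - v = smult (s N) (D' N)" for u v
    proof -
      have "(of_nat k * X N * ?X j k N + u) - (of_nat k * Y N * ?Y j k N + v) =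
         of_nat k * ((X N - Y N) * ?X j k N + Y N * (?X j k N - ?Y j k N)) + (u - v)"
        by (simp add: algebra_simps)
      then show ?thesis unfolding that D(2) assms(4) by (simp add: smult_add_right distrib_left)
    qed
    note step = this[OF D'(2)[of N]]
    have "- pint a' f - - pint a' g = - pint a' (f - g)" for f g a'
      using pint_add[of a' f "- g"] pint_smult[of a' "-1" g] by simp
    then show ?thesis unfolding psi_coeff.simps by (simp only: step pint_smult smult_minus_right)
  qed
  ultimately show ?case by blast
qed

text \<open>After division by \<open>\<eta>\<close> only the linear term of the \<open>\<eta>\<close>-expansion survives in the limit.\<close>
lemma expansion_linear_term:
  fixes c :: "nat \<Rightarrow> nat \<Rightarrow> complex"
  assumes lim: "\<And>j. (\<lambda>N. c j N) \<longlonglongrightarrow> l j" and \<eta>: "\<eta> \<longlonglongrightarrow> 0" "\<And>N. \<eta> N \<noteq> 0"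
    and z: "\<And>N. N \<ge> N0 \<Longrightarrow> (\<Sum>j<Suc (Suc m). \<eta> N ^ j * c j N) = 0" and c0: "\<And>N. c 0 N = 0"
  shows "l 1 = 0"
proof -
  have L: "(\<lambda>N. \<Sum>j<Suc m. \<eta> N ^ j * c (Suc j) N) \<longlonglongrightarrow> (\<Sum>j<Suc m. 0 ^ j * l (Suc j))"
    by (intro tendsto_intros \<eta> lim)
  have "(\<Sum>j<Suc m. \<eta> N ^ j * c (Suc j) N) = 0" if "N \<ge> N0" for N
  proof -
    have "(\<Sum>j<Suc (Suc m). \<eta> N ^ j * c j N) = \<eta> N * (\<Sum>j<Suc m. \<eta> N ^ j * c (Suc j) N)"
      unfolding sum.lessThan_Suc_shift[of _ "Suc m"] c0 sum_distrib_left by (simp add: mult.assoc)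
    then show ?thesis using z[OF that] \<eta>(2)[of N] by simp
  qed
  then have "eventually (\<lambda>N. (\<Sum>j<Suc m. \<eta> N ^ j * c (Suc j) N) = 0) sequentially"
    by (intro eventually_sequentiallyI[of N0])
  then have "(\<lambda>N. \<Sum>j<Suc m. \<eta> N ^ j * c (Suc j) N) \<longlonglongrightarrow> 0" by (rule tendsto_eventually)
  from LIMSEQ_unique[OF L this] have "(\<Sum>j<Suc m. 0 ^ j * l (Suc j)) = 0" .
  then show ?thesis unfolding sum.lessThan_Suc_shift by simp
qed

text \<open>The equation with index \<open>2 * Suc n\<close> gives the moment with exponent
  \<open>n\<close>: its zeroth term in \<open>\<eta>\<close> vanishes at \<open>b\<close> because
  \<open>X N\<close> does, and its linear term is a nonzero multiple of that moment.\<close>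

lemma limit_moments:
  assumes X: "pconv X x" and ends: "\<And>N. poly (X N) a = 0" "\<And>N. poly (X N) b = 0"
    and \<eta>: "\<eta> \<longlonglongrightarrow> 0" "\<And>N. \<eta> N \<noteq> 0"
    and z: "\<And>N k. 2 \<le> k \<Longrightarrow> k \<le> N \<Longrightarrow> poly (psi a (pderiv (X N)) (smult (\<eta> N) (pderiv Q)) k) b = 0"
  shows "moments_vanish a b x Q"
  unfolding moments_vanish_def
proof
  fix n
  let ?k = "2 * Suc n"
  obtain e where e: "e \<noteq> 0" "\<And>P. poly P a = 0 \<Longrightarrow> poly P b = 0 \<Longrightarrow>
      poly (psi_coeff a (pderiv P) (pderiv Q) 1 ?k) b = e * poly (pint a (P ^ n * pderiv Q)) b"
    using psi_coeff_first_end[of a b "pderiv Q" n] by blast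
  have "poly (psi_coeff a (pderiv x) (pderiv Q) 1 ?k) b = 0"
  proof (rule expansion_linear_term[where c = "\<lambda>j N. poly (psi_coeff a (pderiv (X N)) (pderiv Q) j ?k) b"
        and l = "\<lambda>j. poly (psi_coeff a (pderiv x) (pderiv Q) j ?k) b" and m = "2 * n" and ?N0.0 = ?k, OF _ \<eta>])
    show "(\<lambda>N. poly (psi_coeff a (pderiv (X N)) (pderiv Q) j ?k) b) \<longlonglongrightarrow> poly (psi_coeff a (pderiv x) (pderiv Q) j ?k) b" for j
      by (intro pconv_poly pconv_psi_coeff pconv_pderiv X)
    fix N assume "?k \<le> N"
    then show "(\<Sum>j<Suc (Suc (2 * n)). \<eta> N ^ j * poly (psi_coeff a (pderiv (X N)) (pderiv Q) j ?k) b) = 0"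
      using z[of ?k N] psi_expand[of ?k "Suc (Suc (2 * n))" a "pderiv (X N)" "\<eta> N" "pderiv Q"]
      by (simp add: poly_sum del: psi.simps psi_coeff.simps)
  next
    fix N show "poly (psi_coeff a (pderiv (X N)) (pderiv Q) 0 ?k) b = 0" by (rule psi_coeff_zeroth_end[OF ends]) simp
  qed
  moreover have "poly x a = 0" "poly x b = 0"
    by (rule LIMSEQ_unique[OF pconv_poly[OF X]], simp add: ends)+
  ultimately have "e * poly (pint a (x ^ n * pderiv Q)) b = 0" using e(2) by (simp only:)
  then show "poly (pint a (x ^ n * pderiv Q)) b = 0" using e(1) by simp
qed

text \<open>Both sequences satisfy the equations, so their differences may be divided by
  \<open>s N\<close> and then by \<open>\<eta> N\<close>. What remains in the limit is the
  derivative in direction \<open>z\<close> of the moment of \<open>x ^ Suc n\<close>.\<close>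

lemma limit_moments_difference:
  assumes X: "pconv X x" "\<And>N. poly (X N) a = 0" "\<And>N. poly (X N) b = 0"
    and Y: "pconv Y x" "\<And>N. poly (Y N) a = 0" "\<And>N. poly (Y N) b = 0"
    and Z: "pconv Z z" "\<And>N. X N - Y N = smult (s N) (Z N)" "\<And>N. s N \<noteq> 0"
    and \<eta>: "\<eta> \<longlonglongrightarrow> 0" "\<And>N. \<eta> N \<noteq> 0"
    and zX: "\<And>N k. 2 \<le> k \<Longrightarrow> k \<le> N \<Longrightarrow> poly (psi a (pderiv (X N)) (smult (\<eta> N) (pderiv Q)) k) b = 0"
    and zY: "\<And>N k. 2 \<le> k \<Longrightarrow> poly (psi a (pderiv (Y N)) (smult (\<eta> N) (pderiv Q)) k) b = 0"
  shows "moments_vanish a b x (pint a (z * pderiv Q))"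
  unfolding moments_vanish_def
proof
  fix n
  let ?q = "pderiv Q"
  \<comment> \<open>One even index further than in \<open>limit_moments\<close>, since differencing
    lowers the power \<open>Suc n\<close> to \<open>n\<close>.\<close>
  define k where "k = 2 * Suc (Suc n)"
  have k_ge: "2 \<le> k" unfolding k_def by simp
  obtain e where e: "e \<noteq> 0" "\<And>P. poly P a = 0 \<Longrightarrow> poly P b = 0 \<Longrightarrow>
      poly (psi_coeff a (pderiv P) ?q 1 k) b = e * poly (pint a (P ^ Suc n * ?q)) b"
    using psi_coeff_first_end[of a b ?q "Suc n"] unfolding k_def by blast
  have "pderiv (X N) - pderiv (Y N) = smult (s N) (pderiv (Z N))" for N
    using Z(2)[of N] by (metis pderiv_diff pderiv_smult)
  then have "\<forall>j. \<exists>D e. pconv D e \<and> (\<forall>N. psi_coeff a (pderiv (X N)) ?q j k - psi_coeff a (pderiv (Y N)) ?q j k = smult (s N) (D N))"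
    using psi_coeff_difference[OF pconv_pderiv[OF X(1)] pconv_pderiv[OF Y(1)] pconv_pderiv[OF Z(1)]] by blast
  then obtain D d where D: "\<And>j. pconv (D j) (d j)"
    "\<And>j N. psi_coeff a (pderiv (X N)) ?q j k - psi_coeff a (pderiv (Y N)) ?q j k = smult (s N) (D j N)" by metis
  have d0: "poly (d 1) b = 0"
  proof (rule expansion_linear_term[where c = "\<lambda>j N. poly (D j N) b" and l = "\<lambda>j. poly (d j) b" and m = "2 * Suc n" and ?N0.0 = k, OF _ \<eta>])
    show "(\<lambda>N. poly (D j N) b) \<longlonglongrightarrow> poly (d j) b" for j by (intro pconv_poly D)
    fix N
    have Dp: "s N * poly (D j N) b = poly (psi_coeff a (pderiv (X N)) ?q j k) b - poly (psi_coeff a (pderiv (Y N)) ?q j k) b" for j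
      using arg_cong[OF D(2)[of N j, symmetric], of "\<lambda>f. poly f b"] by (simp only: poly_diff poly_smult)
    have "s N * poly (D 0 N) b = 0" unfolding Dp using psi_coeff_zeroth_end[of _ a b k ?q] X Y k_def by simp
    then show "poly (D 0 N) b = 0" using Z(3) by simp
    assume N: "k \<le> N"
    have k2: "Suc (Suc (2 * Suc n)) = k" unfolding k_def by simp
    have "s N * (\<Sum>j<k. \<eta> N ^ j * poly (D j N) b) = (\<Sum>j<k. \<eta> N ^ j * (s N * poly (D j N) b))"
      unfolding sum_distrib_left by (simp only: mult.left_commute)
    also have "\<dots> = poly (\<Sum>j<k. smult (\<eta> N ^ j) (psi_coeff a (pderiv (X N)) ?q j k)) b - poly (\<Sum>j<k. smult (\<eta> N ^ j) (psi_coeff a (pderiv (Y N)) ?q j k)) b"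
      unfolding Dp right_diff_distrib sum_subtractf by (simp add: poly_sum)
    also have "\<dots> = 0"
      using zX[of k N] zY[of k N] N k_ge unfolding psi_expand[of k k, OF order_refl] by (simp only: diff_self)
    finally show "(\<Sum>j<Suc (Suc (2 * Suc n)). \<eta> N ^ j * poly (D j N) b) = 0" using Z(3) unfolding k2 by simp
  qed
  have lim: "(\<lambda>N. poly (D 1 N) b) \<longlonglongrightarrow> e * (of_nat (Suc n) * poly (pint a (x ^ n * (z * ?q))) b)"
  proof -
    \<comment> \<open>The cofactor of \<open>X N - Y N\<close> in the difference of the powers; as
      both sequences tend to \<open>x\<close>, it tends to \<open>Suc n\<close> times
      \<open>x ^ n\<close>.\<close>
    let ?T = "\<lambda>N. \<Sum>i<Suc n. Y N ^ (Suc n - Suc i) * X N ^ i"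
    have "s N * poly (D 1 N) b = s N * (e * poly (pint a (Z N * ?T N * ?q)) b)" for N
    proof -
      have "X N ^ Suc n * ?q - Y N ^ Suc n * ?q = smult (s N) (Z N * ?T N * ?q)"
        unfolding left_diff_distrib[symmetric] power_diff_sumr2[of "X N" "Suc n" "Y N"] Z(2) by simp
      moreover have "pint a f - pint a g = pint a (f - g)" for f g
        using pint_add[of a f "- g"] pint_smult[of a "-1" g] by simp
      ultimately have "pint a (X N ^ Suc n * ?q) - pint a (Y N ^ Suc n * ?q) = smult (s N) (pint a (Z N * ?T N * ?q))"
        by (simp only: pint_smult)
      from arg_cong[OF this, of "\<lambda>f. poly f b"] have P: "poly (pint a (X N ^ Suc n * ?q)) b - poly (pint a (Y N ^ Suc n * ?q)) b = s N * poly (pint a (Z N * ?T N * ?q)) b"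
        by (simp only: poly_diff poly_smult)
      have "s N * poly (D 1 N) b = poly (psi_coeff a (pderiv (X N)) ?q 1 k) b - poly (psi_coeff a (pderiv (Y N)) ?q 1 k) b"
        using arg_cong[OF D(2)[of N 1, symmetric], of "\<lambda>f. poly f b"] by (simp only: poly_diff poly_smult)
      also have "\<dots> = e * (poly (pint a (X N ^ Suc n * ?q)) b - poly (pint a (Y N ^ Suc n * ?q)) b)"
        unfolding e(2)[OF X(2,3)] e(2)[OF Y(2,3)] by (rule right_diff_distrib[symmetric])
      finally show ?thesis unfolding P by (simp only: mult.left_commute)
    qed
    then have eq: "poly (D 1 N) b = e * poly (pint a (Z N * ?T N * ?q)) b" for N using Z(3)[of N] mult_left_cancel by blast
    have "(\<lambda>N. e * poly (pint a (Z N * ?T N * ?q)) b) \<longlonglongrightarrow> e * poly (pint a (z * (\<Sum>i<Suc n. x ^ (Suc n - Suc i) * x ^ i) * ?q)) b"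
      by (intro tendsto_mult tendsto_const pconv_poly pconv_pint pconv_mult pconv_sum pconv_power pconv_const X Y Z)
    also have "(\<Sum>i<Suc n. x ^ (Suc n - Suc i) * x ^ i) = (\<Sum>i<Suc n. x ^ n)"
      by (intro sum.cong refl) (simp flip: power_add)
    also have "z * (\<Sum>i<Suc n. x ^ n) * ?q = smult (of_nat (Suc n)) (x ^ n * (z * ?q))"
      by (simp add: of_nat_poly mult_ac del: of_nat_Suc)
    finally show ?thesis unfolding eq pint_smult by simp
  qed
  have "e * (of_nat (Suc n) * poly (pint a (x ^ n * (z * ?q))) b) = 0"
    using LIMSEQ_unique[OF pconv_poly[OF D(1)[of 1], of b] lim] unfolding d0 by (rule sym)
  then show "poly (pint a (x ^ n * pderiv (pint a (z * ?q)))) b = 0" using e(1) by (simp del: of_nat_Suc)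
qed

section \<open>Finiteness outside the composition set\<close>

definition pnorm :: "nat \<Rightarrow> complex poly \<Rightarrow> real" where
  "pnorm d p = (\<Sum>i\<le>d. norm (coeff p i))"

lemma pnorm_smult: "pnorm d (smult c p) = norm c * pnorm d p"
  unfolding pnorm_def by (simp add: norm_mult sum_distrib_left)

lemma pnorm_pos: "degree p \<le> d \<Longrightarrow> p \<noteq> 0 \<Longrightarrow> pnorm d p > 0"
  unfolding pnorm_def by (rule sum_pos2[of _ "degree p"]) simp_all

lemma norm_coeff_le_pnorm: "i \<le> d \<Longrightarrow> norm (coeff p i) \<le> pnorm d p"
  unfolding pnorm_def by (rule member_le_sum) simp_all

lemma pnorm_tendsto: "pconv X x \<Longrightarrow> (\<lambda>N. pnorm d (X N)) \<longlonglongrightarrow> pnorm d x"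
  unfolding pnorm_def by (intro tendsto_intros pconv_coeff)

lemma pconv_subsequence:
  fixes X :: "nat \<Rightarrow> complex poly"
  assumes deg: "\<And>N. degree (X N) \<le> d" and bd: "\<And>N. pnorm d (X N) \<le> K"
  obtains x r where "strict_mono r" "pconv (X \<circ> r) x"
proof -
  have "\<exists>r :: nat \<Rightarrow> nat. strict_mono r \<and> (\<forall>i<n. convergent (\<lambda>N. coeff (X (r N)) i))" if "n \<le> Suc d" for n
    using that
  proof (induction n)
    case 0
    show ?case by (intro exI[of _ id]) (simp add: strict_mono_def)
  next
    case (Suc n)
    obtain r :: "nat \<Rightarrow> nat" where r: "strict_mono r" "\<And>i. i < n \<Longrightarrow> convergent (\<lambda>N. coeff (X (r N)) i)" using Suc by auto
    have "norm (coeff (X (r N)) n) \<le> K" for N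
      using norm_coeff_le_pnorm[of n d "X (r N)"] bd[of "r N"] Suc.prems by linarith
    then have "bounded (range (\<lambda>N. coeff (X (r N)) n))" by (intro boundedI[of _ K]) auto
    then obtain l r' where r': "strict_mono (r' :: nat \<Rightarrow> nat)" "((\<lambda>N. coeff (X (r N)) n) \<circ> r') \<longlonglongrightarrow> l"
      using bounded_imp_convergent_subsequence by blast
    have "convergent (\<lambda>N. coeff (X ((r \<circ> r') N)) i)" if "i < Suc n" for i
    proof (cases "i = n")
      case True
      then show ?thesis using r'(2) unfolding convergent_def o_def by blast
    next
      case False
      then have "convergent ((\<lambda>N. coeff (X (r N)) i) \<circ> r')"
        using convergent_subseq_convergent[OF r(2) r'(1), of i] that by simp
      then show ?thesis by (simp add: o_def)
    qed
    then show ?case using strict_mono_o[OF r(1) r'(1)] by blast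
  qed
  from this[OF order_refl] obtain r :: "nat \<Rightarrow> nat" where r: "strict_mono r" "\<forall>i<Suc d. convergent (\<lambda>N. coeff (X (r N)) i)" by blast
  then have "\<forall>i. \<exists>l. i < Suc d \<longrightarrow> (\<lambda>N. coeff (X (r N)) i) \<longlonglongrightarrow> l" unfolding convergent_def by blast
  then obtain l where l: "\<And>i. i < Suc d \<Longrightarrow> (\<lambda>N. coeff (X (r N)) i) \<longlonglongrightarrow> l i" by metis
  have "pconv (X \<circ> r) (\<Sum>i\<le>d. monom (l i) i)"
  proof (rule pconvI[of _ d])
    fix i
    have c: "coeff (\<Sum>i\<le>d. monom (l i) i) i = (if i \<le> d then l i else 0)" by (simp add: coeff_sum)
    show "(\<lambda>N. coeff ((X \<circ> r) N) i) \<longlonglongrightarrow> coeff (\<Sum>i\<le>d. monom (l i) i) i"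
    proof (cases "i \<le> d")
      case True
      then show ?thesis using l[of i] unfolding c by simp
    next
      case False
      then have "coeff (X (r N)) i = 0" for N using deg[of "r N"] by (intro coeff_eq_0) simp
      then show ?thesis unfolding c using False by simp
    qed
  qed (simp add: deg)
  then show ?thesis using that r(1) by blast
qed

text \<open>\<open>L\<close> may be infinite-dimensional, so an abstract complement is used.
  Continuity comes later from \<open>pconv_linear\<close>.\<close>

lemma linear_projection:
  fixes L :: "complex poly set"
  assumes "0 \<in> L" "\<And>f g. f \<in> L \<Longrightarrow> g \<in> L \<Longrightarrow> f + g \<in> L" "\<And>c f. f \<in> L \<Longrightarrow> smult c f \<in> L"
  obtains \<pi> where "\<And>f g. \<pi> (f + g) = \<pi> f + \<pi> g" "\<And>c f. \<pi> (smult c f) = smult c (\<pi> f)"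
    "\<And>f. \<pi> f \<in> L" "\<And>f. f \<in> L \<Longrightarrow> \<pi> f = f"
proof -
  interpret vector_space "smult :: complex \<Rightarrow> complex poly \<Rightarrow> complex poly"
    by unfold_locales (simp_all add: smult_add_right smult_add_left)
  interpret vector_space_pair "smult :: complex \<Rightarrow> complex poly \<Rightarrow> complex poly" "smult :: complex \<Rightarrow> complex poly \<Rightarrow> complex poly"
    by unfold_locales
  have "subspace L" unfolding subspace_def using assms by blast
  then obtain \<pi> where \<pi>: "range \<pi> \<subseteq> L" "Vector_Spaces.linear smult smult \<pi>" "\<forall>f\<in>L. \<pi> f = f"
    using linear_exists_left_inverse_on[OF linear_ident, of L] by auto
  interpret \<pi>: Vector_Spaces.linear smult smult \<pi> by fact
  show ?thesis using that[of \<pi>] \<pi>.add \<pi>.scale \<pi>(1,3) by blast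
qed

text \<open>Divide with remainder before composing: a nonzero remainder contradicts the degrees.\<close>
lemma quotient_of_compositions:
  assumes eq: "C * pcompose f V = pcompose g V" and f: "f \<noteq> 0" and V: "degree V > 0"
  shows "\<exists>S. C = pcompose S (V :: complex poly)"
proof (rule ccontr)
  assume contra: "\<not> ?thesis"
  let ?u = "g div f" and ?v = "g mod f"
  have "pcompose g V = pcompose ?u V * pcompose f V + pcompose ?v V"
    by (metis div_mult_mod_eq pcompose_add pcompose_mult)
  then have *: "(C - pcompose ?u V) * pcompose f V = pcompose ?v V" using eq by (simp add: left_diff_distrib)
  have "C - pcompose ?u V \<noteq> 0" using contra by (metis eq_iff_diff_eq_0)
  moreover have "pcompose f V \<noteq> 0" using f V by (simp add: pcompose_eq_0_iff)
  ultimately have nz: "pcompose ?v V \<noteq> 0" and "degree (pcompose ?v V) \<ge> degree (pcompose f V)"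
    unfolding *[symmetric] by (simp_all add: degree_mult_eq)
  then have "degree ?v \<ge> degree f" using V by (simp add: degree_pcompose)
  moreover have "?v \<noteq> 0" using nz by auto
  ultimately show False using degree_mod_less'[OF f, of g] by linarith
qed

definition is_composition :: "complex \<Rightarrow> complex \<Rightarrow> complex poly \<Rightarrow> complex poly \<Rightarrow> bool" where
  "is_composition a b Q P \<longleftrightarrow> (\<exists>P' Q' W. poly W a = poly W b \<and> P = pcompose P' W \<and> Q = pcompose Q' W)"

lemma psi_composition_end:
  assumes "is_composition a b Q P" "k \<ge> 2"
  shows "poly (psi a (pderiv P) (smult c (pderiv Q)) k) b = 0"
proof -
  obtain P' Q' W where W: "poly W a = poly W b" and P: "P = pcompose P' W" and Q: "Q = pcompose Q' W"
    using assms(1) unfolding is_composition_def by blast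
  have "smult c (pderiv Q) = pderiv (pcompose (smult c Q') W)" unfolding Q by (simp add: pcompose_smult pderiv_smult)
  then show ?thesis unfolding P using psi_end_composition[OF W, of k P' "smult c Q'"] assms(2) by simp
qed

text \<open>Here \<open>X N\<close> is a solution of the first \<open>N\<close> center equations divided by its norm \<open>t\<close>, and \<open>\<eta> N\<close> is
  \<open>t\<close> to the power \<open>- 1/2\<close>.\<close>
lemma no_escape:
  assumes Q: "Q \<noteq> 0" "poly Q a = 0" "poly Q b = 0"
    and X: "\<And>N. degree (X N) \<le> d" "\<And>N. poly (X N) a = 0" "\<And>N. poly (X N) b = 0" "\<And>N. pnorm d (X N) = 1"
      "\<And>N i. coeff (X N) i \<noteq> 0 \<Longrightarrow> primepow i"
    and \<eta>: "\<eta> \<longlonglongrightarrow> 0" "\<And>N. \<eta> N \<noteq> 0"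
    and z: "\<And>N k. 2 \<le> k \<Longrightarrow> k \<le> N \<Longrightarrow> poly (psi a (pderiv (X N)) (smult (\<eta> N) (pderiv Q)) k) b = 0"
    and nc: "\<And>N. \<not> is_composition a b Q (X N)"
  shows False
proof -
  obtain x r where r: "strict_mono r" and x: "pconv (X \<circ> r) x"
    by (rule pconv_subsequence[OF X(1) eq_refl[OF X(4)]], rule that)
  have rN: "N \<le> r N" for N using r by (rule seq_suble)
  have xa: "poly x a = 0" "poly x b = 0"
    by (rule LIMSEQ_unique[OF pconv_poly[OF x]], simp add: X)+
  have nx: "pnorm d x = 1"
    by (rule LIMSEQ_unique[OF pnorm_tendsto[OF x]]) (simp add: X)
  then have x0: "x \<noteq> 0" unfolding pnorm_def by auto
  have "primepow (degree x)"
  proof (rule ccontr)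
    assume "\<not> primepow (degree x)"
    then have "coeff ((X \<circ> r) N) (degree x) = 0" for N using X(5) by auto
    then have "coeff x (degree x) = 0" using LIMSEQ_unique[OF pconv_coeff[OF x, of "degree x"], of 0] by simp
    then show False using x0 by simp
  qed
  then obtain p m where p: "prime p" "degree x = p ^ m" unfolding primepow_def by blast
  have \<eta>r: "(\<eta> \<circ> r) \<longlonglongrightarrow> 0" using LIMSEQ_subseq_LIMSEQ[OF \<eta>(1) r] .
  have zr: "poly (psi a (pderiv ((X \<circ> r) N)) (smult ((\<eta> \<circ> r) N) (pderiv Q)) k) b = 0" if "2 \<le> k" "k \<le> N" for N k
    using z[OF that(1), of "r N"] that(2) rN[of N] by simp
  have mom: "moments_vanish a b x Q"
    by (rule limit_moments[OF x _ _ \<eta>r _ zr]) (simp_all add: X \<eta>)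
  obtain V where V: "poly V a = poly V b" "degree V > 0" and
    comp: "\<And>R. R = x \<or> moments_vanish a b x R \<Longrightarrow> \<exists>R'. R = pcompose R' V"
    using moment_composition[OF p, of a b] xa by auto
  obtain Q' where Q': "Q = pcompose Q' V" using comp mom by blast
  \<comment> \<open>The normalisation at \<open>a\<close> makes members of \<open>L\<close> vanish
    at both ends, as the polynomial in the center equations has to.\<close>
  define L where "L = {pcompose R V | R. poly R (poly V a) = 0}"
  have inL: "f \<in> L" if "f = pcompose R V" "poly f a = 0" for f R using that unfolding L_def by (auto simp: poly_pcompose)
  obtain \<pi> where \<pi>: "\<And>f g. \<pi> (f + g) = \<pi> f + \<pi> g" "\<And>c f. \<pi> (smult c f) = smult c (\<pi> f)"
    "\<And>f. \<pi> f \<in> L" "\<And>f. f \<in> L \<Longrightarrow> \<pi> f = f"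
  proof (rule linear_projection[of L])
    show "0 \<in> L" by (rule inL[of _ 0]) simp_all
    show "f + g \<in> L" if fg: "f \<in> L" "g \<in> L" for f g
    proof -
      obtain R S where "f = pcompose R V" "g = pcompose S V" "poly R (poly V a) = 0" "poly S (poly V a) = 0"
        using fg unfolding L_def by blast
      then show ?thesis by (intro inL[of _ "R + S"]) (simp_all add: pcompose_add poly_pcompose)
    qed
    show "smult c f \<in> L" if f: "f \<in> L" for c f
    proof -
      obtain R where "f = pcompose R V" "poly R (poly V a) = 0" using f unfolding L_def by blast
      then show ?thesis by (intro inL[of _ "smult c R"]) (simp_all add: pcompose_smult poly_pcompose)
    qed
  qed blast
  have \<pi>_diff: "\<pi> (f - g) = \<pi> f - \<pi> g" for f g using \<pi>(1)[of f "- g"] \<pi>(2)[of "-1" g] by simp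
  have Lend: "poly f a = 0" "poly f b = 0" if "f \<in> L" for f using that V(1) unfolding L_def by (auto simp: poly_pcompose)
  have Lcomp: "is_composition a b Q f" if "f \<in> L" for f
    using that Q' V(1) unfolding L_def is_composition_def by blast
  \<comment> \<open>These share the factor \<open>V\<close> with \<open>Q\<close>, so they satisfy
    the center equations of every index, not only up to \<open>N\<close>.\<close>
  define Y where "Y N = \<pi> ((X \<circ> r) N)" for N
  define B where "B N = (X \<circ> r) N - Y N" for N
  obtain R where "x = pcompose R V" using comp by blast
  then have "\<pi> x = x" using \<pi>(4) inL xa(1) by blast
  then have Y: "pconv Y x" unfolding Y_def using pconv_linear[OF \<pi>(1,2) x] by simp
  have "pconv B (x - x)" unfolding B_def by (rule pconv_diff[OF x Y])
  \<comment> \<open>The projection need not respect the bound \<open>d\<close>, so a new degree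
    bound is taken from the convergence.\<close>
  then obtain D where D: "\<And>N. degree (B N) \<le> D" using pconv_degree by blast
  have B0: "B N \<noteq> 0" for N
  proof
    assume "B N = 0"
    then have "X (r N) \<in> L" using \<pi>(3)[of "X (r N)"] unfolding B_def Y_def by simp
    then show False using nc Lcomp by blast
  qed
  have nB: "pnorm D (B N) > 0" for N by (rule pnorm_pos[OF D B0])
  define C where "C N = smult (of_real (1 / pnorm D (B N))) (B N)" for N
  have nC: "pnorm D (C N) = 1" for N unfolding C_def pnorm_smult norm_of_real using nB[of N] by simp
  have degC: "degree (C N) \<le> D" for N unfolding C_def using D[of N] by (meson degree_smult_le order_trans)
  obtain c s where s: "strict_mono s" and c: "pconv (C \<circ> s) c"
    by (rule pconv_subsequence[OF degC eq_refl[OF nC]], rule that)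
  have Cend: "poly (C N) a = 0" "poly (C N) b = 0" for N
    unfolding C_def B_def using X(2,3) Lend[OF \<pi>(3)] by (simp_all add: Y_def)
  have c_a: "poly c a = 0" by (rule LIMSEQ_unique[OF pconv_poly[OF c]]) (simp add: Cend)
  have sN: "N \<le> s N" for N using s by (rule seq_suble)
  have mc: "moments_vanish a b x (pint a (c * pderiv Q))"
  proof (rule limit_moments_difference[where X = "X \<circ> r \<circ> s" and Y = "Y \<circ> s" and Z = "C \<circ> s"
        and s = "\<lambda>N. of_real (pnorm D (B (s N)))" and \<eta> = "\<eta> \<circ> r \<circ> s"])
    show "pconv (X \<circ> r \<circ> s) x" "pconv (Y \<circ> s) x" using pconv_subseq[OF _ s] x Y by blast+
    show "(\<eta> \<circ> r \<circ> s) \<longlonglongrightarrow> 0" using LIMSEQ_subseq_LIMSEQ[OF \<eta>r s] .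
    show "(X \<circ> r \<circ> s) N - (Y \<circ> s) N = smult (of_real (pnorm D (B (s N)))) ((C \<circ> s) N)" for N
      using nB[of "s N"] by (simp add: C_def B_def del: of_real_divide flip: of_real_mult)
    show "(of_real (pnorm D (B (s N))) :: complex) \<noteq> 0" for N using nB[of "s N"] by simp
    show "poly (psi a (pderiv ((X \<circ> r \<circ> s) N)) (smult ((\<eta> \<circ> r \<circ> s) N) (pderiv Q)) k) b = 0" if "2 \<le> k" "k \<le> N" for N k
      using zr[OF that(1), of "s N"] that(2) sN[of N] by simp
    show "poly (psi a (pderiv ((Y \<circ> s) N)) (smult ((\<eta> \<circ> r \<circ> s) N) (pderiv Q)) k) b = 0" if "2 \<le> k" for N k
      using psi_composition_end[OF Lcomp[OF \<pi>(3)] that] unfolding Y_def by simp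
  qed (use X \<eta> c Lend[OF \<pi>(3)] in \<open>simp_all add: Y_def\<close>)
  \<comment> \<open>The second use of the same \<open>V\<close>: the derivative of this primitive
    and that of \<open>Q\<close> both are a polynomial in \<open>V\<close> times
    \<open>pderiv V\<close>.\<close>
  obtain R where R: "pint a (c * pderiv Q) = pcompose R V" using comp mc by blast
  have "c * pderiv Q = pderiv (pcompose R V)" unfolding R[symmetric] by simp
  then have "(c * pcompose (pderiv Q') V) * pderiv V = pcompose (pderiv R) V * pderiv V"
    unfolding Q' pderiv_pcompose by (simp only: mult.assoc)
  moreover have "pderiv V \<noteq> 0" using V(2) by (simp add: pderiv_eq_0_iff)
  ultimately have cQ: "c * pcompose (pderiv Q') V = pcompose (pderiv R) V" by simp
  have "pderiv Q' \<noteq> 0"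
  proof
    assume "pderiv Q' = 0"
    then have "degree Q = 0" unfolding Q' by (simp add: pderiv_eq_0_iff degree_pcompose)
    then obtain u where u: "Q = [:u:]" by (rule degree_eq_zeroE)
    then show False using Q(1,2) by simp
  qed
  from quotient_of_compositions[OF cQ this V(2)] obtain S where "c = pcompose S V" by blast
  then have "\<pi> c = c" using inL c_a \<pi>(4) by blast
  \<comment> \<open>The projection annihilates every \<open>C N\<close>, and this survives the
    limit; a nonzero \<open>c\<close> cannot be both fixed and annihilated.\<close>
  moreover have "\<pi> c = 0"
  proof -
    have "\<pi> (C N) = 0" for N unfolding C_def \<pi>(2) B_def \<pi>_diff Y_def \<pi>(4)[OF \<pi>(3)] by simp
    then have "pconv (\<lambda>N. \<pi> ((C \<circ> s) N)) 0" using pconv_const[of 0] by simp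
    then have z: "(\<lambda>N. coeff (\<pi> ((C \<circ> s) N)) i) \<longlonglongrightarrow> 0" for i using pconv_coeff by force
    show ?thesis
      by (rule poly_eqI) (use LIMSEQ_unique[OF z pconv_coeff[OF pconv_linear[OF \<pi>(1,2) c]]] in simp)
  qed
  moreover have "pnorm D c = 1" by (rule LIMSEQ_unique[OF pnorm_tendsto[OF c]]) (simp add: nC)
  ultimately show False unfolding pnorm_def by simp
qed

section \<open>The center equations and composability as constructible conditions\<close>

lemma ppoly_pint:
  assumes "ppoly n F" shows "ppoly n (\<lambda>e. pint a (F e))"
proof -
  obtain d where d: "\<And>e. degree (F e) \<le> d" using assms unfolding ppoly_def by blast
  have "pint a (F e) = (\<Sum>i\<le>d. smult (coeff (F e) i) (pint a (monom 1 i)))" for e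
    by (rule linear_poly_expand[OF pint_add pint_smult d])
  then show ?thesis by (simp only:) (intro ppoly_sum ppoly_smult ppoly_const ppoly_coeff assms)
qed

lemma ppoly_psi:
  assumes "ppoly n F" shows "ppoly n (\<lambda>e. psi a (F e) q k)"
proof (induction k rule: less_induct)
  case (less k)
  consider "k = 0" | "k = Suc 0" | m where "k = Suc (Suc m)" using not0_implies_Suc by metis
  then show ?case
  proof cases
    case (3 m)
    show ?thesis unfolding 3 psi.simps
      by (intro ppoly_uminus ppoly_pint ppoly_add ppoly_mult ppoly_const assms less.IH) (simp_all add: 3)
  qed (simp_all add: ppoly_const)
qed

definition coords :: "nat \<Rightarrow> (nat \<Rightarrow> complex) \<Rightarrow> complex poly" where
  "coords n e = (\<Sum>i<n. monom (e i) i)"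

lemma coeff_coords: "coeff (coords n e) i = (if i < n then e i else 0)"
  unfolding coords_def by (simp add: coeff_sum)

lemma coords_coeff: "degree p < n \<Longrightarrow> coords n (coeff p) = p"
  by (rule poly_eqI) (simp add: coeff_coords coeff_eq_0)

lemma ppoly_coords_shift: "m + n \<le> l \<Longrightarrow> ppoly l (\<lambda>e. coords n (\<lambda>i. e (m + i)))"
  unfolding coords_def by (intro ppoly_sum ppoly_monom polyfun.var) simp

text \<open>Since \<open>Q\<close> is not constant, \<open>W\<close> and \<open>Q'\<close> are not
  either, and the degrees of all three factors are bounded by \<open>n\<close> and
  \<open>degree Q\<close>. The existential quantifiers thus range over finitely many coefficients
  and can be eliminated.\<close>

lemma constr_is_composition:
  assumes Q: "degree Q > 0"
  shows "constr n (\<lambda>e. is_composition a b Q (coords n e))"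
proof -
  define M where "M = Suc (n + degree Q)"
  \<comment> \<open>After the \<open>n\<close> given coordinates come three blocks of length
    \<open>M\<close> with the coefficients of \<open>W\<close>, of the outer factor of the given
    polynomial, and of the outer factor of \<open>Q\<close>.\<close>
  let ?W = "\<lambda>e. coords M (\<lambda>i. e (n + i))" and ?P = "\<lambda>e. coords M (\<lambda>i. e (n + M + i))" and ?Q = "\<lambda>e. coords M (\<lambda>i. e (n + 2 * M + i))"
  let ?S = "\<lambda>e. poly (?W e) a - poly (?W e) b = 0 \<and> coords n e - pcompose (?P e) (?W e) = 0 \<and> Q - pcompose (?Q e) (?W e) = 0"
  have "constr (n + 3 * M) ?S"
    by (intro constr.conj constr.eq0 constr_ppoly_eq_0 ppoly_diff polyfun_diff polyfun_poly polyfun.const ppoly_pcompose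
        ppoly_const ppoly_coords_shift ppoly_coords_shift[of 0, simplified]) simp_all
  then have "constr n (\<lambda>e. \<exists>e'. (\<forall>i<n. e' i = e i) \<and> ?S e')" by (rule constr_project_many)
  moreover have "(\<exists>e'. (\<forall>i<n. e' i = e i) \<and> ?S e') \<longleftrightarrow> is_composition a b Q (coords n e)" for e
  proof
    assume "\<exists>e'. (\<forall>i<n. e' i = e i) \<and> ?S e'"
    then obtain e' where e': "\<forall>i<n. e' i = e i" "?S e'" by blast
    then have "coords n e' = coords n e" unfolding coords_def by (intro sum.cong) simp_all
    then show "is_composition a b Q (coords n e)" unfolding is_composition_def
      using e'(2) by (intro exI[of _ "?P e'"] exI[of _ "?Q e'"] exI[of _ "?W e'"]) simp
  next
    assume "is_composition a b Q (coords n e)"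
    then obtain P' Q' W where W: "poly W a = poly W b" "coords n e = pcompose P' W" "Q = pcompose Q' W"
      unfolding is_composition_def by blast
    have dQ: "degree Q = degree Q' * degree W" unfolding W(3) by (rule degree_pcompose)
    then have dW: "degree W > 0" "degree Q' > 0" using Q by (metis mult_0_right mult_0 gr0I)+
    have "degree (coords n e) \<le> n" by (rule degree_le) (simp add: coeff_coords)
    then have "degree P' * degree W \<le> n" unfolding W(2) by (simp add: degree_pcompose)
    moreover have "degree P' * 1 \<le> degree P' * degree W" "degree Q' * 1 \<le> degree Q' * degree W" "1 * degree W \<le> degree Q' * degree W"
      using dW by (intro mult_le_mono order_refl; simp)+
    ultimately have deg: "degree P' < M" "degree Q' < M" "degree W < M" unfolding M_def dQ by linarith+
    define e' where "e' i = (if i < n then e i else if i < n + M then coeff W (i - n) else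
      if i < n + 2 * M then coeff P' (i - (n + M)) else coeff Q' (i - (n + 2 * M)))" for i
    have "?W e' = coords M (coeff W)" "?P e' = coords M (coeff P')" "?Q e' = coords M (coeff Q')" "coords n e' = coords n e"
      unfolding coords_def by (intro sum.cong refl arg_cong[where f = "\<lambda>c. monom c _"]; simp add: e'_def)+
    then have "?S e'" using W deg by (simp add: coords_coeff)
    moreover have "\<forall>i<n. e' i = e i" unfolding e'_def by simp
    ultimately show "\<exists>e'. (\<forall>i<n. e' i = e i) \<and> ?S e'" by blast
  qed
  ultimately show ?thesis by simp
qed

theorem theorem1p6:
  fixes a b :: complex and Q :: "complex poly" and d :: nat
  assumes "a \<noteq> b" and "poly Q a = 0" and "poly Q b = 0"
  shows "\<exists>F. finite F \<and> center_set a b Q d = composition_set a b Q d \<union> F"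
proof -
  have comp_iff: "P \<in> composition_set a b Q d \<longleftrightarrow> P \<in> prime_power_space a b d \<and> is_composition a b Q P" for P
    unfolding composition_set_def is_composition_def by blast
  have center_iff: "P \<in> center_set a b Q d \<longleftrightarrow>
      P \<in> prime_power_space a b d \<and> (\<forall>k\<ge>2. poly (psi a (pderiv P) (pderiv Q) k) b = 0)" for P
    unfolding center_set_def abel_center_iff_psi by blast
  have sub: "composition_set a b Q d \<subseteq> center_set a b Q d"
    using psi_composition_end[of a b Q _ _ 1] by (auto simp: comp_iff center_iff)
  have "finite (center_set a b Q d - composition_set a b Q d)"
  proof (cases "Q = 0")
    case True
    \<comment> \<open>For \<open>Q = 0\<close> the polynomial \<open>P\<close> itself serves as
      \<open>W\<close>, because it vanishes at both ends.\<close>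
    have "is_composition a b Q P" if "P \<in> prime_power_space a b d" for P
      unfolding is_composition_def using that True
      by (intro exI[of _ "[:0, 1:]"] exI[of _ 0] exI[of _ P]) (simp add: prime_power_space_def poly_space_def pcompose_pCons)
    then have "center_set a b Q d - composition_set a b Q d = {}" by (auto simp: comp_iff center_iff)
    then show ?thesis by (simp only: finite.emptyI)
  next
    case Q0: False
    have degQ: "degree Q > 0"
    proof (rule ccontr)
      assume "\<not> degree Q > 0"
      then obtain u where "Q = [:u:]" using degree_eq_zeroE by auto
      then show False using Q0 assms(2) by simp
    qed
    show ?thesis
    proof (rule ccontr)
      assume inf: "infinite (center_set a b Q d - composition_set a b Q d)"
      let ?n = "Suc d"
      define S where "S N e \<longleftrightarrow> (poly (coords ?n e) a = 0 \<and> poly (coords ?n e) b = 0) \<and> (\<forall>i\<in>{i. i < ?n \<and> \<not> primepow i}. e i = 0) \<and>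
        (\<forall>k\<in>{2..N}. poly (psi a (pderiv (coords ?n e)) (pderiv Q) k) b = 0) \<and> \<not> is_composition a b Q (coords ?n e)" for N e
      have pc: "ppoly ?n (coords ?n)" using ppoly_coords_shift[of 0 ?n ?n] by simp
      \<comment> \<open>The same \<open>N\<close> counts the equations and bounds the size from
        below, so one sequence both escapes to infinity and satisfies every equation from some index
        on.\<close>
      have "\<exists>e. S N e \<and> (\<forall>i\<ge>?n. e i = 0) \<and> (\<exists>i<?n. norm (e i) > real N)" for N
      proof (rule constr_infinite_unbounded)
        have "constr ?n (\<lambda>e. poly (coords ?n e) a = 0)" "constr ?n (\<lambda>e. poly (coords ?n e) b = 0)"
          by (intro constr.eq0 polyfun_poly[OF pc] polyfun.const)+
        moreover have "constr ?n (\<lambda>e. \<forall>i\<in>{i. i < ?n \<and> \<not> primepow i}. e i = 0)"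
          by (intro constr_ball constr.eq0 polyfun.var) auto
        moreover have "constr ?n (\<lambda>e. \<forall>k\<in>{2..N}. poly (psi a (pderiv (coords ?n e)) (pderiv Q) k) b = 0)"
          by (intro constr_ball constr.eq0 polyfun_poly ppoly_psi ppoly_pderiv pc polyfun.const) simp
        moreover have "constr ?n (\<lambda>e. \<not> is_composition a b Q (coords ?n e))"
          by (intro constr_not constr_is_composition degQ)
        ultimately show "constr ?n (S N)" unfolding S_def by (intro constr.conj)
        have "coeff ` (center_set a b Q d - composition_set a b Q d) \<subseteq> {e. S N e \<and> (\<forall>i\<ge>?n. e i = 0)}"
        proof
          fix e assume "e \<in> coeff ` (center_set a b Q d - composition_set a b Q d)"
          then obtain P where P: "e = coeff P" "P \<in> center_set a b Q d" "P \<notin> composition_set a b Q d" by blast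
          then have PP: "P \<in> prime_power_space a b d" and zP: "\<forall>k\<ge>2. poly (psi a (pderiv P) (pderiv Q) k) b = 0"
            and nc: "\<not> is_composition a b Q P" unfolding comp_iff center_iff by blast+
          have P': "degree P < ?n" "poly P a = 0" "poly P b = 0" "\<forall>i. coeff P i \<noteq> 0 \<longrightarrow> primepow i"
            using PP unfolding prime_power_space_def poly_space_def by auto
          have "coords ?n e = P" unfolding P(1) using P'(1) by (rule coords_coeff)
          moreover have "\<forall>i\<ge>?n. e i = 0" unfolding P(1) using P'(1) by (auto intro: coeff_eq_0)
          ultimately show "e \<in> {e. S N e \<and> (\<forall>i\<ge>?n. e i = 0)}" unfolding S_def using P' zP nc P(1) by auto
        qed
        moreover have "inj_on coeff (center_set a b Q d - composition_set a b Q d)"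
          by (rule inj_onI) (simp add: coeff_inject)
        ultimately show "infinite {e. S N e \<and> (\<forall>i\<ge>?n. e i = 0)}" using inf finite_imageD infinite_super by blast
      qed
      then obtain E where E: "\<And>N. S N (E N)" "\<And>N. \<exists>i<?n. norm (E N i) > real N" by metis
      define P where "P N = coords ?n (E N)" for N
      define t where "t N = pnorm d (P N)" for N
      have t: "t N > real N" for N
      proof -
        obtain i where "i < ?n" "norm (E N i) > real N" using E(2) by blast
        moreover from this have "norm (E N i) \<le> t N"
          using norm_coeff_le_pnorm[of i d "P N"] unfolding t_def P_def by (simp add: coeff_coords)
        ultimately show ?thesis by linarith
      qed
      then have t0: "t N > 0" for N by (rule le_less_trans[rotated]) simp
      \<comment> \<open>A square root, because \<open>psi_scale\<close> multiplies \<open>p\<close>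
        by \<open>l ^ 2\<close> and \<open>q\<close> by \<open>l\<close>.\<close>
      define l where "l N = complex_of_real (sqrt (t N))" for N
      have l2: "l N ^ 2 = of_real (t N)" for N unfolding l_def using t0[of N] by (simp flip: of_real_power)
      have l0: "l N \<noteq> 0" for N unfolding l_def using t0[of N] by simp
      define X where "X N = smult (1 / of_real (t N)) (P N)" for N
      have PX: "P N = smult (l N ^ 2) (X N)" for N unfolding X_def l2 using t0[of N] by simp
      have XP: "is_composition a b Q (P N)" if c: "is_composition a b Q (X N)" for N
      proof -
        obtain P' Q' W where "poly W a = poly W b" "X N = pcompose P' W" "Q = pcompose Q' W"
          using c unfolding is_composition_def by blast
        then show ?thesis unfolding is_composition_def
          by (intro exI[of _ "smult (l N ^ 2) P'"] exI[of _ Q'] exI[of _ W]) (simp add: PX pcompose_smult)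
      qed
      show False
      proof (rule no_escape[of Q a b X d "\<lambda>N. 1 / l N"])
        fix N
        have "degree (P N) \<le> d" unfolding P_def by (rule degree_le) (simp add: coeff_coords)
        then show "degree (X N) \<le> d" unfolding X_def by (meson degree_smult_le order_trans)
        show "poly (X N) a = 0" "poly (X N) b = 0" using E(1)[of N] unfolding X_def P_def S_def by simp_all
        show "pnorm d (X N) = 1" unfolding X_def pnorm_smult t_def[symmetric] norm_divide norm_of_real using t0[of N] by simp
        show "1 / l N \<noteq> 0" using l0 by simp
        show "\<not> is_composition a b Q (X N)" using E(1)[of N] XP unfolding P_def S_def by blast
      next
        fix N i assume "coeff (X N) i \<noteq> 0"
        then have "coeff (P N) i \<noteq> 0" unfolding X_def by simp
        then have "i < ?n" "E N i \<noteq> 0" unfolding P_def coeff_coords by (simp_all split: if_splits)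
        then show "primepow i" using E(1)[of N] unfolding S_def by blast
      next
        fix N k :: nat assume k: "2 \<le> k" "k \<le> N"
        \<comment> \<open>Scaling is applied to \<open>X N\<close> and \<open>Q\<close> divided by
          \<open>l N\<close>, so that the original \<open>P N\<close> and \<open>Q\<close> come
          out.\<close>
        have "psi a (smult (l N ^ 2) (pderiv (X N))) (smult (l N) (smult (1 / l N) (pderiv Q))) k =
            smult (if k = 0 then 0 else l N ^ (k - 1)) (psi a (pderiv (X N)) (smult (1 / l N) (pderiv Q)) k)"
          by (rule psi_scale)
        moreover have "smult (l N) (smult (1 / l N) (pderiv Q)) = pderiv Q" using l0[of N] by simp
        ultimately have "psi a (pderiv (P N)) (pderiv Q) k = smult (l N ^ (k - 1)) (psi a (pderiv (X N)) (smult (1 / l N) (pderiv Q)) k)"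
          using k by (simp only: PX pderiv_smult) simp
        moreover have "poly (psi a (pderiv (P N)) (pderiv Q) k) b = 0" using E(1)[of N] k unfolding P_def S_def by simp
        ultimately show "poly (psi a (pderiv (X N)) (smult (1 / l N) (pderiv Q)) k) b = 0" using l0[of N] by simp
      next
        have "filterlim t at_top sequentially"
          by (rule filterlim_at_top_mono[OF filterlim_real_sequentially]) (use t less_imp_le in \<open>auto intro!: always_eventually\<close>)
        then have "filterlim (\<lambda>N. sqrt (t N)) at_top sequentially" by (rule filterlim_compose[OF sqrt_at_top])
        then have "(\<lambda>N. inverse (sqrt (t N))) \<longlonglongrightarrow> 0" by (rule tendsto_inverse_0_at_top)
        then have "(\<lambda>N. complex_of_real (inverse (sqrt (t N)))) \<longlonglongrightarrow> of_real 0" by (rule tendsto_of_real)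
        then show "(\<lambda>N. 1 / l N) \<longlonglongrightarrow> 0" unfolding l_def by (simp add: inverse_eq_divide)
      qed (use Q0 assms in auto)
    qed
  qed
  then show ?thesis using sub by (intro exI[of _ "center_set a b Q d - composition_set a b Q d"]) blast
qed

end
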